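(* Let $\Omega\subset X$ be a nonempty open set and let $u\in \mathrm{BV}(\Omega)$. Then there exists $v\in N^{1,1}(\Omega)\cap \mathrm{Lip}_{\mathrm{loc}}(\Omega)$ such that \[ \frac{1}{\mu(B(x,r)\cap\Omega)}\int_{B(x,r)\cap \Omega}|v-u|^{s/(s-1)}\,d\mu\to 0\quad \text{as } r\to 0^+ \] uniformly for all $x\in\partial\Omega$.
   Context: Standing assumptions: $(X,d,\mu)$ is a complete metric space with a Borel regular outer measure $\mu$ that is doubling: there is $C_d\ge 1$ with $0<\mu(B(x,2r))\le C_d\,\mu(B(x,r))<\infty$ for all balls $B(x,r)=\{y\in X: d(x,y)<r\}$. A fixed exponent $s>1$ with $s\ge \log_2 C_d$ is called the homogeneous dimension; it satisfies $\mu(B(y,r))/\mu(B(x,R))\ge 4^{-s}(r/R)^s$ for all $0<r\le R$, $y\in B(x,R)$. $X$ supports a $(1,1)$-Poincaré inequality: there are $C_P>0$, $\lambda\ge 1$ such that for every ball $B(x,r)$, every $u\in L^1_{\mathrm{loc}}(X)$ and every upper gradient $g$ of $u$, $\frac{1}{\mu(B(x,r))}\int_{B(x,r)}|u-u_{B(x,r)}|\,d\mu\le C_P r\,\frac{1}{\mu(B(x,\lambda r))}\int_{B(x,\lambda r)}g\,d\mu$, where $u_B$ is the $\mu$-mean of $u$ over $B$. Functions take values in $[-\infty,\infty]$. A curve is a rectifiable continuous map from a compact interval. A nonnegative Borel function $g$ is an upper gradient of $u$ if $|u(x)-u(y)|\le\int_\gamma g\,ds$ for all nonconstant curves $\gamma$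 with end points $x,y$ (with $|u(x)-u(y)|:=\infty$ if $|u(x)|$ or $|u(y)|$ is infinite). A curve family $\Gamma$ has zero $1$-modulus if there is a nonnegative Borel $\rho\in L^1(X)$ with $\int_\gamma\rho\,ds=\infty$ for all $\gamma\in\Gamma$. A nonnegative $\mu$-measurable $g$ is a $1$-weak upper gradient of $u$ in $H\subset X$ if the upper gradient inequality holds for all curves in $H$ outside a family of zero $1$-modulus. $\|u\|_{N^{1,1}(H)}:=\|u\|_{L^1(H)}+\inf\|g\|_{L^1(H)}$ (infimum over $1$-weak upper gradients $g$ of $u$ in $H$), and $N^{1,1}(H)=\{u:\|u\|_{N^{1,1}(H)}<\infty\}$. The minimal $1$-weak upper gradient of $u$ is denoted $g_u$. $\Omega'\Subset\Omega$ means $\overline{\Omega'}$ is a compact subset of $\Omega$. Local spaces ($L^1_{\mathrm{loc}}(\Omega)$, $N^{1,1}_{\mathrm{loc}}(\Omega)$, $\mathrm{Lip}_{\mathrm{loc}}(\Omega)$) consist of functions belonging to the corresponding space on every open $\Omega'\Subset\Omega$. For $u\in L^1_{\mathrm{loc}}(\Omega)$, $\|Du\|(\Omega):=\inf\{\liminf_{i\to\infty}\int_\Omega g_{u_i}\,d\mu:\ u_i\in N^{1,1}_{\mathrm{loc}}(\Omega),\ u_i\to u \text{ in } L^1_{\mathrm{loc}}(\Omega)\}$, with $g_{u_i}$ the minimal $1$-weak upper gradient of $u_i$ in $\Omega$. $\mathrm{BV}(\Omega)$ is the set of $u\in L^1(\Omega)$ with $\|Du\|(\Omega)<\infty$. 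*)

theory Defs
  imports "HOL-Analysis.Analysis"
begin

text \<open>
  The metric space is a type of class \<open>metric_space\<close>. Functions on a subset \<open>H\<close> are rendered as total
  functions with values in \<open>ereal\<close> (nonnegative ones: in \<open>ennreal\<close>), and no notion below depends on
  the values outside \<open>H\<close>.
\<close>

subsection \<open>Borel regular outer measures\<close>

definition borel_regular_outer_measure :: "('a::metric_space set \<Rightarrow> ennreal) \<Rightarrow> bool" where
  "borel_regular_outer_measure \<mu> \<longleftrightarrow>
     outer_measure_space UNIV \<mu> \<and>
     sets borel \<subseteq> lambda_system UNIV UNIV \<mu> \<and>
     (\<forall>A. \<exists>B\<in>sets borel. A \<subseteq> B \<and> \<mu> B = \<mu> A)"

text \<open>The restriction of an outer measure to its Caratheodory-measurable sets.\<close>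

definition cmeasure :: "('a set \<Rightarrow> ennreal) \<Rightarrow> 'a measure" where
  "cmeasure \<mu> = measure_of UNIV (lambda_system UNIV UNIV \<mu>) \<mu>"

lemma
  assumes "outer_measure_space UNIV \<mu>"
  shows space_cmeasure: "space (cmeasure \<mu>) = UNIV"
    and sets_cmeasure: "sets (cmeasure \<mu>) = lambda_system UNIV UNIV \<mu>"
    and emeasure_cmeasure: "A \<in> lambda_system UNIV UNIV \<mu> \<Longrightarrow> emeasure (cmeasure \<mu>) A = \<mu> A"
proof -
  have sa: "sigma_algebra (UNIV :: 'a set) UNIV"
    using sigma_algebra_Pow[of "UNIV :: 'a set"] by simp
  have ms: "measure_space UNIV (lambda_system UNIV UNIV \<mu>) \<mu>"
    by (rule sigma_algebra.caratheodory_lemma[OF sa assms])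
  then have sl: "sigma_algebra UNIV (lambda_system UNIV UNIV \<mu>)"
    by (simp add: measure_space_def)
  show "space (cmeasure \<mu>) = UNIV"
    by (simp add: cmeasure_def space_measure_of_conv)
  show sets: "sets (cmeasure \<mu>) = lambda_system UNIV UNIV \<mu>"
    unfolding cmeasure_def by (rule sigma_algebra.sets_measure_of_eq[OF sl])
  show "emeasure (cmeasure \<mu>) A = \<mu> A" if "A \<in> lambda_system UNIV UNIV \<mu>"
    using ms that sets
    by (intro emeasure_measure_of[OF cmeasure_def]) (auto simp: measure_space_def)
qed

lemma sets_borel_subset_cmeasure:
  assumes "borel_regular_outer_measure \<mu>"
  shows "sets borel \<subseteq> sets (cmeasure \<mu>)"
  using assms by (simp add: borel_regular_outer_measure_def sets_cmeasure)

definition doubling :: "('a::metric_space set \<Rightarrow> ennreal) \<Rightarrow> real \<Rightarrow> bool" where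
  "doubling \<mu> C \<longleftrightarrow> 1 \<le> C \<and>
     (\<forall>x r. 0 < r \<longrightarrow>
        0 < \<mu> (ball x (2 * r)) \<and>
        \<mu> (ball x (2 * r)) \<le> ennreal C * \<mu> (ball x r) \<and>
        ennreal C * \<mu> (ball x r) < \<infinity>)"


subsection \<open>Curves\<close>

definition curve_length :: "real \<Rightarrow> real \<Rightarrow> (real \<Rightarrow> 'a::metric_space) \<Rightarrow> ennreal" where
  "curve_length a b \<gamma> =
     (SUP ts \<in> {ts. sorted ts \<and> set ts \<subseteq> {a..b}}.
        \<Sum>i<length ts - 1. ennreal (dist (\<gamma> (ts ! i)) (\<gamma> (ts ! Suc i))))"

text \<open>A curve \<open>(a, b, \<gamma>)\<close> is the map \<open>\<gamma>\<close> restricted to the compact interval \<open>{a..b}\<close>.\<close>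

definition curves :: "(real \<times> real \<times> (real \<Rightarrow> 'a::metric_space)) set" where
  "curves = {(a, b, \<gamma>). a \<le> b \<and> continuous_on {a..b} \<gamma> \<and> curve_length a b \<gamma> < \<infinity>}"

text \<open>
  The arc-length parametrization: \<open>\<gamma>\<close> is constant on the (closed) level sets of its length function, so
  taking the infimum of the level set is only a choice of a representative.
\<close>

definition arclength_param :: "real \<Rightarrow> real \<Rightarrow> (real \<Rightarrow> 'a::metric_space) \<Rightarrow> real \<Rightarrow> 'a" where
  "arclength_param a b \<gamma> \<tau> = \<gamma> (Inf {t \<in> {a..b}. curve_length a t \<gamma> = ennreal \<tau>})"

definition line_integral ::
  "('a::metric_space \<Rightarrow> ennreal) \<Rightarrow> real \<Rightarrow> real \<Rightarrow> (real \<Rightarrow> 'a) \<Rightarrow> ennreal" where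
  "line_integral g a b \<gamma> =
     (\<integral>\<^sup>+\<tau>\<in>{0..enn2real (curve_length a b \<gamma>)}. g (arclength_param a b \<gamma> \<tau>) \<partial>lebesgue)"

definition zero_modulus ::
  "'a::metric_space measure \<Rightarrow> (real \<times> real \<times> (real \<Rightarrow> 'a)) set \<Rightarrow> bool" where
  "zero_modulus M \<Gamma> \<longleftrightarrow> \<Gamma> \<subseteq> curves \<and>
     (\<exists>\<rho>\<in>borel_measurable borel. (\<integral>\<^sup>+x. \<rho> x \<partial>M) < \<infinity> \<and>
        (\<forall>(a, b, \<gamma>)\<in>\<Gamma>. line_integral \<rho> a b \<gamma> = \<infinity>))"


subsection \<open>Upper gradients\<close>

definition oscillation :: "('a \<Rightarrow> ereal) \<Rightarrow> 'a \<Rightarrow> 'a \<Rightarrow> ennreal" where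
  "oscillation u x y =
     (if \<bar>u x\<bar> = \<infinity> \<or> \<bar>u y\<bar> = \<infinity> then \<infinity> else e2ennreal \<bar>u x - u y\<bar>)"

definition upper_gradient :: "('a::metric_space \<Rightarrow> ereal) \<Rightarrow> ('a \<Rightarrow> ennreal) \<Rightarrow> bool" where
  "upper_gradient u g \<longleftrightarrow> g \<in> borel_measurable borel \<and>
     (\<forall>(a, b, \<gamma>)\<in>curves. \<not> \<gamma> constant_on {a..b} \<longrightarrow>
        oscillation u (\<gamma> a) (\<gamma> b) \<le> line_integral g a b \<gamma>)"

text \<open>
  For \<open>\<mu>\<close>-measurable \<open>g\<close> the integrand of \<^const>\<open>line_integral\<close> may be non-measurable (the integral then
  being a lower integral), but only for a family of curves of zero modulus, as \<open>g\<close> agrees almost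
  everywhere with a Borel function.
\<close>

definition weak_upper_gradient ::
  "'a::metric_space measure \<Rightarrow> 'a set \<Rightarrow> ('a \<Rightarrow> ereal) \<Rightarrow> ('a \<Rightarrow> ennreal) \<Rightarrow> bool" where
  "weak_upper_gradient M H u g \<longleftrightarrow> g \<in> borel_measurable (restrict_space M H) \<and>
     (\<exists>\<Gamma>. zero_modulus M \<Gamma> \<and>
        (\<forall>(a, b, \<gamma>)\<in>curves - \<Gamma>. \<gamma> ` {a..b} \<subseteq> H \<and> \<not> \<gamma> constant_on {a..b} \<longrightarrow>
           oscillation u (\<gamma> a) (\<gamma> b) \<le> line_integral g a b \<gamma>))"


subsection \<open>Function spaces\<close>

definition L1_norm :: "'a measure \<Rightarrow> 'a set \<Rightarrow> ('a \<Rightarrow> ereal) \<Rightarrow> ennreal" where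
  "L1_norm M H u = (\<integral>\<^sup>+x\<in>H. e2ennreal \<bar>u x\<bar> \<partial>M)"

definition L1 :: "'a measure \<Rightarrow> 'a set \<Rightarrow> ('a \<Rightarrow> ereal) set" where
  "L1 M H = {u \<in> borel_measurable (restrict_space M H). L1_norm M H u < \<infinity>}"

definition N11_norm :: "'a::metric_space measure \<Rightarrow> 'a set \<Rightarrow> ('a \<Rightarrow> ereal) \<Rightarrow> ennreal" where
  "N11_norm M H u =
     L1_norm M H u + (INF g \<in> {g. weak_upper_gradient M H u g}. \<integral>\<^sup>+x\<in>H. g x \<partial>M)"

definition N11 :: "'a::metric_space measure \<Rightarrow> 'a set \<Rightarrow> ('a \<Rightarrow> ereal) set" where
  "N11 M H = {u \<in> borel_measurable (restrict_space M H). N11_norm M H u < \<infinity>}"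

definition compactly_inside :: "'a::metric_space set \<Rightarrow> 'a set \<Rightarrow> bool" where
  "compactly_inside \<Omega>' \<Omega> \<longleftrightarrow> compact (closure \<Omega>') \<and> closure \<Omega>' \<subseteq> \<Omega>"

definition L1_loc :: "'a::metric_space measure \<Rightarrow> 'a set \<Rightarrow> ('a \<Rightarrow> ereal) set" where
  "L1_loc M \<Omega> = {u. \<forall>\<Omega>'. open \<Omega>' \<and> compactly_inside \<Omega>' \<Omega> \<longrightarrow> u \<in> L1 M \<Omega>'}"

definition N11_loc :: "'a::metric_space measure \<Rightarrow> 'a set \<Rightarrow> ('a \<Rightarrow> ereal) set" where
  "N11_loc M \<Omega> = {u. \<forall>\<Omega>'. open \<Omega>' \<and> compactly_inside \<Omega>' \<Omega> \<longrightarrow> u \<in> N11 M \<Omega>'}"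

definition Lip_loc :: "'a::metric_space set \<Rightarrow> ('a \<Rightarrow> real) set" where
  "Lip_loc \<Omega> = {v. \<forall>\<Omega>'. open \<Omega>' \<and> compactly_inside \<Omega>' \<Omega> \<longrightarrow> (\<exists>L. L-lipschitz_on \<Omega>' v)}"

definition converges_L1_loc ::
  "'a::metric_space measure \<Rightarrow> 'a set \<Rightarrow> (nat \<Rightarrow> 'a \<Rightarrow> ereal) \<Rightarrow> ('a \<Rightarrow> ereal) \<Rightarrow> bool" where
  "converges_L1_loc M \<Omega> w u \<longleftrightarrow>
     (\<forall>\<Omega>'. open \<Omega>' \<and> compactly_inside \<Omega>' \<Omega> \<longrightarrow>
        (\<lambda>i. L1_norm M \<Omega>' (\<lambda>x. w i x - u x)) \<longlonglongrightarrow> 0)"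


subsection \<open>The Poincare inequality\<close>

definition poincare_inequality :: "'a::metric_space measure \<Rightarrow> real \<Rightarrow> real \<Rightarrow> bool" where
  "poincare_inequality M C \<Lambda> \<longleftrightarrow> 0 < C \<and> 1 \<le> \<Lambda> \<and>
     (\<forall>x r u g. 0 < r \<and> u \<in> L1_loc M UNIV \<and> upper_gradient u g \<longrightarrow>
        (let B = ball x r;
             m = (LINT y:B|M. real_of_ereal (u y)) / measure M B
         in (\<integral>\<^sup>+y\<in>B. e2ennreal \<bar>u y - ereal m\<bar> \<partial>M) / emeasure M B
            \<le> ennreal (C * r) * ((\<integral>\<^sup>+y\<in>ball x (\<Lambda> * r). g y \<partial>M) / emeasure M (ball x (\<Lambda> * r)))))"


subsection \<open>Functions of bounded variation\<close>

text \<open>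
  Minimality is meant, as usual, almost everywhere and among the locally integrable 1-weak upper
  gradients; a minimal one is unique up to null sets.
\<close>

definition minimal_weak_upper_gradient ::
  "'a::metric_space measure \<Rightarrow> 'a set \<Rightarrow> ('a \<Rightarrow> ereal) \<Rightarrow> ('a \<Rightarrow> ennreal) \<Rightarrow> bool" where
  "minimal_weak_upper_gradient M \<Omega> u g \<longleftrightarrow>
     weak_upper_gradient M \<Omega> u g \<and> (\<lambda>x. enn2ereal (g x)) \<in> L1_loc M \<Omega> \<and>
     (\<forall>h. weak_upper_gradient M \<Omega> u h \<and> (\<lambda>x. enn2ereal (h x)) \<in> L1_loc M \<Omega> \<longrightarrow>
        (AE x in M. x \<in> \<Omega> \<longrightarrow> g x \<le> h x))"

definition total_variation :: "'a::metric_space measure \<Rightarrow> 'a set \<Rightarrow> ('a \<Rightarrow> ereal) \<Rightarrow> ennreal" where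
  "total_variation M \<Omega> u =
     Inf {liminf (\<lambda>i. \<integral>\<^sup>+x\<in>\<Omega>. g i x \<partial>M) | w g.
            (\<forall>i. w i \<in> N11_loc M \<Omega> \<and> minimal_weak_upper_gradient M \<Omega> (w i) (g i)) \<and>
            converges_L1_loc M \<Omega> w u}"

definition BV :: "'a::metric_space measure \<Rightarrow> 'a set \<Rightarrow> ('a \<Rightarrow> ereal) set" where
  "BV M \<Omega> = {u \<in> L1 M \<Omega>. total_variation M \<Omega> u < \<infinity>}"


definition ennreal_powr :: "ennreal \<Rightarrow> real \<Rightarrow> ennreal" where
  "ennreal_powr x p = (if x = \<infinity> then \<infinity> else ennreal (enn2real x powr p))"

end

theory Submission
  imports Defs
begin

text \<open>
  The function \<open>v\<close> is a convolution of \<open>u\<close> at a variable scale: \<open>v x\<close> is the average of \<open>u\<close> with weight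
  \<open>max 0 (\<rho> x - dist x y)\<close>, where the positive function \<open>\<rho>\<close> has a small Lipschitz constant and is small
  compared with the distance to the complement of \<open>\<Omega>\<close>. The Poincare inequality for an approximating
  sequence of \<open>u\<close> and an exchange of integrals show that \<open>v\<close> is locally Lipschitz with a gradient whose
  integral is bounded by a multiple of the total variation, uniformly in \<open>\<rho>\<close>. As \<open>\<rho>\<close> tends to \<open>0\<close>, the
  Sobolev inequality for these convolutions gives \<open>u\<close> in \<open>L\<^sup>q\<close> locally for \<open>q = s / (s - 1)\<close>, and therefore
  on each compact set \<open>v\<close> is as close to \<open>u\<close> in \<open>L\<^sup>q\<close> as desired if \<open>\<rho>\<close> is small enough there.
  Finally, by compactness, the measure of \<open>ball z r \<inter> \<Omega>\<close> is bounded below over all \<open>z\<close> in the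
  frontier and \<open>r \<le> 1\<close> for which the ball meets a given compact subset of \<open>\<Omega>\<close>; so the accuracy can be
  prescribed separately on the shells of a compact exhaustion, which makes the boundary limit uniform.
\<close>

subsection \<open>Rectifiable curves\<close>

text \<open>The weight is a tent and not the indicator of a ball because a plain ball average is in
  general not Lipschitz in its centre, while the tent is 1-Lipschitz in centre and radius; so
  \<open>v\<close> is smooth enough without a Whitney covering or a partition of unity. The
  Lipschitz constant of \<rho> is 1/(16 \<Lambda>): then \<rho> changes by at most a quarter on the
  balls that occur, "z is near x" and "x is near z" become interchangeable up to constants, and
  integrals can be exchanged. Only the approximants of \<open>u\<close> have gradients. The
  variation therefore enters through mean oscillations on balls, which pass to the limit under local
  L^1 convergence. Closeness of \<open>v\<close> to \<open>u\<close> in L^1 follows at once from the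
  oscillation bound; the real obstacle is L^q, which needs \<open>u\<close> to be locally
  q-integrable, that is, the endpoint Sobolev embedding. Chaining means over shrinking balls yields
  only a weak type estimate there, and truncation turns it into a strong one. Its constant must not
  depend on the scale, since it is applied to all convolutions at once. The exponent s/(s-1) comes
  from balancing the decay of volumes (at most like r^s) against the radius r in the Poincare
  inequality.\<close>

fun polygon_length :: "(real \<Rightarrow> 'a::metric_space) \<Rightarrow> real list \<Rightarrow> ennreal" where
  "polygon_length \<gamma> (x # y # zs) = ennreal (dist (\<gamma> x) (\<gamma> y)) + polygon_length \<gamma> (y # zs)"
| "polygon_length \<gamma> _ = 0"

text \<open>The recursive form permits induction on the list of breakpoints in place of index shifts
  in a sum.\<close>

lemma sum_dist_eq_polygon_length:
  "(\<Sum>i<length ts - 1. ennreal (dist (\<gamma> (ts ! i)) (\<gamma> (ts ! Suc i)))) = polygon_length \<gamma> ts"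
proof (induction \<gamma> ts rule: polygon_length.induct)
  case (1 \<gamma> x y zs)
  have "(\<Sum>i<Suc (length zs). ennreal (dist (\<gamma> ((x # y # zs) ! i)) (\<gamma> ((x # y # zs) ! Suc i))))
     = ennreal (dist (\<gamma> x) (\<gamma> y)) + (\<Sum>i<length zs. ennreal (dist (\<gamma> ((y # zs) ! i)) (\<gamma> ((y # zs) ! Suc i))))"
    by (subst sum.lessThan_Suc_shift) simp
  then show ?case using 1 by simp
qed auto

lemma curve_length_eq:
  "curve_length a b \<gamma> = (SUP ts \<in> {ts. sorted ts \<and> set ts \<subseteq> {a..b}}. polygon_length \<gamma> ts)"
  unfolding curve_length_def sum_dist_eq_polygon_length ..

lemma polygon_length_append_ge:
  "polygon_length \<gamma> xs + polygon_length \<gamma> ys \<le> polygon_length \<gamma> (xs @ ys)"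
proof (induction \<gamma> xs rule: polygon_length.induct)
  case (1 \<gamma> x y zs)
  then show ?case by (simp add: add.assoc add_left_mono)
next
  case ("2_2" \<gamma> v)
  show ?case by (cases ys) auto
qed auto

lemma polygon_length_join:
  "polygon_length \<gamma> (xs @ c # ys) = polygon_length \<gamma> (xs @ [c]) + polygon_length \<gamma> (c # ys)"
proof (induction \<gamma> xs rule: polygon_length.induct)
  case (1 \<gamma> x y zs)
  then show ?case by (simp add: add.assoc)
qed auto

lemma polygon_length_insert:
  "polygon_length \<gamma> (xs @ ys) \<le> polygon_length \<gamma> (xs @ c # ys)"
proof (induction \<gamma> xs rule: polygon_length.induct)
  case (1 \<gamma> x y zs)
  then show ?case by (simp add: add_left_mono)
next
  case ("2_1" \<gamma>)
  show ?case by (cases ys) auto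
next
  case ("2_2" \<gamma> v)
  show ?case
  proof (cases ys)
    case (Cons z zs)
    have "ennreal (dist (\<gamma> v) (\<gamma> z)) \<le> ennreal (dist (\<gamma> v) (\<gamma> c)) + ennreal (dist (\<gamma> c) (\<gamma> z))"
      by (simp flip: ennreal_plus add: dist_triangle ennreal_leI)
    then show ?thesis using Cons by (simp flip: add.assoc add: add_right_mono)
  qed simp
qed

lemma polygon_length_const:
  "(\<And>x. x \<in> set xs \<Longrightarrow> x = c) \<Longrightarrow> polygon_length \<gamma> xs = 0"
  by (induction \<gamma> xs rule: polygon_length.induct) auto

lemma polygon_length_le_curve_length:
  "sorted ts \<Longrightarrow> set ts \<subseteq> {a..b} \<Longrightarrow> polygon_length \<gamma> ts \<le> curve_length a b \<gamma>"
  unfolding curve_length_eq by (intro SUP_upper) auto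

lemma dist_le_curve_length: "a \<le> b \<Longrightarrow> ennreal (dist (\<gamma> a) (\<gamma> b)) \<le> curve_length a b \<gamma>"
  using polygon_length_le_curve_length[of "[a, b]" a b \<gamma>] by simp

lemma sorted_list_split:
  fixes ts :: "'a::linorder list"
  assumes "sorted ts"
  obtains xs ys where "ts = xs @ ys" "sorted xs" "sorted ys" "\<And>x. x \<in> set xs \<Longrightarrow> x < c" "\<And>y. y \<in> set ys \<Longrightarrow> c \<le> y"
proof -
  define xs where "xs = takeWhile (\<lambda>x. x < c) ts"
  define ys where "ys = dropWhile (\<lambda>x. x < c) ts"
  have eq: "ts = xs @ ys" by (simp add: xs_def ys_def)
  have s: "sorted xs" "sorted ys" using assms unfolding eq by (auto simp: sorted_append)
  have "x < c" if "x \<in> set xs" for x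
    using that set_takeWhileD unfolding xs_def by fastforce
  moreover have "c \<le> y" if "y \<in> set ys" for y
  proof (cases ys)
    case Nil
    then show ?thesis using that by simp
  next
    case (Cons z zs)
    then have "\<not> z < c" using hd_dropWhile[of "\<lambda>x. x < c" ts] unfolding ys_def by auto
    moreover have "z \<le> y" using that s(2) Cons by auto
    ultimately show ?thesis by auto
  qed
  ultimately show thesis using that[of xs ys] eq s by auto
qed

text \<open>Inserting \<open>c\<close> as a breakpoint gives one inequality; concatenating polygons
  of the two halves, and dropping the edge that joins them, gives the other.\<close>

lemma curve_length_add:
  assumes "a \<le> c" "c \<le> b"
  shows "curve_length a b \<gamma> = curve_length a c \<gamma> + curve_length c b \<gamma>"
proof (rule antisym)
  show "curve_length a b \<gamma> \<le> curve_length a c \<gamma> + curve_length c b \<gamma>"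
    unfolding curve_length_eq[of a b]
  proof (rule SUP_least, safe)
    fix ts assume ts: "sorted ts" "set ts \<subseteq> {a..b}"
    obtain xs ys where s: "ts = xs @ ys" "sorted xs" "sorted ys"
      "\<And>x. x \<in> set xs \<Longrightarrow> x < c" "\<And>y. y \<in> set ys \<Longrightarrow> c \<le> y"
      using sorted_list_split[OF ts(1), of c] by blast
    have "polygon_length \<gamma> ts \<le> polygon_length \<gamma> (xs @ c # ys)"
      unfolding s(1) by (rule polygon_length_insert)
    also have "\<dots> = polygon_length \<gamma> (xs @ [c]) + polygon_length \<gamma> (c # ys)"
      by (rule polygon_length_join)
    also have "\<dots> \<le> curve_length a c \<gamma> + curve_length c b \<gamma>"
      using s ts(2) assms
      by (intro add_mono polygon_length_le_curve_length) (fastforce simp: sorted_append)+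
    finally show "polygon_length \<gamma> ts \<le> curve_length a c \<gamma> + curve_length c b \<gamma>" .
  qed
  have ne: "{ts. sorted ts \<and> set ts \<subseteq> {x..y}} \<noteq> {}" for x y :: real
    by (auto intro!: exI[of _ "[]"])
  have "curve_length a c \<gamma> + polygon_length \<gamma> ys \<le> curve_length a b \<gamma>"
    if "sorted ys" "set ys \<subseteq> {c..b}" for ys
  proof -
    have "polygon_length \<gamma> xs + polygon_length \<gamma> ys \<le> curve_length a b \<gamma>"
      if "sorted xs" "set xs \<subseteq> {a..c}" for xs
    proof (rule order.trans[OF polygon_length_append_ge], rule polygon_length_le_curve_length)
      show "sorted (xs @ ys)" "set (xs @ ys) \<subseteq> {a..b}"
        using that \<open>sorted ys\<close> \<open>set ys \<subseteq> {c..b}\<close> assms by (fastforce simp: sorted_append)+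
    qed
    then show ?thesis
      unfolding curve_length_eq[of a c]
        by (subst ennreal_SUP_add_left[symmetric]) (use ne in \<open>auto intro!: SUP_least\<close>)
  qed
  then show "curve_length a c \<gamma> + curve_length c b \<gamma> \<le> curve_length a b \<gamma>"
    unfolding curve_length_eq[of c b] by (subst ennreal_SUP_add_right) (use ne in \<open>auto intro!: SUP_least\<close>)
qed

text \<open>Applied to the breakpoints of a polygon: a parameter interval shorter than the gap meets
  at most one of them.\<close>

lemma finite_set_gap:
  fixes S :: "real set"
  assumes "finite S"
  obtains g where "g > 0" "\<And>x y. x \<in> S \<Longrightarrow> y \<in> S \<Longrightarrow> \<bar>x - y\<bar> < g \<Longrightarrow> x = y"
proof -
  define D where "D = insert 1 ((\<lambda>(x, y). \<bar>x - y\<bar>) ` {(x, y) \<in> S \<times> S. x \<noteq> y})"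
  have "finite {(x, y) \<in> S \<times> S. x \<noteq> y}" using assms by (auto intro: finite_subset[of _ "S \<times> S"])
  then have fin: "finite D" by (auto simp: D_def)
  have "Min D > 0" using fin by (subst Min_gr_iff) (auto simp: D_def)
  moreover have "x = y" if "x \<in> S" "y \<in> S" "\<bar>x - y\<bar> < Min D" for x y
  proof (rule ccontr)
    assume "x \<noteq> y"
    then have "\<bar>x - y\<bar> \<in> D" using that by (auto simp: D_def)
    then show False using that(3) fin Min_le by fastforce
  qed
  ultimately show thesis using that by blast
qed

text \<open>This is the continuity of the length function. Take a polygon that misses at most e/2 of
  the total length and insert \<open>s\<close> and \<open>t\<close>. For \<open>t - s\<close> below
  the gap of its breakpoints, the part between \<open>s\<close> and \<open>t\<close> has at most two
  edges, of total length at most e/2 by uniform continuity. Additivity of the length transfers the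
  deficit e/2 to the piece from \<open>s\<close> to \<open>t\<close>.\<close>

lemma curve_length_small:
  fixes \<gamma> :: "real \<Rightarrow> 'a::metric_space"
  assumes ab: "a \<le> b" and cont: "continuous_on {a..b} \<gamma>" and fin: "curve_length a b \<gamma> < \<infinity>"
    and e: "(e::real) > 0"
  obtains d where "d > 0" "\<And>s t. a \<le> s \<Longrightarrow> s \<le> t \<Longrightarrow> t \<le> b \<Longrightarrow> t - s < d \<Longrightarrow> curve_length s t \<gamma> \<le> ennreal e"
proof -
  have "uniformly_continuous_on {a..b} \<gamma>"
    using cont compact_Icc by (rule compact_uniformly_continuous)
  then obtain d1 where d1: "d1 > 0" "\<And>s t. s \<in> {a..b} \<Longrightarrow> t \<in> {a..b} \<Longrightarrow> dist t s < d1 \<Longrightarrow> dist (\<gamma> t) (\<gamma> s) < e / 4"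
    using e unfolding uniformly_continuous_on_def by (metis zero_less_divide_iff zero_less_numeral)
  have "\<exists>ts. sorted ts \<and> set ts \<subseteq> {a..b} \<and> curve_length a b \<gamma> < polygon_length \<gamma> ts + ennreal (e/2)"
  \<comment> \<open>A curve of length 0 is served by the empty polygon; subtracting e/2 makes the
    length strictly smaller only when it is positive.\<close>
  proof (cases "curve_length a b \<gamma> = 0")
    case True
    then show ?thesis using e by (intro exI[of _ "[]"]) auto
  next
    case False
    then have "curve_length a b \<gamma> - ennreal (e/2) < curve_length a b \<gamma>"
      using fin e by (intro ennreal_between) (auto simp: zero_less_iff_neq_zero)
    then obtain ts where "sorted ts" "set ts \<subseteq> {a..b}" "curve_length a b \<gamma> - ennreal (e/2) <
       polygon_length \<gamma> ts"
      unfolding curve_length_eq less_SUP_iff by auto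
    moreover from this(3) have "curve_length a b \<gamma> < polygon_length \<gamma> ts + ennreal (e/2)"
      using fin e by (cases "curve_length a b \<gamma>"; cases "polygon_length \<gamma> ts")
        (auto simp: ennreal_minus ennreal_less_iff not_le[symmetric] le_diff_eq simp flip: ennreal_plus
           split: if_splits intro: ennreal_leI)
    ultimately show ?thesis by auto
  qed
  then obtain ts where ts: "sorted ts" "set ts \<subseteq> {a..b}" "curve_length a b \<gamma> < polygon_length \<gamma> ts +
     ennreal (e/2)"
    by auto
  obtain g where g: "g > 0" "\<And>x y. x \<in> set ts \<Longrightarrow> y \<in> set ts \<Longrightarrow> \<bar>x - y\<bar> < g \<Longrightarrow> x = y"
    using finite_set_gap[of "set ts"] by blast
  show thesis
  proof (rule that[of "min d1 g"])
    show "0 < min d1 g" using d1 g by simp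
    fix s t assume st: "a \<le> s" "s \<le> t" "t \<le> b" "t - s < min d1 g"
    obtain xs us where 1: "ts = xs @ us" "sorted xs" "sorted us" "\<And>x. x \<in> set xs \<Longrightarrow> x < s" "\<And>y. y \<in> set us \<Longrightarrow>
       s \<le> y"
      using sorted_list_split[OF ts(1), of s] by blast
    obtain zs ys where 2: "us = zs @ ys" "sorted zs" "sorted ys" "\<And>x. x \<in> set zs \<Longrightarrow> x < t" "\<And>y. y \<in> set ys \<Longrightarrow>
       t \<le> y"
      using sorted_list_split[OF 1(3), of t] by blast
    have mid: "polygon_length \<gamma> (s # zs @ [t]) \<le> ennreal (e/2)"
    proof (cases zs)
      case Nil
      then show ?thesis using d1(2)[of s t] st e
        by (auto simp: dist_commute dist_real_def intro!: ennreal_leI)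
    next
      \<comment> \<open>Sorted lists may repeat entries. All of \<open>zs\<close> lies in an
        interval shorter than the gap, so it consists of copies of \<open>z\<close>, and the edges
        between them vanish.\<close>
      case (Cons z zs')
      have eq: "x = z" if "x \<in> set zs" for x
        using that Cons 1 2 st by (intro g(2)) (force simp: abs_less_iff)+
      have z: "s \<le> z" "z < t" using Cons 1 2 by auto
      have nonempty: "zs \<noteq> []" using Cons by simp
      have zz: "last zs = z" using eq Cons last_in_set[of zs] by auto
      have "polygon_length \<gamma> (s # zs @ [t]) = ennreal (dist (\<gamma> s) (\<gamma> z)) + polygon_length \<gamma> (zs @ [t])"
        using Cons by simp
      also have "polygon_length \<gamma> (zs @ [t]) = polygon_length \<gamma> (butlast zs @ last zs # [t])"
        using Cons by (metis append.assoc append_Cons append_Nil append_butlast_last_id list.distinct(1))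
      also have "\<dots> = polygon_length \<gamma> (butlast zs @ [last zs]) + polygon_length \<gamma> (last zs # [t])"
        by (rule polygon_length_join)
      also have "polygon_length \<gamma> (butlast zs @ [last zs]) = 0"
        unfolding append_butlast_last_id[OF nonempty] by (rule polygon_length_const) (rule eq)
      also have "ennreal (dist (\<gamma> s) (\<gamma> z)) + (0 + polygon_length \<gamma> (last zs # [t])) =
         ennreal (dist (\<gamma> s) (\<gamma> z) + dist (\<gamma> z) (\<gamma> t))"
        using zz by simp
      also have "\<dots> \<le> ennreal (e/2)"
        using d1(2)[of s z] d1(2)[of t z] st z by (intro ennreal_leI) (auto simp: dist_commute dist_real_def)
      finally show ?thesis .
    qed
    have xs: "a \<le> x \<and> x \<le> s" if "x \<in> set xs" for x
      using 1(4)[OF that] ts(2) that by (auto simp: 1(1))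
    have ys: "t \<le> y \<and> y \<le> b" if "y \<in> set ys" for y
      using 2(5)[OF that] ts(2) that by (auto simp: 1(1) 2(1))
    have left: "polygon_length \<gamma> (xs @ [s]) \<le> curve_length a s \<gamma>"
      using 1(2) xs st(1) by (intro polygon_length_le_curve_length) (auto simp: sorted_append)
    have right: "polygon_length \<gamma> (t # ys) \<le> curve_length t b \<gamma>"
      using 2(3) ys st(3) by (intro polygon_length_le_curve_length) auto
    have "polygon_length \<gamma> ts \<le> polygon_length \<gamma> (xs @ s # us)" unfolding 1(1) by (rule polygon_length_insert)
    also have "\<dots> = polygon_length \<gamma> (xs @ [s]) + polygon_length \<gamma> ((s # zs) @ ys)"
      unfolding 2(1) by (subst polygon_length_join) simp
    also have "\<dots> \<le> polygon_length \<gamma> (xs @ [s]) + polygon_length \<gamma> ((s # zs) @ t # ys)"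
      by (intro add_left_mono polygon_length_insert)
    also have "polygon_length \<gamma> ((s # zs) @ t # ys) =
       polygon_length \<gamma> (s # zs @ [t]) + polygon_length \<gamma> (t # ys)"
      by (subst polygon_length_join) simp
    also have "polygon_length \<gamma> (xs @ [s]) + (polygon_length \<gamma> (s # zs @ [t]) + polygon_length \<gamma> (t # ys))
       \<le> curve_length a s \<gamma> + (ennreal (e/2) + curve_length t b \<gamma>)"
      by (intro add_mono mid left right)
    finally have le: "polygon_length \<gamma> ts \<le> curve_length a s \<gamma> + (ennreal (e/2) + curve_length t b \<gamma>)" .
    have eq: "curve_length a b \<gamma> = curve_length a s \<gamma> + (curve_length s t \<gamma> + curve_length t b \<gamma>)"
      using st by (simp add: curve_length_add[of a s b] curve_length_add[of s t b])
    have f: "curve_length a s \<gamma> < top" "curve_length s t \<gamma> < top" "curve_length t b \<gamma> < top"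
      using fin unfolding eq by auto
    have "curve_length a s \<gamma> + (curve_length s t \<gamma> + curve_length t b \<gamma>) \<le>
       curve_length a s \<gamma> + (ennreal (e/2) + curve_length t b \<gamma>) + ennreal (e/2)"
      using ts(3) le unfolding eq by (meson add_right_mono less_imp_le order.trans)
    then show "curve_length s t \<gamma> \<le> ennreal e"
      using f e by (cases "curve_length a s \<gamma>"; cases "curve_length s t \<gamma>"; cases "curve_length t b \<gamma>")
         (auto simp flip: ennreal_plus simp: ennreal_le_iff2 split: if_splits)
  qed
qed

text \<open>Distances along the curve are bounded by differences of the length function
  \<open>L\<close>, so \<gamma> factors through \<open>L\<close>. Continuity of \<open>L\<close>
  makes each level set nonempty (intermediate values) and closed, hence the infimum in the
  definition is attained and lies in the level set.\<close>

lemma arclength_param_properties: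
  fixes \<gamma> :: "real \<Rightarrow> 'a::metric_space"
  assumes "(a, b, \<gamma>) \<in> curves"
  defines "l \<equiv> enn2real (curve_length a b \<gamma>)"
  defines "p \<equiv> arclength_param a b \<gamma>"
  shows arclength_param_lipschitz: "\<And>s t. s \<in> {0..l} \<Longrightarrow> t \<in> {0..l} \<Longrightarrow> dist (p s) (p t) \<le> \<bar>s - t\<bar>"
    and arclength_param_image: "p ` {0..l} = \<gamma> ` {a..b}"
    and arclength_param_0: "p 0 = \<gamma> a"
    and arclength_param_end: "p l = \<gamma> b"
    and arclength_length_pos: "\<not> \<gamma> constant_on {a..b} \<Longrightarrow> l > 0"
proof -
  have ab: "a \<le> b" and cont: "continuous_on {a..b} \<gamma>" and fin: "curve_length a b \<gamma> < \<infinity>"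
    using assms(1) by (auto simp: curves_def)
  define L where "L t = enn2real (curve_length a t \<gamma>)" for t
  have fin': "curve_length s t \<gamma> < top" if "a \<le> s" "s \<le> t" "t \<le> b" for s t
    using fin that by (simp add: curve_length_add[of a s b] curve_length_add[of s t b])
  have L: "curve_length a t \<gamma> = ennreal (L t)" if "t \<in> {a..b}" for t
    using fin'[of a t] that by (auto simp: L_def)
  have L0: "L t \<ge> 0" for t by (simp add: L_def)
  have Ldiff: "curve_length s t \<gamma> = ennreal (L t - L s)" "L s \<le> L t" if "a \<le> s" "s \<le> t" "t \<le> b" for s t
  proof -
    have "ennreal (L t) = ennreal (L s) + curve_length s t \<gamma>"
      using that L[of s] L[of t] curve_length_add[of a s t \<gamma>] by auto
    then show "curve_length s t \<gamma> = ennreal (L t - L s)" "L s \<le> L t"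
      using fin'[OF that] L0 by (cases "curve_length s t \<gamma>"; auto simp flip: ennreal_plus)+
  qed
  have La: "L a = 0" using Ldiff(1)[of a a] ab by (simp add: L_def)
  have Lb: "L b = l" by (simp add: L_def l_def)
  have contL: "continuous_on {a..b} L"
    unfolding continuous_on_iff
  proof (intro ballI allI impI)
    fix x :: real and e :: real assume x: "x \<in> {a..b}" and e: "e > 0"
    obtain d where d: "d > 0" "\<And>s t. a \<le> s \<Longrightarrow> s \<le> t \<Longrightarrow> t \<le> b \<Longrightarrow> t - s < d \<Longrightarrow> curve_length s t \<gamma> \<le> ennreal (e/2)"
      using curve_length_small[OF ab cont fin, of "e/2"] e by auto
    have *: "L t - L s \<le> e / 2" if "a \<le> s" "s \<le> t" "t \<le> b" "t - s < d" for s t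
      using d(2)[OF that] Ldiff[OF that(1-3)] e by (simp add: ennreal_le_iff)
    show "\<exists>d>0. \<forall>x'\<in>{a..b}. dist x' x < d \<longrightarrow> dist (L x') (L x) < e"
    proof (intro exI[of _ d] conjI ballI impI d)
      fix y assume y: "y \<in> {a..b}" "dist y x < d"
      show "dist (L y) (L x) < e"
        using *[of x y] *[of y x] Ldiff(2)[of x y] Ldiff(2)[of y x] x y e
          by (cases "x \<le> y") (auto simp: dist_real_def)
    qed
  qed
  have dist_le: "dist (\<gamma> s) (\<gamma> t) \<le> L t - L s" if "a \<le> s" "s \<le> t" "t \<le> b" for s t
    using dist_le_curve_length[OF that(2), of \<gamma>] Ldiff[OF that] by simp
  have dist_le': "dist (\<gamma> s) (\<gamma> t) \<le> \<bar>L s - L t\<bar>" if "s \<in> {a..b}" "t \<in> {a..b}" for s t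
    using dist_le[of s t] dist_le[of t s] that by (cases "s \<le> t") (auto simp: dist_commute)
  define T where "T \<tau> = Inf {t \<in> {a..b}. curve_length a t \<gamma> = ennreal \<tau>}" for \<tau>
  have T: "T \<tau> \<in> {a..b} \<and> L (T \<tau>) = \<tau>" if "\<tau> \<in> {0..l}" for \<tau>
  proof -
    have eq: "{t \<in> {a..b}. curve_length a t \<gamma> = ennreal \<tau>} = {t \<in> {a..b}. L t = \<tau>}"
      using L L0 that by auto
    have "closed {t \<in> {a..b}. L t = \<tau>}"
      using continuous_closed_preimage_constant[OF contL] by simp
    moreover have "{t \<in> {a..b}. L t = \<tau>} \<noteq> {}"
      using IVT'[of L a \<tau> b] contL ab that La Lb by auto
    moreover have "bdd_below {t \<in> {a..b}. L t = \<tau>}" by (rule bdd_belowI[of _ a]) auto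
    ultimately have "Inf {t \<in> {a..b}. L t = \<tau>} \<in> {t \<in> {a..b}. L t = \<tau>}"
      by (rule closed_contains_Inf[rotated 2])
    then show ?thesis unfolding T_def eq by auto
  qed
  have p: "p \<tau> = \<gamma> (T \<tau>)" for \<tau> by (simp add: p_def arclength_param_def T_def)
  have pL: "p (L t) = \<gamma> t" if "t \<in> {a..b}" for t
  proof -
    have "L t \<in> {0..l}" using Ldiff(2)[of t b] that L0 Lb by auto
    from T[OF this] dist_le'[of "T (L t)" t] that show ?thesis by (simp add: p)
  qed
  show "dist (p s) (p t) \<le> \<bar>s - t\<bar>" if "s \<in> {0..l}" "t \<in> {0..l}" for s t
    using dist_le'[of "T s" "T t"] T that by (simp add: p)
  show "p ` {0..l} = \<gamma> ` {a..b}"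
  proof (safe)
    fix \<tau> assume "\<tau> \<in> {0..l}" then show "p \<tau> \<in> \<gamma> ` {a..b}" using T p by auto
  next
    fix t assume t: "t \<in> {a..b}"
    have "L t \<in> {0..l}" using Ldiff(2)[of t b] t L0 Lb by auto
    then show "\<gamma> t \<in> p ` {0..l}" using pL[OF t] by (metis imageI)
  qed
  show "p 0 = \<gamma> a" using pL[of a] ab La by simp
  show "p l = \<gamma> b" using pL[of b] ab Lb by simp
  show "l > 0" if "\<not> \<gamma> constant_on {a..b}"
  proof (rule ccontr)
    assume "\<not> l > 0"
    then have "L t = 0" if "t \<in> {a..b}" for t using Ldiff(2)[of t b] that L0[of t] Lb by auto
    then have "\<gamma> t = \<gamma> a" if "t \<in> {a..b}" for t using dist_le'[of t a] that ab by auto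
    then have "\<gamma> constant_on {a..b}" unfolding constant_on_def by blast
    then show False using that by blast
  qed
qed

subsection \<open>Upper gradients of locally Lipschitz functions\<close>

text \<open>Near each point the local Lipschitz constant is dominated by every value of
  \<open>G\<close>, not only by the value at that point. Along a curve, \<open>G\<close> therefore
  lies above step functions, and its line integral can be bounded below even if the integrand is not
  measurable.\<close>

definition local_lipschitz_gradient :: "'a::metric_space set \<Rightarrow> ('a \<Rightarrow> real) \<Rightarrow> ('a \<Rightarrow> ennreal) \<Rightarrow> bool" where
  "local_lipschitz_gradient H f G \<longleftrightarrow> (\<forall>x\<in>H. \<exists>U. open U \<and> x \<in> U \<and>
     (\<forall>y\<in>U \<inter> H. \<forall>z\<in>U \<inter> H. \<forall>w\<in>U \<inter> H. ennreal \<bar>f z - f w\<bar> \<le> G y * ennreal (dist z w)))"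

text \<open>A Lebesgue number of the cover pulled back to the parameter interval allows a
  subdivision into \<open>n\<close> equal pieces, each inside one good neighbourhood. The difference
  quotient of \<open>f\<close> over a piece lies below \<open>G\<close> on the whole piece, so the
  step function \<open>h\<close> of these quotients is below \<open>G\<close> along the curve, and
  its integral dominates the telescoping sum.\<close>

lemma local_lipschitz_gradient_line_integral:
  fixes \<gamma> :: "real \<Rightarrow> 'a::metric_space"
  assumes loc: "local_lipschitz_gradient H f G" and cur: "(a, b, \<gamma>) \<in> curves" and H: "\<gamma> ` {a..b} \<subseteq> H"
  shows "ennreal \<bar>f (\<gamma> a) - f (\<gamma> b)\<bar> \<le> line_integral G a b \<gamma>"
proof -
  define l where "l = enn2real (curve_length a b \<gamma>)"
  define p where "p = arclength_param a b \<gamma>"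
  note P = arclength_param_lipschitz[OF cur, folded l_def p_def] arclength_param_image[OF cur, folded l_def
    p_def]
    arclength_param_0[OF cur, folded p_def] arclength_param_end[OF cur, folded l_def p_def]
  show ?thesis
  proof (cases "l > 0")
    case False
    then have "l = 0" using enn2real_nonneg[of "curve_length a b \<gamma>"] unfolding l_def by linarith
    then have "\<gamma> a = \<gamma> b" using P by simp
    then show ?thesis by simp
  next
    case True
    have pH: "p \<tau> \<in> H" if "\<tau> \<in> {0..l}" for \<tau> using P(2) H that by blast
    define good where "good U \<longleftrightarrow>
      (\<forall>y\<in>U \<inter> H. \<forall>z\<in>U \<inter> H. \<forall>w\<in>U \<inter> H. ennreal \<bar>f z - f w\<bar> \<le> G y * ennreal (dist z w))" for U
    \<comment> \<open>Parameter intervals whose image stays in one good neighbourhood; the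
      arc-length parametrization is 1-Lipschitz, so radii carry over unchanged.\<close>
    define \<G> where "\<G> = {ball \<tau> \<epsilon> | \<tau> \<epsilon>. \<exists>U. good U \<and> p ` (ball \<tau> \<epsilon> \<inter> {0..l}) \<subseteq> U}"
    have cov: "{0..l} \<subseteq> \<Union>\<G>"
    proof
      fix \<tau> assume \<tau>: "\<tau> \<in> {0..l}"
      then have "p \<tau> \<in> H" by (rule pH)
      then obtain U where U: "open U" "p \<tau> \<in> U" "good U"
        using loc unfolding local_lipschitz_gradient_def good_def by meson
      obtain \<epsilon> where e: "\<epsilon> > 0" "ball (p \<tau>) \<epsilon> \<subseteq> U" using U open_contains_ball by meson
      have "p ` (ball \<tau> \<epsilon> \<inter> {0..l}) \<subseteq> U"
      proof safe
        fix t assume t: "t \<in> ball \<tau> \<epsilon>" "t \<in> {0..l}"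
        have "dist (p \<tau>) (p t) < \<epsilon>" using P(1)[OF \<tau> t(2)] t(1) by (auto simp: dist_real_def)
        then show "p t \<in> U" using e by auto
      qed
      then have "ball \<tau> \<epsilon> \<in> \<G>" using U unfolding \<G>_def by blast
      then show "\<tau> \<in> \<Union>\<G>" using e by (auto intro: centre_in_ball[THEN iffD2])
    qed
    obtain e where e: "0 < e" "\<And>x. x \<in> {0..l} \<Longrightarrow> \<exists>B\<in>\<G>. ball x e \<subseteq> B"
      by (rule Heine_Borel_lemma[OF compact_Icc cov]) (auto simp: \<G>_def)
    obtain n :: nat where n: "l / e < real n" using reals_Archimedean2 by blast
    have n0: "real n > 0" using n e True by (smt (verit) divide_pos_pos)
    define d where "d = l / n"
    have d: "d > 0" "d < e" using n0 True n e by (auto simp: d_def field_simps)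
    have nd: "real n * d = l" using n0 by (simp add: d_def)
    define D where "D i = \<bar>f (p (real (Suc i) * d)) - f (p (real i * d))\<bar>" for i
    \<comment> \<open>Half-open pieces are pairwise disjoint, so at each parameter at most one term
      of \<open>h\<close> is nonzero.\<close>
    define I where "I i = {real i * d..<real (Suc i) * d}" for i
    have sub: "real i * d \<ge> 0" "real (Suc i) * d \<le> l" if "i < n" for i
    proof -
      show "real i * d \<ge> 0" using d by simp
      have "real (Suc i) * d \<le> real n * d" using that d by (intro mult_right_mono) auto
      then show "real (Suc i) * d \<le> l" using nd by simp
    qed
    have piece: "ennreal (D i / d) \<le> G (p \<tau>)" if i: "i < n" and \<tau>: "\<tau> \<in> I i" for i \<tau>
    proof -
      have in0: "real i * d \<in> {0..l}" "real (Suc i) * d \<in> {0..l}" "\<tau> \<in> {0..l}"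
      proof -
        have "real i * d \<le> real (Suc i) * d" using d by (intro mult_right_mono) auto
        then show "real i * d \<in> {0..l}" "real (Suc i) * d \<in> {0..l}" "\<tau> \<in> {0..l}"
          using sub[OF i] \<tau> unfolding I_def atLeastAtMost_iff atLeastLessThan_iff by linarith+
      qed
      obtain B where B: "B \<in> \<G>" "ball (real i * d) e \<subseteq> B" using e(2)[OF in0(1)] by blast
      obtain U where U: "good U" "p ` (B \<inter> {0..l}) \<subseteq> U" using B(1) unfolding \<G>_def by blast
      have inB: "real i * d \<in> B" "real (Suc i) * d \<in> B" "\<tau> \<in> B"
        using B(2) d e \<tau> by (auto simp: I_def dist_real_def algebra_simps subset_eq)
      have inU: "p (real i * d) \<in> U \<inter> H" "p (real (Suc i) * d) \<in> U \<inter> H" "p \<tau> \<in> U \<inter> H"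
        using in0 inB U(2) pH by blast+
      have "ennreal (D i) \<le> G (p \<tau>) * ennreal (dist (p (real (Suc i) * d)) (p (real i * d)))"
        using U(1) inU unfolding good_def D_def by blast
      also have "\<dots> \<le> G (p \<tau>) * ennreal d"
        using P(1)[OF in0(2) in0(1)] d by (intro mult_left_mono ennreal_leI) (auto simp: algebra_simps)
      finally have "ennreal (D i) \<le> G (p \<tau>) * ennreal d" .
      then have "ennreal (D i) / ennreal d \<le> G (p \<tau>) * ennreal d / ennreal d"
        by (rule divide_right_mono_ennreal)
      also have "G (p \<tau>) * ennreal d / ennreal d = G (p \<tau>)"
        using d by (simp add: ennreal_mult_divide_eq)
      finally show ?thesis using d by (simp add: divide_ennreal D_def)
    qed
    have disj: "i = j" if "\<tau> \<in> I i" "\<tau> \<in> I j" for i j \<tau>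
    proof -
      have "real i * d < real (Suc j) * d" "real j * d < real (Suc i) * d" using that by (auto simp: I_def)
      then have "i < Suc j" "j < Suc i" using d by (auto simp: mult_less_cancel_right)
      then show ?thesis by simp
    qed
    define h where "h \<tau> = (\<Sum>i<n. ennreal (D i / d) * indicator (I i) \<tau>)" for \<tau>
    have h_le: "h \<tau> \<le> G (p \<tau>) * indicator {0..l} \<tau>" for \<tau>
    proof (cases "\<exists>i<n. \<tau> \<in> I i")
      case True
      then obtain i where i: "i < n" "\<tau> \<in> I i" by blast
      have "h \<tau> = (\<Sum>j\<in>{i}. ennreal (D j / d) * indicator (I j) \<tau>)"
        unfolding h_def using i disj by (intro sum.mono_neutral_right) (auto simp: indicator_def)
      also have "\<dots> = ennreal (D i / d)" using i by simp
      also have "\<dots> \<le> G (p \<tau>)" using piece i by blast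
      finally show ?thesis using sub[OF i(1)] i(2) by (auto simp: I_def indicator_def)
    next
      case False
      then have "h \<tau> = 0" unfolding h_def by (auto simp: indicator_def intro!: sum.neutral)
      then show ?thesis by simp
    qed
    have "\<bar>f (\<gamma> a) - f (\<gamma> b)\<bar> = \<bar>\<Sum>i<n. f (p (real (Suc i) * d)) - f (p (real i * d))\<bar>"
      using P nd by (subst sum_lessThan_telescope) (simp add: abs_minus_commute)
    also have "\<dots> \<le> (\<Sum>i<n. D i)" unfolding D_def by (rule sum_abs)
    finally have "ennreal \<bar>f (\<gamma> a) - f (\<gamma> b)\<bar> \<le> ennreal (\<Sum>i<n. D i)" by (rule ennreal_leI)
    also have "\<dots> = (\<Sum>i<n. ennreal (D i / d) * ennreal d)" using d
      by (subst sum_ennreal[symmetric]) (auto simp: D_def simp flip: ennreal_mult'' intro!: sum.cong)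
    finally have "ennreal \<bar>f (\<gamma> a) - f (\<gamma> b)\<bar> \<le> (\<Sum>i<n. ennreal (D i / d) * ennreal d)" .
    have [measurable]: "I i \<in> sets lebesgue" for i by (simp add: I_def)
    have Ilen: "emeasure lebesgue (I i) = ennreal d" for i using d by (simp add: I_def algebra_simps)
    note \<open>ennreal \<bar>f (\<gamma> a) - f (\<gamma> b)\<bar> \<le> (\<Sum>i<n. ennreal (D i / d) * ennreal d)\<close>
    also have "(\<Sum>i<n. ennreal (D i / d) * ennreal d) = (\<integral>\<^sup>+\<tau>. h \<tau> \<partial>lebesgue)"
      unfolding h_def by (subst nn_integral_sum) (simp_all add: nn_integral_cmult_indicator Ilen)
    also have "\<dots> \<le> line_integral G a b \<gamma>"
      unfolding line_integral_def l_def[symmetric] p_def[symmetric] by (intro nn_integral_mono h_le)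
    finally show ?thesis .
  qed
qed

section \<open>Weak upper gradients and infinite line integrals\<close>

lemma zero_modulus_empty: "zero_modulus M {}"
  unfolding zero_modulus_def by (auto intro!: bexI[of _ "\<lambda>_. 0"])

lemma local_lipschitz_gradient_weak_upper_gradient:
  assumes "local_lipschitz_gradient H f G" "G \<in> borel_measurable (restrict_space M H)"
  shows "weak_upper_gradient M H (\<lambda>x. ereal (f x)) G"
  unfolding weak_upper_gradient_def
proof (intro conjI exI[of _ "{}"] zero_modulus_empty assms, safe)
  fix a b \<gamma> assume "(a, b, \<gamma>) \<in> curves" "\<gamma> ` {a..b} \<subseteq> H"
  from local_lipschitz_gradient_line_integral[OF assms(1) this]
  show "oscillation (\<lambda>x. ereal (f x)) (\<gamma> a) (\<gamma> b) \<le> line_integral G a b \<gamma>"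
    by (simp add: oscillation_def)
qed

text \<open>The arc-length parametrization is 1-Lipschitz, so around a parameter whose point is
  outside the larger ball there is an interval of parameters whose points are outside the smaller
  one. The interval is nondegenerate because a nonconstant curve has positive length.\<close>

lemma line_integral_avoid_ball:
  assumes cur: "(a, b, \<gamma>) \<in> curves" and nc: "\<not> \<gamma> constant_on {a..b}"
    and esc: "\<not> \<gamma> ` {a..b} \<subseteq> ball x R" and R: "R' < R" and G: "\<And>y. y \<notin> ball x R' \<Longrightarrow> G y = \<infinity>"
  shows "line_integral G a b \<gamma> = \<infinity>"
proof -
  define l where "l = enn2real (curve_length a b \<gamma>)"
  define p where "p = arclength_param a b \<gamma>"
  note P = arclength_param_lipschitz[OF cur, folded l_def p_def] arclength_param_image[OF cur, folded l_def
    p_def]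
    arclength_length_pos[OF cur, folded l_def, OF nc]
  have "\<exists>y\<in>p ` {0..l}. y \<notin> ball x R" using esc unfolding P(2) by blast
  then obtain \<tau> where \<tau>: "\<tau> \<in> {0..l}" "p \<tau> \<notin> ball x R" by blast
  define d where "d = R - R'"
  have d: "d > 0" using R by (simp add: d_def)
  define J where "J = {max 0 (\<tau> - d)<..<min l (\<tau> + d)}"
  have J: "G (p t) = \<infinity> \<and> t \<in> {0..l}" if "t \<in> J" for t
  proof -
    have t: "t \<in> {0..l}" using that by (auto simp: J_def)
    have "dist (p t) (p \<tau>) < d" using P(1)[OF t \<tau>(1)] that by (auto simp: J_def)
    moreover have "dist x (p \<tau>) \<le> dist x (p t) + dist (p t) (p \<tau>)" by (rule dist_triangle)
    ultimately have "p t \<notin> ball x R'" using \<tau>(2) by (auto simp: d_def)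
    then show ?thesis using G t by auto
  qed
  have "max 0 (\<tau> - d) < min l (\<tau> + d)" using \<tau> d P(3) by auto
  then have pos: "emeasure lebesgue J > 0" by (simp add: J_def)
  have "\<infinity> = \<infinity> * emeasure lebesgue J" using pos by (simp add: ennreal_top_mult)
  also have "\<dots> = (\<integral>\<^sup>+\<tau>. \<infinity> * indicator J \<tau> \<partial>lebesgue)"
    by (subst nn_integral_cmult_indicator) (auto simp: J_def)
  also have "\<dots> \<le> line_integral G a b \<gamma>"
    unfolding line_integral_def l_def[symmetric] p_def[symmetric]
    using J by (intro nn_integral_mono) (auto simp: indicator_def)
  finally show ?thesis by (simp add: top_unique)
qed

lemma line_integral_mono_on:
  assumes cur: "(a, b, \<gamma>) \<in> curves" and le: "\<And>y. y \<in> \<gamma> ` {a..b} \<Longrightarrow> g y \<le> h y"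
  shows "line_integral g a b \<gamma> \<le> line_integral h a b \<gamma>"
proof -
  have "arclength_param a b \<gamma> t \<in> \<gamma> ` {a..b}" if "t \<in> {0..enn2real (curve_length a b \<gamma>)}" for t
    using arclength_param_image[OF cur] that by blast
  then show ?thesis
    unfolding line_integral_def using le by (intro nn_integral_mono) (auto simp: indicator_def)
qed

text \<open>Pulling the constant out requires a measurable integrand, which is available since
  \<rho> is Borel and the parametrization is continuous. It lets an arbitrarily small multiple of
  \<rho> take care of the exceptional curves.\<close>

lemma line_integral_top_cmult:
  assumes cur: "(a, b, \<gamma>) \<in> curves" and \<rho>: "\<rho> \<in> borel_measurable borel"
    and top: "line_integral \<rho> a b \<gamma> = \<infinity>" and c: "0 < (c::real)"
  shows "line_integral (\<lambda>x. ennreal c * \<rho> x) a b \<gamma> = \<infinity>"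
proof -
  define l where "l = enn2real (curve_length a b \<gamma>)"
  define p where "p = arclength_param a b \<gamma>"
  note P = arclength_param_lipschitz[OF cur, folded l_def p_def]
  have "1-lipschitz_on {0..l} p"
    using P by (auto intro!: lipschitz_onI simp: dist_real_def)
  then have "continuous_on {0..l} p" by (rule lipschitz_on_continuous_on)
  then have p: "p \<in> borel_measurable (restrict_space borel {0..l})"
    by (rule borel_measurable_continuous_on_restrict)
  have "(\<lambda>t. \<rho> (p t)) \<in> borel_measurable (restrict_space borel {0..l})"
    using measurable_compose[OF p \<rho>] .
  then have "(\<lambda>t. \<rho> (p t) * indicator {0..l} t) \<in> borel_measurable borel"
    by (subst (asm) borel_measurable_restrict_space_iff_ennreal) auto
  then have m: "(\<lambda>t. \<rho> (p t) * indicator {0..l} t) \<in> borel_measurable lebesgue"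
    by (simp add: measurable_completion)
  have "line_integral (\<lambda>x. ennreal c * \<rho> x) a b \<gamma> = ennreal c * line_integral \<rho> a b \<gamma>"
    unfolding line_integral_def l_def[symmetric] p_def[symmetric]
    by (subst nn_integral_cmult[OF m, symmetric]) (simp add: mult.assoc)
  then show ?thesis using top c by (simp add: ennreal_mult_top)
qed

text \<open>Vitali selection: keep a ball of largest radius, discard all balls that meet it, and
  recurse. Discarded balls have no larger radius, so tripling the kept one covers them.\<close>

lemma finite_ball_covering:
  fixes c :: "'i \<Rightarrow> 'a::metric_space"
  assumes "finite I"
  obtains J where "J \<subseteq> I" "disjoint_family_on (\<lambda>j. ball (c j) (r j)) J"
    "\<And>i. i \<in> I \<Longrightarrow> \<exists>j\<in>J. ball (c i) (r i) \<subseteq> ball (c j) (3 * r j)"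
proof -
  have "\<exists>J\<subseteq>I. disjoint_family_on (\<lambda>j. ball (c j) (r j)) J \<and>
     (\<forall>i\<in>I. \<exists>j\<in>J. ball (c i) (r i) \<subseteq> ball (c j) (3 * r j))"
    using assms
  proof (induction I rule: finite_psubset_induct)
    case (psubset I)
    show ?case
    proof (cases "I = {}")
      case False
      have "Max (r ` I) \<in> r ` I" using psubset.hyps False by (intro Max_in) auto
      then obtain m where m: "m \<in> I" "r m = Max (r ` I)" by auto
      have m_max: "r i \<le> r m" if "i \<in> I" for i using psubset.hyps that m by simp
      define I' where "I' = {i \<in> I - {m}. ball (c i) (r i) \<inter> ball (c m) (r m) = {}}"
      have "I' \<subset> I" using m by (auto simp: I'_def)
      from psubset.IH[OF this] obtain J where J: "J \<subseteq> I'" "disjoint_family_on (\<lambda>j. ball (c j) (r j)) J"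
        "\<forall>i\<in>I'. \<exists>j\<in>J. ball (c i) (r i) \<subseteq> ball (c j) (3 * r j)" by blast
      have "disjoint_family_on (\<lambda>j. ball (c j) (r j)) (insert m J)"
        using J(1,2) unfolding disjoint_family_on_def I'_def by blast
      moreover have "\<exists>j\<in>insert m J. ball (c i) (r i) \<subseteq> ball (c j) (3 * r j)" if "i \<in> I" for i
      proof (cases "i \<in> I'")
        case False
        have "ball (c i) (r i) \<subseteq> ball (c m) (3 * r m)"
        proof (cases "i = m")
          case True
          show ?thesis
          proof
            fix z assume z: "z \<in> ball (c i) (r i)"
            \<comment> \<open>Radii are arbitrary reals; only the membership of \<open>z\<close>
              shows that this one is positive and that tripling enlarges the ball.\<close>
            then have "r i > 0" by (metis mem_ball order.strict_trans1 zero_le_dist)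
            then show "z \<in> ball (c m) (3 * r m)" using z True by auto
          qed
        next
          case F: False
          then have "ball (c i) (r i) \<inter> ball (c m) (r m) \<noteq> {}" using False \<open>i \<in> I\<close> by (auto simp: I'_def)
          then obtain w where w: "dist (c i) w < r i" "dist (c m) w < r m" by auto
          show ?thesis
          proof
            fix z assume "z \<in> ball (c i) (r i)"
            then have "dist (c i) z < r i" by simp
            moreover have "dist (c m) z \<le> dist (c m) w + dist w z" "dist w z \<le> dist w (c i) + dist (c i) z"
              by (rule dist_triangle)+
            ultimately show "z \<in> ball (c m) (3 * r m)" using w m_max[OF that] by (auto simp: dist_commute)
          qed
        qed
        then show ?thesis by blast
      qed (use J in blast)
      moreover have "insert m J \<subseteq> I" using J(1) m by (auto simp: I'_def)
      ultimately show ?thesis by blast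
    qed (auto simp: disjoint_family_on_def)
  qed
  then show thesis using that by blast
qed

subsection \<open>Doubling measures\<close>

text \<open>The outer measure is left behind here: \<open>borel_hull\<close> is the trace of Borel
  regularity on the measurable sets.\<close>

locale doubling_measure =
  fixes M :: "'a::complete_space measure" and C :: real
  assumes space_M [simp]: "space M = UNIV"
    and borel_sets: "sets borel \<subseteq> sets M"
    and C_ge_1: "1 \<le> C"
    and emeasure_ball_pos: "0 < r \<Longrightarrow> 0 < emeasure M (ball x r)"
    and emeasure_ball_finite: "emeasure M (ball x r) < \<infinity>"
    and emeasure_doubling: "0 < r \<Longrightarrow> emeasure M (ball x (2 * r)) \<le> ennreal C * emeasure M (ball x r)"
    and borel_hull: "A \<in> sets M \<Longrightarrow> \<exists>B\<in>sets borel. A \<subseteq> B \<and> emeasure M B = emeasure M A"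
begin

definition vol :: "'a \<Rightarrow> real \<Rightarrow> real" where "vol x r = measure M (ball x r)"

lemma emeasure_ball: "emeasure M (ball x r) = ennreal (vol x r)"
  unfolding vol_def using emeasure_ball_finite[of x r] by (intro emeasure_eq_ennreal_measure) auto

lemma vol_nonneg [simp]: "0 \<le> vol x r" by (simp add: vol_def)

lemma vol_pos: "0 < r \<Longrightarrow> 0 < vol x r"
  using emeasure_ball_pos[of r x] by (simp add: emeasure_ball)

lemma borel_in_sets: "A \<in> sets borel \<Longrightarrow> A \<in> sets M" using borel_sets by blast

lemma open_in_sets: "open A \<Longrightarrow> A \<in> sets M"
  by (rule borel_in_sets) simp

lemma closed_in_sets: "closed A \<Longrightarrow> A \<in> sets M"
  by (rule borel_in_sets) simp

lemma ball_in_sets [simp, measurable]: "ball x r \<in> sets M"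
  by (simp add: open_in_sets)

lemma vol_mono: "ball x r \<subseteq> ball y s \<Longrightarrow> vol x r \<le> vol y s"
  using emeasure_mono[of "ball x r" "ball y s" M] by (simp add: emeasure_ball)

lemma vol_doubling: "0 < r \<Longrightarrow> vol x (2 * r) \<le> C * vol x r"
  using emeasure_doubling[of r x] C_ge_1 by (simp add: emeasure_ball flip: ennreal_mult'')

lemma vol_doubling_power: "0 < r \<Longrightarrow> vol x (2 ^ n * r) \<le> C ^ n * vol x r"
proof (induction n)
  case (Suc n)
  have "vol x (2 ^ Suc n * r) \<le> C * vol x (2 ^ n * r)"
    using vol_doubling[of "2 ^ n * r" x] Suc.prems by (simp add: mult.assoc)
  also have "\<dots> \<le> C * (C ^ n * vol x r)" using Suc C_ge_1 by (intro mult_left_mono) auto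
  finally show ?case by (simp add: mult.assoc)
qed simp

lemma vol_compare:
  assumes "0 < r" "dist x y + s \<le> 2 ^ n * r"
  shows "vol y s \<le> C ^ n * vol x r"
proof -
  have "ball y s \<subseteq> ball x (2 ^ n * r)"
  proof
    fix z assume "z \<in> ball y s"
    then show "z \<in> ball x (2 ^ n * r)" using assms dist_triangle[of x z y] by auto
  qed
  from vol_mono[OF this] vol_doubling_power[OF assms(1), of x n] show ?thesis by linarith
qed

section \<open>Properness, separability and measurability in doubling spaces\<close>

lemma emeasure_bounded_finite: "bounded A \<Longrightarrow> emeasure M A < \<infinity>"
proof -
  assume "bounded A"
  then obtain x r where "A \<subseteq> ball x r"
    by (metis bounded_subset_ballD)
  then have "emeasure M A \<le> emeasure M (ball x r)" by (intro emeasure_mono) auto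
  then show ?thesis using emeasure_ball_finite[of x r] by (rule order.strict_trans1)
qed

text \<open>Around the points of an e-separated set the balls of radius e/2 are disjoint, and by
  doubling each carries a fixed fraction of the volume of a ball containing them all. Hence such
  sets have bounded cardinality, and one of maximal cardinality is a finite e-net.\<close>

lemma compact_cball: "compact (cball (x::'a) R)"
  unfolding compact_eq_totally_bounded
proof (intro conjI allI impI)
  show "complete (cball x R)" by (simp add: complete_eq_closed)
next
  fix e :: real assume e: "e > 0"
  show "\<exists>k. finite k \<and> cball x R \<subseteq> (\<Union>x\<in>k. ball x e)"
  proof (cases "R < 0")
    case False
    then have R: "R \<ge> 0" by simp
    \<comment> \<open>For any centre in the closed ball, n doublings of the radius e/2 reach the
      whole of \<open>ball x (R + e)\<close>: centre distance R plus radius R + e.\<close>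
    obtain n where n: "(2 * R + e) / (e/2) < 2 ^ n" using real_arch_pow[of 2] by auto
    then have n: "2 * R + e \<le> 2 ^ n * (e/2)" using e by (simp add: field_simps)
    define sep where "sep S \<longleftrightarrow> finite S \<and> S \<subseteq> cball x R \<and> (\<forall>y\<in>S. \<forall>z\<in>S. y \<noteq> z \<longrightarrow> dist y z \<ge> e)" for S
    have bound: "real (card S) \<le> C ^ n" if "sep S" for S
    proof -
      have S: "finite S" "S \<subseteq> cball x R" "\<And>y z. y \<in> S \<Longrightarrow> z \<in> S \<Longrightarrow> y \<noteq> z \<Longrightarrow> dist y z \<ge> e"
        using that by (auto simp: sep_def)
      have disj: "disjoint_family_on (\<lambda>y. ball y (e/2)) S"
        unfolding disjoint_family_on_def
      proof (intro ballI impI equals0I)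
        fix y z w assume yz: "y \<in> S" "z \<in> S" "y \<noteq> z" "w \<in> ball y (e/2) \<inter> ball z (e/2)"
        have "dist y z < e" using yz(4) dist_triangle[of y z w] by (auto simp: dist_commute)
        then show False using S(3)[OF yz(1-3)] by simp
      qed
      have sub: "(\<Union>y\<in>S. ball y (e/2)) \<subseteq> ball x (R + e)"
      proof safe
        fix y z assume "y \<in> S" "z \<in> ball y (e/2)"
        then show "z \<in> ball x (R + e)" using S(2) dist_triangle[of x z y] e by auto
      qed
      have "vol x (R + e) \<le> C ^ n * vol y (e/2)" if "y \<in> S" for y
        using e n S(2) that by (intro vol_compare) (auto simp: dist_commute)
      then have "real (card S) * vol x (R + e) \<le> (\<Sum>y\<in>S. C ^ n * vol y (e/2))"
        using sum_mono[of S "\<lambda>_. vol x (R + e)"] by simp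
      also have "\<dots> = C ^ n * measure M (\<Union>y\<in>S. ball y (e/2))"
        unfolding vol_def sum_distrib_left[symmetric] using S(1) disj emeasure_ball_finite
        by (subst measure_finite_Union) (auto simp: less_top)
      also have "\<dots> \<le> C ^ n * vol x (R + e)"
        unfolding vol_def using sub C_ge_1 S(1) emeasure_ball_finite[of x "R + e"]
        by (intro mult_left_mono measure_mono_fmeasurable) (auto simp: fmeasurable_def)
      finally show ?thesis using vol_pos[of "R + e" x] R e by simp
    qed
    have "\<exists>S. sep S \<and> (\<forall>T. sep T \<longrightarrow> card T \<le> card S)"
    proof (rule Lattices_Big.ex_has_greatest_nat[of sep "{}"])
      show "sep {}" by (simp add: sep_def)
      show "\<forall>T. sep T \<longrightarrow> card T < Suc (nat \<lfloor>C ^ n\<rfloor>)" using bound by (simp add: le_nat_floor less_Suc_eq_le)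
    qed
    then obtain S where S: "sep S" "\<And>T. sep T \<Longrightarrow> card T \<le> card S" by blast
    have "cball x R \<subseteq> (\<Union>x\<in>S. ball x e)"
    proof (rule ccontr)
      assume "\<not> ?thesis"
      then obtain z where z: "z \<in> cball x R" "\<And>y. y \<in> S \<Longrightarrow> dist y z \<ge> e" by force
      then have "z \<notin> S" using e by force
      moreover have "sep (insert z S)" using S(1) z by (auto simp: sep_def dist_commute)
      ultimately show False using S(2)[of "insert z S"] S(1) by (simp add: sep_def)
    qed
    then show ?thesis using S(1) sep_def by blast
  qed (auto intro!: exI[of _ "{}"])
qed

lemma compact_closed_bounded: "closed (K :: 'a set) \<Longrightarrow> bounded K \<Longrightarrow> compact K"
proof -
  assume K: "closed K" "bounded K"
  then obtain x R where "K \<subseteq> cball x R" by (meson bounded_def mem_cball subsetI)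
  then have "K = cball x R \<inter> K" by blast
  then show ?thesis using compact_Int_closed[OF compact_cball[of x R] K(1)] by simp
qed

lemma compactly_inside_subset: "(A :: 'a set) \<subseteq> cball x r \<Longrightarrow> cball x r \<subseteq> \<Omega> \<Longrightarrow> compactly_inside A \<Omega>"
  unfolding compactly_inside_def
  using closure_minimal[of A "cball x r"]
  by (auto intro!: compact_closed_bounded intro: bounded_subset)

lemma ex_countable_dense: "\<exists>D :: 'a set. countable D \<and> (\<forall>x. \<forall>e>0. \<exists>y\<in>D. dist x y < e)"
proof -
  fix o' :: 'a
  have "\<forall>n m. \<exists>k. finite k \<and> cball o' (real n) \<subseteq> (\<Union>x\<in>k. ball x (1 / real (Suc m)))"
    using compact_cball[unfolded compact_eq_totally_bounded] by simp
  then obtain k where k: "\<And>n m. finite (k n m)"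
    "\<And>n m. cball o' (real n) \<subseteq> (\<Union>x\<in>k n m. ball x (1 / real (Suc m)))" by metis
  show ?thesis
  proof (intro exI conjI allI impI)
    show "countable (\<Union>n. \<Union>m. k n m)" by (intro countable_UN countableI_type countable_finite k(1))
    fix x :: 'a and e :: real assume e: "e > 0"
    obtain n where "dist o' x \<le> real n" using real_arch_simple by blast
    then have x: "x \<in> cball o' (real n)" by simp
    obtain m where m: "1 / real (Suc m) < e" using e nat_approx_posE by blast
    obtain y where "y \<in> k n m" "dist y x < 1 / real (Suc m)" using x k(2)[of n m] by auto
    then show "\<exists>y\<in>(\<Union>n. \<Union>m. k n m). dist x y < e" using m by (force simp: dist_commute)
  qed
qed

lemma ident_measurable [measurable]: "(\<lambda>x. x) \<in> measurable M borel"
  using borel_sets by (auto simp: measurable_def)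

lemma borel_measurable_M: "f \<in> measurable borel N \<Longrightarrow> f \<in> measurable M N"
  using measurable_compose[OF ident_measurable] by simp

lemma continuous_measurable: "continuous_on UNIV f \<Longrightarrow> f \<in> measurable M borel"
  by (rule borel_measurable_M) (rule borel_measurable_continuous_onI)

text \<open>Continuity of the distance on the product does not give measurability for the product
  sigma-algebra, as the type carries no countable basis. A countable dense set writes the distance
  as a countable infimum of sums of functions of one variable.\<close>

lemma dist_measurable [measurable (raw)]:
  assumes "f \<in> measurable N M" "g \<in> measurable N M"
  shows "(\<lambda>x. dist (f x) (g x)) \<in> borel_measurable N"
proof -
  obtain D :: "'a set" where D: "countable D" "\<And>x e. e > 0 \<Longrightarrow> \<exists>y\<in>D. dist x y < e"
    using ex_countable_dense by blast
  have ne: "D \<noteq> {}" using D(2)[of 1] by fastforce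
  have dist_eq: "dist x y = (INF q\<in>D. dist x q + dist y q)" for x y
  proof (rule antisym)
    show "dist x y \<le> (INF q\<in>D. dist x q + dist y q)"
      using ne by (intro cINF_greatest) (auto simp: dist_triangle2)
    show "(INF q\<in>D. dist x q + dist y q) \<le> dist x y"
    proof (rule field_le_epsilon)
      fix e :: real assume "e > 0"
      then obtain q where q: "q \<in> D" "dist x q < e/2" using D(2)[of "e/2" x] by auto
      have "(INF q\<in>D. dist x q + dist y q) \<le> dist x q + dist y q"
        using q by (intro cINF_lower) (auto intro!: bdd_belowI[of _ 0])
      also have "dist y q \<le> dist y x + dist x q" by (rule dist_triangle)
      finally show "(INF q\<in>D. dist x q + dist y q) \<le> dist x y + e" using q by (simp add: dist_commute)
    qed
  qed
  have m: "(\<lambda>y. dist y q) \<in> borel_measurable M" for q :: 'a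
    by (intro continuous_measurable continuous_intros)
  have "(\<lambda>x. dist (f x) q) \<in> borel_measurable N" "(\<lambda>x. dist (g x) q) \<in> borel_measurable N" for q :: 'a
    using measurable_compose[OF assms(1) m[of q]] measurable_compose[OF assms(2) m[of q]] .
  then have "(\<lambda>x. dist (f x) q + dist (g x) q) \<in> borel_measurable N" for q
    by (rule borel_measurable_add)
  then have "(\<lambda>x. INF q\<in>D. dist (f x) q + dist (g x) q) \<in> borel_measurable N"
    by (rule borel_measurable_cINF_real[OF D(1)])
  moreover have "(\<lambda>x. dist (f x) (g x)) = (\<lambda>x. INF q\<in>D. dist (f x) q + dist (g x) q)"
    by (rule ext) (rule dist_eq)
  ultimately show ?thesis by (rule ssubst[rotated])
qed

sublocale sigma_finite_measure M
proof
  fix o' :: 'a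
  have "(\<Union>n. ball o' (real n)) = UNIV" using reals_Archimedean2 by fastforce
  then show "\<exists>A. countable A \<and> A \<subseteq> sets M \<and> \<Union> A = space M \<and> (\<forall>a\<in>A. emeasure M a \<noteq> \<infinity>)"
    using emeasure_ball_finite by (intro exI[of _ "range (\<lambda>n. ball o' (real n))"]) (auto simp: emeasure_ball)
qed

text \<open>The Poincare inequality accepts only Borel gradients, and the majorization has to hold
  at every point because curves see null sets. Replacing each rational superlevel set by a Borel
  hull of the same measure and taking the supremum of levels gives such a majorant; finiteness of
  the measure makes the excess of each hull a null set.\<close>

lemma borel_majorant:
  assumes U: "U \<in> sets M" "emeasure M U < \<infinity>" and g: "g \<in> borel_measurable M"
  obtains g' :: "'a \<Rightarrow> ennreal" where "g' \<in> borel_measurable borel" "\<And>x. x \<in> U \<Longrightarrow> g x \<le> g' x"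
    "(\<integral>\<^sup>+x\<in>U. g' x \<partial>M) \<le> (\<integral>\<^sup>+x\<in>U. g x \<partial>M)"
proof -
  \<comment> \<open>\<open>ennreal\<close> sends negative levels to 0, so they contribute nothing to
    the supremum \<open>g'\<close>.\<close>
  define A where "A q = {x\<in>U. ennreal (real_of_rat q) < g x}" for q
  have A: "A q \<in> sets M" for q
  proof -
    have "{x \<in> space M. ennreal (real_of_rat q) < g x} \<in> sets M" using g by measurable
    then have "U \<inter> {x \<in> space M. ennreal (real_of_rat q) < g x} \<in> sets M" using U(1) by blast
    then show ?thesis by (simp add: A_def Int_def)
  qed
  have "\<forall>q. \<exists>B\<in>sets borel. A q \<subseteq> B \<and> emeasure M B = emeasure M (A q)" using borel_hull[OF A] by blast
  then obtain B where B: "\<And>q. B q \<in> sets borel" "\<And>q. A q \<subseteq> B q" "\<And>q. emeasure M (B q) = emeasure M (A q)"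
    by metis
  define g' where "g' x = (SUP q. ennreal (real_of_rat q) * indicator (B q) x)" for x
  have null: "emeasure M (B q - A q) = 0" for q
  proof -
    have "emeasure M (A q) \<le> emeasure M U" using U by (intro emeasure_mono) (auto simp: A_def)
    then have "emeasure M (A q) \<noteq> \<infinity>" using U(2) by auto
    then show ?thesis using A B borel_in_sets by (subst emeasure_Diff) auto
  qed
  have "B q - A q \<in> null_sets M" for q
    using null A B(1) borel_in_sets by (auto simp: null_sets_def)
  then have "AE x in M. \<forall>q. x \<notin> B q - A q"
    unfolding AE_all_countable by (blast intro: AE_not_in)
  then have le: "AE x in M. g' x * indicator U x \<le> g x * indicator U x"
  proof (eventually_elim)
    fix x assume x: "\<forall>q. x \<notin> B q - A q"
    show "g' x * indicator U x \<le> g x * indicator U x"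
    proof (cases "x \<in> U")
      case True
      have "ennreal (real_of_rat q) * indicator (B q) x \<le> g x" for q
        using x by (cases "x \<in> B q") (auto simp: A_def)
      then show ?thesis using True by (auto simp: g'_def intro: SUP_least)
    qed simp
  qed
  show thesis
  proof (rule that[of g'])
    have "(\<lambda>x. SUP q\<in>UNIV. ennreal (real_of_rat q) * indicator (B q) x) \<in> borel_measurable borel"
      using B(1) by (intro borel_measurable_SUP) auto
    then show "g' \<in> borel_measurable borel" unfolding g'_def[abs_def] .
    show "(\<integral>\<^sup>+x\<in>U. g' x \<partial>M) \<le> (\<integral>\<^sup>+x\<in>U. g x \<partial>M)" using le by (rule nn_integral_mono_AE)
    fix x assume x: "x \<in> U"
    show "g x \<le> g' x"
    proof (rule ccontr)
      assume "\<not> g x \<le> g' x"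
      then obtain q where q: "g' x < ennreal (real_of_rat q)" "ennreal (real_of_rat q) < g x"
        using ennreal_rat_dense[of "g' x" "g x"] by (auto simp: not_le)
      then have "x \<in> B q" using x B(2) by (auto simp: A_def)
      then have "ennreal (real_of_rat q) \<le> g' x"
        unfolding g'_def by (intro SUP_upper2[of q]) auto
      then show False using q(1) by simp
    qed
  qed
qed

end

subsection \<open>Local Poincare inequality and averages over variable balls\<close>

lemma divide_ennreal_eq_mult: "0 < c \<Longrightarrow> X / ennreal c = ennreal (1 / c) * X"
  by (simp add: divide_ennreal_def inverse_ennreal inverse_eq_divide mult.commute)

lemma ennreal_le_mult_epsilon:
  fixes X I J :: ennreal
  assumes "\<And>e. 0 < e \<Longrightarrow> X \<le> ennreal K * (I + ennreal e * J)" "J < \<infinity>" "0 \<le> K"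
  shows "X \<le> ennreal K * I"
proof (rule ennreal_le_epsilon)
  fix e :: real assume e: "0 < e"
  obtain j where j: "J = ennreal j" "0 \<le> j" using assms(2) by (cases J) auto
  define d where "d = e / (K * j + 1)"
  have pos: "K * j + 1 > 0" using assms(3) j(2) by (simp add: add_nonneg_pos)
  then have d: "d > 0" using e by (simp add: d_def)
  have "K * (d * j) \<le> e"
    using e pos assms(3) j(2) by (simp add: d_def field_simps)
  then have "ennreal K * (ennreal d * J) \<le> ennreal e"
    using assms(3) d j by (auto simp flip: ennreal_mult'' intro: ennreal_leI)
  then show "X \<le> ennreal K * I + ennreal e"
    using assms(1)[OF d] by (simp add: distrib_left) (meson add_left_mono order.trans)
qed

locale poincare_space = doubling_measure M C for M :: "'a::complete_space measure" and C +
  fixes CP \<Lambda> :: real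
  assumes poincare: "poincare_inequality M CP \<Lambda>"
begin

lemma CP_pos: "0 < CP" and \<Lambda>_ge_1: "1 \<le> \<Lambda>"
  using poincare by (auto simp: poincare_inequality_def)

definition mean :: "('a \<Rightarrow> real) \<Rightarrow> 'a \<Rightarrow> real \<Rightarrow> real" where
  "mean f x r = (LINT y:ball x r|M. f y) / vol x r"

definition osc :: "('a \<Rightarrow> real) \<Rightarrow> 'a \<Rightarrow> real \<Rightarrow> ennreal" where
  "osc f x r = ennreal (1 / vol x r) * (\<integral>\<^sup>+y\<in>ball x r. ennreal \<bar>f y - mean f x r\<bar> \<partial>M)"

text \<open>
  The Poincare inequality is only assumed for globally defined functions. Extend \<open>f\<close> by \<open>0\<close> outside the
  ball of radius \<open>2 * \<Lambda> * r\<close> and its gradient by \<open>\<infinity>\<close> outside the ball of radius \<open>\<Lambda> * r\<close>: a curve leaving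
  the large ball spends positive length where the gradient is infinite.
\<close>

lemma local_poincare:
  fixes f :: "'a \<Rightarrow> ereal"
  assumes r: "0 < r" and sub: "ball x (2 * \<Lambda> * r) \<subseteq> \<Omega>"
    and wug: "weak_upper_gradient M \<Omega> f g" and \<Omega>: "\<Omega> \<in> sets M"
    and L1: "f \<in> L1 M (ball x (2 * \<Lambda> * r))"
    and v: "\<And>y. y \<in> ball x r \<Longrightarrow> v y = real_of_ereal (f y)"
  shows "osc v x r \<le> ennreal (CP * r / vol x (\<Lambda> * r)) * (\<integral>\<^sup>+y\<in>ball x (\<Lambda> * r). g y \<partial>M)"
proof -
  define R' where "R' = \<Lambda> * r"
  define R where "R = 2 * \<Lambda> * r"
  have RR: "0 < R'" "R' < R" "r \<le> R'" using r \<Lambda>_ge_1 by (auto simp: R'_def R_def)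
  obtain \<Gamma> where \<Gamma>: "zero_modulus M \<Gamma>" and \<Gamma>': "\<forall>(a, b, \<gamma>)\<in>curves - \<Gamma>. \<gamma> ` {a..b} \<subseteq> \<Omega> \<and>
     \<not> \<gamma> constant_on {a..b} \<longrightarrow> oscillation f (\<gamma> a) (\<gamma> b) \<le> line_integral g a b \<gamma>"
    and g: "g \<in> borel_measurable (restrict_space M \<Omega>)"
    using wug unfolding weak_upper_gradient_def by blast
  have osc_le: "oscillation f (\<gamma> a) (\<gamma> b) \<le> line_integral g a b \<gamma>"
    if "(a, b, \<gamma>) \<in> curves" "(a, b, \<gamma>) \<notin> \<Gamma>" "\<gamma> ` {a..b} \<subseteq> \<Omega>" "\<not> \<gamma> constant_on {a..b}" for a b \<gamma>
    using bspec[OF \<Gamma>', of "(a, b, \<gamma>)"] that by simp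
  obtain \<rho> where \<rho>: "\<rho> \<in> borel_measurable borel" "(\<integral>\<^sup>+x. \<rho> x \<partial>M) < \<infinity>"
    and \<rho>': "\<forall>(a, b, \<gamma>)\<in>\<Gamma>. line_integral \<rho> a b \<gamma> = \<infinity>"
    using \<Gamma> unfolding zero_modulus_def by blast
  have \<rho>_top: "line_integral \<rho> a b \<gamma> = \<infinity>" if "(a, b, \<gamma>) \<in> \<Gamma>" for a b \<gamma>
    using bspec[OF \<rho>' that] by simp
  have g1: "(\<lambda>y. g y * indicator \<Omega> y) \<in> borel_measurable M"
    using g \<Omega> by (subst borel_measurable_restrict_space_iff_ennreal[symmetric]) auto
  obtain gb where gb: "gb \<in> borel_measurable borel" "\<And>y. y \<in> ball x R' \<Longrightarrow> g y * indicator \<Omega> y \<le> gb y"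
    "(\<integral>\<^sup>+y\<in>ball x R'. gb y \<partial>M) \<le> (\<integral>\<^sup>+y\<in>ball x R'. g y * indicator \<Omega> y \<partial>M)"
    using borel_majorant[OF ball_in_sets emeasure_ball_finite g1] by blast
  have sub': "ball x R' \<subseteq> \<Omega>" using sub RR by (auto simp: R_def)
  have gb2: "g y \<le> gb y" if "y \<in> ball x R'" for y
    using gb(2)[OF that] sub' that by auto
  define fe where "fe y = (if y \<in> ball x R then f y else 0)" for y
  have "fe \<in> borel_measurable M"
    unfolding fe_def using L1 unfolding L1_def R_def[symmetric]
    by (subst measurable_If_restrict_space_iff) (auto simp del: mem_ball)
  then have feL1: "fe \<in> L1_loc M UNIV"
    unfolding L1_loc_def
  proof safe
    fix \<Omega>' :: "'a set"
    have "L1_norm M \<Omega>' fe \<le> L1_norm M (ball x R) f"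
      unfolding L1_norm_def
        by (intro nn_integral_mono) (auto simp: fe_def indicator_def zero_ereal_def e2ennreal_ereal)
    also have "\<dots> < \<infinity>" using L1 by (simp add: L1_def R_def)
    finally show "fe \<in> L1 M \<Omega>'"
      using \<open>fe \<in> borel_measurable M\<close> by (simp add: L1_def measurable_restrict_space1)
  qed
  \<comment> \<open>Exceptional curves have infinite \<rho>-integral, so adding \<open>e\<close>
    times \<rho> yields a genuine upper gradient; as the integral of \<rho> is finite, the extra
    cost vanishes with \<open>e\<close>.\<close>
  have main: "osc v x r \<le> ennreal (CP * r / vol x R') * ((\<integral>\<^sup>+y\<in>ball x R'. g y \<partial>M) + ennreal e *
     (\<integral>\<^sup>+y. \<rho> y \<partial>M))"
    if e: "0 < e" for e
  proof -
    define h where "h y = (if y \<in> ball x R' then gb y + ennreal e * \<rho> y else \<infinity>)" for y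
    have [measurable]: "h \<in> borel_measurable borel"
      unfolding h_def using gb(1) \<rho>(1) by (intro measurable_If) (auto simp del: mem_ball)
    have "upper_gradient fe h"
      unfolding upper_gradient_def
    proof (intro conjI ballI; (safe)?)
      fix a b and \<gamma> :: "real \<Rightarrow> 'a" assume cur: "(a, b, \<gamma>) \<in> curves" and nc: "\<not> \<gamma> constant_on {a..b}"
      show "oscillation fe (\<gamma> a) (\<gamma> b) \<le> line_integral h a b \<gamma>"
      proof (cases "\<gamma> ` {a..b} \<subseteq> ball x R")
        case False
        from line_integral_avoid_ball[OF cur nc this RR(2), of h] show ?thesis by (simp add: h_def)
      next
        case True
        have "a \<le> b" using cur by (simp add: curves_def)
        then have "\<gamma> a \<in> ball x R" "\<gamma> b \<in> ball x R" using True
          by (simp_all add: image_subset_iff del: mem_ball)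
        then have eq: "oscillation fe (\<gamma> a) (\<gamma> b) = oscillation f (\<gamma> a) (\<gamma> b)"
          by (simp add: oscillation_def fe_def)
        show ?thesis
        proof (cases "(a, b, \<gamma>) \<in> \<Gamma>")
          case True
          have "line_integral (\<lambda>x. ennreal e * \<rho> x) a b \<gamma> \<le> line_integral h a b \<gamma>"
            by (rule line_integral_mono_on[OF cur]) (simp add: h_def)
          then show ?thesis
            using line_integral_top_cmult[OF cur \<rho>(1) \<rho>_top[OF True] e] by (simp add: top_unique)
        next
          case False
          have "oscillation f (\<gamma> a) (\<gamma> b) \<le> line_integral g a b \<gamma>"
            using osc_le[OF cur False] True sub nc by (auto simp: R_def)
          also have "\<dots> \<le> line_integral h a b \<gamma>"
            by (rule line_integral_mono_on[OF cur]) (auto simp: h_def simp del: mem_ball intro: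
              add_increasing2 gb2)
          finally show ?thesis unfolding eq .
        qed
      qed
    qed (measurable)
    with poincare feL1 r have P:
      "(\<integral>\<^sup>+y\<in>ball x r. e2ennreal \<bar>fe y - ereal ((LINT y:ball x r|M. real_of_ereal (fe y)) / measure M
       (ball x r))\<bar> \<partial>M)
        / emeasure M (ball x r)
      \<le> ennreal (CP * r) * ((\<integral>\<^sup>+y\<in>ball x (\<Lambda> * r). h y \<partial>M) / emeasure M (ball x (\<Lambda> * r)))"
      unfolding poincare_inequality_def Let_def by blast
    have rv: "real_of_ereal (fe y) = v y" if "y \<in> ball x r" for y
      using that RR v[OF that] by (auto simp: fe_def)
    have "(LINT y:ball x r|M. real_of_ereal (fe y)) = (LINT y:ball x r|M. v y)"
      by (intro set_lebesgue_integral_cong) (auto simp: rv)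
    then have m: "(LINT y:ball x r|M. real_of_ereal (fe y)) / measure M (ball x r) = mean v x r"
      by (simp add: mean_def vol_def)
    have "osc v x r \<le> (\<integral>\<^sup>+y\<in>ball x r. e2ennreal \<bar>fe y - ereal (mean v x r)\<bar> \<partial>M) / emeasure M (ball x r)"
      unfolding osc_def emeasure_ball divide_ennreal_eq_mult[OF vol_pos[OF r]]
    proof (intro mult_left_mono nn_integral_mono)
      fix y
      have "ennreal \<bar>v y - mean v x r\<bar> \<le> e2ennreal \<bar>fe y - ereal (mean v x r)\<bar>" if "y \<in> ball x r"
        using rv[OF that] by (cases "fe y") (auto simp: e2ennreal_ereal)
      then show "ennreal \<bar>v y - mean v x r\<bar> * indicator (ball x r) y \<le>
         e2ennreal \<bar>fe y - ereal (mean v x r)\<bar> * indicator (ball x r) y"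
        by (auto simp: indicator_def)
    qed simp
    also have "\<dots> \<le> ennreal (CP * r) * ((\<integral>\<^sup>+y\<in>ball x R'. h y \<partial>M) / emeasure M (ball x R'))"
      using P unfolding m R'_def .
    also have "\<dots> = ennreal (CP * r / vol x R') * (\<integral>\<^sup>+y\<in>ball x R'. h y \<partial>M)"
      unfolding emeasure_ball divide_ennreal_eq_mult[OF vol_pos[OF RR(1)]] mult.assoc[symmetric]
      using CP_pos r by (subst ennreal_mult[symmetric]) auto
    also have "(\<integral>\<^sup>+y\<in>ball x R'. h y \<partial>M) \<le> (\<integral>\<^sup>+y. gb y * indicator (ball x R') y + ennreal e * \<rho> y \<partial>M)"
      by (intro nn_integral_mono) (auto simp: h_def indicator_def)
    also have "\<dots> = (\<integral>\<^sup>+y\<in>ball x R'. gb y \<partial>M) + ennreal e * (\<integral>\<^sup>+y. \<rho> y \<partial>M)"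
      using borel_measurable_M[OF gb(1)] borel_measurable_M[OF \<rho>(1)]
      by (simp add: nn_integral_add nn_integral_cmult)
    also have "(\<integral>\<^sup>+y\<in>ball x R'. gb y \<partial>M) \<le> (\<integral>\<^sup>+y\<in>ball x R'. g y \<partial>M)"
      using gb(3) by (rule order.trans) (auto intro!: nn_integral_mono simp: indicator_def)
    finally show ?thesis by (simp add: mult_left_mono add_right_mono)
  qed
  show ?thesis
    unfolding R'_def[symmetric]
    by (rule ennreal_le_mult_epsilon[OF main \<rho>(2)]) (use CP_pos r in auto)
qed

text \<open>A doubling constant for all pairs of balls whose radii differ by a factor of at most \<open>32 * \<Lambda>\<close>.\<close>

definition \<kappa> :: real where "\<kappa> = C ^ (LEAST n. 32 * \<Lambda> \<le> 2 ^ n)"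

lemma \<kappa>_ge_1: "1 \<le> \<kappa>" using C_ge_1 by (simp add: \<kappa>_def one_le_power)

lemma vol_\<kappa>:
  assumes "0 < r" "dist x y + s \<le> 32 * \<Lambda> * r"
  shows "vol y s \<le> \<kappa> * vol x r"
proof -
  have "\<exists>n. 32 * \<Lambda> \<le> 2 ^ n" using real_arch_pow[of 2 "32 * \<Lambda>"] by (auto intro: less_imp_le)
  then have "32 * \<Lambda> \<le> 2 ^ (LEAST n. 32 * \<Lambda> \<le> 2 ^ n)" by (rule LeastI_ex)
  then have "32 * \<Lambda> * r \<le> 2 ^ (LEAST n. 32 * \<Lambda> \<le> 2 ^ n) * r" using assms(1) by (intro mult_right_mono) auto
  then show ?thesis unfolding \<kappa>_def using assms by (intro vol_compare assms(1)) linarith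
qed

text \<open>The Lipschitz bound makes \<rho> vary by at most \<rho> x / 4 on the ball of radius 4
  \<Lambda> \<rho> x. The radius 16 \<Lambda> \<rho> x leaves room for the closed ball of radius 8
  \<Lambda> \<rho> x, so that the local Poincare inequality at radius 4 \<rho> x takes place
  compactly inside \<Omega>. The Lipschitz bound is demanded on the whole space, which gives
  continuity and measurability.\<close>

definition admissible :: "'a set \<Rightarrow> ('a \<Rightarrow> real) \<Rightarrow> bool" where
  "admissible \<Omega> \<rho> \<longleftrightarrow> (\<forall>x y. \<bar>\<rho> x - \<rho> y\<bar> \<le> dist x y / (16 * \<Lambda>)) \<and>
     (\<forall>x\<in>\<Omega>. 0 < \<rho> x \<and> ball x (16 * \<Lambda> * \<rho> x) \<subseteq> \<Omega>)"

lemma admissible_pos: "admissible \<Omega> \<rho> \<Longrightarrow> x \<in> \<Omega> \<Longrightarrow> 0 < \<rho> x"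
  by (simp add: admissible_def)

lemma admissible_ball:
  assumes "admissible \<Omega> \<rho>" "x \<in> \<Omega>" "r \<le> 16 * \<Lambda> * \<rho> x"
  shows "ball x r \<subseteq> \<Omega>"
  using assms subset_ball[of r "16 * \<Lambda> * \<rho> x" x] unfolding admissible_def by blast

lemma admissible_near:
  assumes "admissible \<Omega> \<rho>" "x \<in> \<Omega>" "dist x z < 4 * \<Lambda> * \<rho> x"
  shows "z \<in> \<Omega>" "3/4 * \<rho> x \<le> \<rho> z" "\<rho> z \<le> 5/4 * \<rho> x"
proof -
  have p: "\<rho> x > 0" using assms by (simp add: admissible_pos)
  have "4 * \<Lambda> * \<rho> x \<le> 16 * \<Lambda> * \<rho> x" using p \<Lambda>_ge_1 by simp
  then show "z \<in> \<Omega>" using admissible_ball[OF assms(1,2)] assms(3) by (meson mem_ball subsetD)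
  have "\<bar>\<rho> x - \<rho> z\<bar> \<le> dist x z / (16 * \<Lambda>)" using assms(1) by (simp add: admissible_def)
  also have "\<dots> \<le> (4 * \<Lambda> * \<rho> x) / (16 * \<Lambda>)" using assms(3) \<Lambda>_ge_1 by (intro divide_right_mono) auto
  also have "\<dots> = \<rho> x / 4" using \<Lambda>_ge_1 by simp
  finally show "3/4 * \<rho> x \<le> \<rho> z" "\<rho> z \<le> 5/4 * \<rho> x" unfolding abs_le_iff by linarith+
qed

lemma admissible_measurable:
  assumes "admissible \<Omega> \<rho>"
  shows "\<rho> \<in> borel_measurable M"
proof (rule continuous_measurable)
  have "(1 / (16 * \<Lambda>))-lipschitz_on UNIV \<rho>"
    using assms \<Lambda>_ge_1 by (intro lipschitz_onI) (auto simp: admissible_def dist_real_def)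
  then show "continuous_on UNIV \<rho>" by (rule lipschitz_on_continuous_on)
qed

lemma indicator_ball_measurable:
  assumes "f \<in> measurable N M" "g \<in> measurable N M" "h \<in> borel_measurable N"
  shows "(\<lambda>w. indicator (ball (f w) (h w)) (g w) :: 'b::{comm_semiring_1,t2_space}) \<in> borel_measurable N"
proof -
  have "{w \<in> space N. dist (f w) (g w) < h w} \<in> sets N"
    using dist_measurable[OF assms(1,2)] assms(3) by measurable
  then have "(indicator {w \<in> space N. dist (f w) (g w) < h w} :: _ \<Rightarrow> 'b) \<in> borel_measurable N"
    by (rule borel_measurable_indicator)
  then show ?thesis by (rule measurable_cong[THEN iffD1, rotated]) (auto simp: indicator_def)
qed

lemma indicator_ball_measurable_pair:
  "h \<in> borel_measurable M \<Longrightarrow>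
   (\<lambda>w. indicator (ball (fst w) (h (fst w))) (snd w) :: 'b::{comm_semiring_1,t2_space}) \<in> borel_measurable
     (M \<Otimes>\<^sub>M M)"
  by (intro indicator_ball_measurable measurable_fst measurable_snd measurable_compose[OF measurable_fst])

lemma vol_measurable:
  assumes h: "h \<in> borel_measurable M"
  shows "(\<lambda>x. vol x (h x)) \<in> borel_measurable M"
proof -
  have "(\<lambda>x. \<integral>\<^sup>+y. indicator (ball x (h x)) y \<partial>M) \<in> borel_measurable M"
    using borel_measurable_nn_integral_fst[OF indicator_ball_measurable_pair[OF h]] by simp
  then have "(\<lambda>x. enn2real (emeasure M (ball x (h x)))) \<in> borel_measurable M" by simp
  then show ?thesis by (simp add: vol_def measure_def)
qed

text \<open>If z lies in the ball of radius a \<rho> x about x, then \<rho> x is at most 4/3 \<rho>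
  z, so x lies in the ball of radius 2 a \<rho> z about z, and the volumes of the two balls of scale
  a are comparable with constant \<kappa>. After these replacements Tonelli's theorem swaps the
  roles of x and z.\<close>

lemma tonelli_average:
  assumes adm: "admissible \<Omega> \<rho>" and \<Omega>: "open \<Omega>" and a: "0 < a" "a \<le> 4 * \<Lambda>"
    and H: "case_prod H \<in> borel_measurable (M \<Otimes>\<^sub>M M)"
  shows "(\<integral>\<^sup>+x\<in>\<Omega>. ennreal (1 / vol x (a * \<rho> x)) * (\<integral>\<^sup>+z\<in>ball x (a * \<rho> x). H x z \<partial>M) \<partial>M)
    \<le> ennreal \<kappa> * (\<integral>\<^sup>+z\<in>\<Omega>. ennreal (1 / vol z (a * \<rho> z)) * (\<integral>\<^sup>+x\<in>ball z (2 * a * \<rho> z) \<inter> \<Omega>. H x z \<partial>M) \<partial>M)"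
proof -
  interpret P: pair_sigma_finite M M ..
  note [measurable] = admissible_measurable[OF adm] open_in_sets[OF \<Omega>] H
  have [measurable]: "(\<lambda>x. vol x (a * \<rho> x)) \<in> borel_measurable M" by (rule vol_measurable) measurable
  have wm: "(\<lambda>x. ennreal (1 / vol x (a * \<rho> x))) \<in> borel_measurable M" by measurable
  have H': "(\<lambda>w. H (fst w) (snd w)) \<in> borel_measurable (M \<Otimes>\<^sub>M M)"
    using H by (simp add: case_prod_beta')
  have om: "(indicator \<Omega> :: 'a \<Rightarrow> ennreal) \<in> borel_measurable M" by measurable
  define J where "J x z = H x z * indicator (ball x (a * \<rho> x)) z * indicator \<Omega> x *
     ennreal (1 / vol x (a * \<rho> x))" for x z
  have [measurable]: "case_prod J \<in> borel_measurable (M \<Otimes>\<^sub>M M)"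
    unfolding J_def case_prod_beta'
    by (intro borel_measurable_times_ennreal H' indicator_ball_measurable_pair
      measurable_compose[OF measurable_fst om] measurable_compose[OF measurable_fst wm]) measurable
  have Jm: "J x z \<le>
     ennreal \<kappa> * (indicator \<Omega> z * ennreal (1 / vol z (a * \<rho> z)) *
    (H x z * indicator (ball z (2 * a * \<rho> z) \<inter> \<Omega>) x))" for x z
  proof (cases "x \<in> \<Omega> \<and> z \<in> ball x (a * \<rho> x)")
    case True
    then have x: "x \<in> \<Omega>" and d: "dist x z < a * \<rho> x" by auto
    have p: "\<rho> x > 0" using adm x by (rule admissible_pos)
    have "a * \<rho> x \<le> 4 * \<Lambda> * \<rho> x" using a p by (intro mult_right_mono) auto
    then have d4: "dist x z < 4 * \<Lambda> * \<rho> x" using d by linarith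
    note near = admissible_near[OF adm x d4]
    have r: "a * (3/4 * \<rho> x) \<le> a * \<rho> z" "a * \<rho> z \<le> a * (5/4 * \<rho> x)"
      using near a by (intro mult_left_mono; simp)+
    have ap: "0 < a * \<rho> x" using a p by simp
    have zp: "0 < a * \<rho> z" using r ap by linarith
    have "4 * (a * \<rho> x) \<le> 32 * \<Lambda> * (a * \<rho> x)" using ap \<Lambda>_ge_1 by (intro mult_right_mono) auto
    then have "vol z (a * \<rho> z) \<le> \<kappa> * vol x (a * \<rho> x)"
      using d r ap by (intro vol_\<kappa>) auto
    then have "1 / vol x (a * \<rho> x) \<le> \<kappa> * (1 / vol z (a * \<rho> z))"
      using vol_pos[OF ap, of x] vol_pos[OF zp, of z] by (simp add: field_simps)
    then have *: "ennreal (1 / vol x (a * \<rho> x)) \<le> ennreal \<kappa> * ennreal (1 / vol z (a * \<rho> z))"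
      using \<kappa>_ge_1 by (simp add: ennreal_mult''[symmetric] ennreal_leI)
    have "x \<in> ball z (2 * a * \<rho> z)" using d r ap by (auto simp: dist_commute)
    then have "J x z = H x z * ennreal (1 / vol x (a * \<rho> x))" using True by (simp add: J_def)
    also have "\<dots> \<le> H x z * (ennreal \<kappa> * ennreal (1 / vol z (a * \<rho> z)))" by (intro mult_left_mono *) simp
    finally show ?thesis using near x \<open>x \<in> ball z (2 * a * \<rho> z)\<close> by (simp add: ac_simps)
  qed (auto simp: J_def)
  have "(\<integral>\<^sup>+x\<in>\<Omega>. ennreal (1 / vol x (a * \<rho> x)) * (\<integral>\<^sup>+z\<in>ball x (a * \<rho> x). H x z \<partial>M) \<partial>M)
    = (\<integral>\<^sup>+x. \<integral>\<^sup>+z. J x z \<partial>M \<partial>M)"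
  proof (intro nn_integral_cong)
    fix x
    have Hx: "(\<lambda>z. H x z) \<in> borel_measurable M" using measurable_Pair2[OF H, of x] by simp
    show "ennreal (1 / vol x (a * \<rho> x)) * (\<integral>\<^sup>+z\<in>ball x (a * \<rho> x). H x z \<partial>M) * indicator \<Omega> x =
       (\<integral>\<^sup>+z. J x z \<partial>M)"
      unfolding J_def using Hx
      by (subst nn_integral_multc, measurable)+ (simp add: ac_simps)
  qed
  also have "\<dots> = (\<integral>\<^sup>+z. \<integral>\<^sup>+x. J x z \<partial>M \<partial>M)"
    using P.Fubini'[of J] by simp
  also have "\<dots> \<le>
     (\<integral>\<^sup>+z. ennreal \<kappa> * (ennreal (1 / vol z (a * \<rho> z)) * (\<integral>\<^sup>+x\<in>ball z (2 * a * \<rho> z) \<inter> \<Omega>. H x z \<partial>M) * indicator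
    \<Omega> z) \<partial>M)"
  proof (intro nn_integral_mono)
    fix z
    have Hz: "(\<lambda>x. H x z) \<in> borel_measurable M" using measurable_Pair1[OF H, of z] by simp
    have [measurable]: "ball z (2 * a * \<rho> z) \<inter> \<Omega> \<in> sets M" using \<Omega> by (intro open_in_sets) auto
    have "(\<integral>\<^sup>+x. J x z \<partial>M) \<le>
       (\<integral>\<^sup>+x. ennreal \<kappa> * (indicator \<Omega> z * ennreal (1 / vol z (a * \<rho> z)) *
      (H x z * indicator (ball z (2 * a * \<rho> z) \<inter> \<Omega>) x)) \<partial>M)"
      by (intro nn_integral_mono Jm)
    also have "\<dots> = ennreal \<kappa> * (indicator \<Omega> z * ennreal (1 / vol z (a * \<rho> z)) *
       (\<integral>\<^sup>+x\<in>ball z (2 * a * \<rho> z) \<inter> \<Omega>. H x z \<partial>M))"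
      using Hz by (subst nn_integral_cmult, measurable)+
    finally show "(\<integral>\<^sup>+x. J x z \<partial>M) \<le>
       ennreal \<kappa> * (ennreal (1 / vol z (a * \<rho> z)) * (\<integral>\<^sup>+x\<in>ball z (2 * a * \<rho> z) \<inter> \<Omega>. H x z \<partial>M) * indicator \<Omega>
      z)"
      by (simp add: ac_simps)
  qed
  also have "\<dots> = ennreal \<kappa> * (\<integral>\<^sup>+z\<in>\<Omega>. ennreal (1 / vol z (a * \<rho> z)) *
     (\<integral>\<^sup>+x\<in>ball z (2 * a * \<rho> z) \<inter> \<Omega>. H x z \<partial>M) \<partial>M)"
  proof (rule nn_integral_cmult)
    have H'': "(\<lambda>w. H (snd w) (fst w)) \<in> borel_measurable (M \<Otimes>\<^sub>M M)"
      using measurable_compose[OF measurable_pair_swap' H] by (simp add: case_prod_beta')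
    have i1: "(\<lambda>w. indicator (ball (fst w) (2 * a * \<rho> (fst w))) (snd w) :: ennreal) \<in> borel_measurable
       (M \<Otimes>\<^sub>M M)"
      by (rule indicator_ball_measurable_pair) measurable
    have i2: "(\<lambda>w. indicator \<Omega> (snd w) :: ennreal) \<in> borel_measurable (M \<Otimes>\<^sub>M M)"
      by (rule measurable_compose[OF measurable_snd om])
    note borel_measurable_times_ennreal[OF H'' borel_measurable_times_ennreal[OF i1 i2]]
    from borel_measurable_nn_integral_fst[OF this]
    have im: "(\<lambda>z. \<integral>\<^sup>+x\<in>ball z (2 * a * \<rho> z) \<inter> \<Omega>. H x z \<partial>M) \<in> borel_measurable M"
      by (simp add: indicator_inter_arith)
    show "(\<lambda>z. ennreal (1 / vol z (a * \<rho> z)) * (\<integral>\<^sup>+x\<in>ball z (2 * a * \<rho> z) \<inter> \<Omega>. H x z \<partial>M) *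
       indicator \<Omega> z) \<in> borel_measurable M"
      by (intro borel_measurable_times_ennreal wm im om)
  qed
  finally show ?thesis .
qed

end

section \<open>Limits, compact exhaustions and local measurability\<close>

lemma le_liminf_add_null:
  fixes a :: ennreal
  assumes "\<And>i. a \<le> b i + e i" "e \<longlonglongrightarrow> 0"
  shows "a \<le> liminf b"
proof (rule ennreal_le_epsilon)
  fix \<epsilon> :: real assume \<epsilon>: "0 < \<epsilon>"
  have "\<forall>\<^sub>F i in sequentially. e i < ennreal \<epsilon>"
    using assms(2) by (rule order_tendstoD) (simp add: \<epsilon>)
  then have "\<forall>\<^sub>F i in sequentially. a - ennreal \<epsilon> \<le> b i"
  proof eventually_elim
    fix i assume "e i < ennreal \<epsilon>"
    then have "b i + e i \<le> b i + ennreal \<epsilon>" by (intro add_left_mono less_imp_le)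
    with assms(1)[of i] have "a \<le> ennreal \<epsilon> + b i" unfolding add.commute[of "ennreal \<epsilon>"] by (rule order.trans)
    then show "a - ennreal \<epsilon> \<le> b i" by (simp add: ennreal_minus_le_iff)
  qed
  then have "a - ennreal \<epsilon> \<le> liminf b" by (rule Liminf_bounded)
  then show "a \<le> liminf b + ennreal \<epsilon>" by (simp add: ennreal_minus_le_iff add.commute)
qed

lemma set_nn_integral_abs:
  fixes f :: "'a \<Rightarrow> real"
  assumes "set_integrable M A f"
  shows "(\<integral>\<^sup>+y\<in>A. ennreal \<bar>f y\<bar> \<partial>M) = ennreal (LINT y:A|M. \<bar>f y\<bar>)"
proof -
  have "integrable M (\<lambda>y. indicator A y *\<^sub>R \<bar>f y\<bar>)"
    using set_integrable_abs[OF assms] by (simp add: set_integrable_def)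
  then have "(\<integral>\<^sup>+y. ennreal (indicator A y *\<^sub>R \<bar>f y\<bar>) \<partial>M) = ennreal (LINT y:A|M. \<bar>f y\<bar>)"
    unfolding set_lebesgue_integral_def by (rule nn_integral_eq_integral) simp
  then show ?thesis by (simp add: indicator_mult_ennreal mult.commute)
qed

text \<open>The distance to the complement is expressed by a quantifier over outside points, so that
  \<Omega> = \<open>UNIV\<close>, with empty complement, needs no separate treatment. The thresholds
  2^-k are the scales that reappear in the boundary estimate.\<close>

definition exhaustion :: "'a::metric_space set \<Rightarrow> 'a \<Rightarrow> nat \<Rightarrow> 'a set" where
  "exhaustion \<Omega> p n = {x. dist p x \<le> real n \<and> (\<forall>z. z \<notin> \<Omega> \<longrightarrow> 1 / 2 ^ n \<le> dist x z)}"

lemma exhaustion_subset: "exhaustion \<Omega> p n \<subseteq> \<Omega>"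
proof
  fix x assume "x \<in> exhaustion \<Omega> p n"
  then have x: "\<forall>z. z \<notin> \<Omega> \<longrightarrow> 1 / 2 ^ n \<le> dist x z" by (simp add: exhaustion_def)
  show "x \<in> \<Omega>"
  proof (rule ccontr)
    assume "x \<notin> \<Omega>"
    then have "1 / 2 ^ n \<le> dist x x" using x by blast
    then have "1 / 2 ^ n \<le> (0::real)" by simp
    moreover have "0 < (1 / 2 ^ n :: real)" by simp
    ultimately show False by linarith
  qed
qed

lemma closed_exhaustion: "closed (exhaustion \<Omega> p n)"
proof -
  have "exhaustion \<Omega> p n = {x. dist p x \<le> real n} \<inter> (\<Inter>z\<in>-\<Omega>. {x. 1 / 2 ^ n \<le> dist x z})"
    by (auto simp: exhaustion_def)
  moreover have "closed {x. dist p x \<le> real n}" "closed {x. 1 / 2 ^ n \<le> dist x z}" for z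
    by (intro closed_Collect_le continuous_intros)+
  ultimately show ?thesis by (simp only:) (intro closed_Int closed_INT ballI)
qed

text \<open>Membership alone would not suffice: a whole ball in one set shows that the interiors
  cover \<Omega>, and it keeps the shell index bounded near each point.\<close>

lemma exhaustion_ball:
  assumes "open \<Omega>" "x \<in> \<Omega>"
  obtains \<delta> n where "0 < \<delta>" "ball x \<delta> \<subseteq> exhaustion \<Omega> p n"
proof -
  obtain \<epsilon> where \<epsilon>: "\<epsilon> > 0" "ball x \<epsilon> \<subseteq> \<Omega>" using assms open_contains_ball by blast
  obtain n1 where n1: "(1/2) ^ n1 < \<epsilon> / 2" using real_arch_pow_inv[of "\<epsilon>/2" "1/2"] \<epsilon> by auto
  obtain n2 where n2: "dist p x + \<epsilon> \<le> real n2" using real_arch_simple by blast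
  define n where "n = max n1 n2"
  have "(1/2) ^ n \<le> ((1/2) ^ n1 :: real)" by (rule power_decreasing) (auto simp: n_def)
  then have n: "1 / 2 ^ n < \<epsilon> / 2" using n1 by (simp add: power_one_over)
  have "real n2 \<le> real n" by (simp add: n_def)
  then have n': "dist p x + \<epsilon> \<le> real n" using n2 by linarith
  have "ball x (\<epsilon> / 2) \<subseteq> exhaustion \<Omega> p n"
  proof
    fix y assume "y \<in> ball x (\<epsilon> / 2)"
    then have y: "dist x y < \<epsilon> / 2" by simp
    have "dist p y \<le> dist p x + dist x y" by (rule dist_triangle)
    then have "dist p y \<le> real n" using y n' \<epsilon> by linarith
    moreover have "1 / 2 ^ n \<le> dist y z" if "z \<notin> \<Omega>" for z
    proof -
      have "z \<notin> ball x \<epsilon>" using that \<epsilon> by blast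
      then have "\<epsilon> \<le> dist x z" by simp
      also have "\<dots> \<le> dist x y + dist y z" by (rule dist_triangle)
      finally show ?thesis using y n by linarith
    qed
    ultimately show "y \<in> exhaustion \<Omega> p n" by (simp add: exhaustion_def)
  qed
  then show thesis using that[of "\<epsilon>/2" n] \<epsilon> by auto
qed

context doubling_measure
begin

lemma compact_exhaustion: "compact (exhaustion \<Omega> (p::'a) n)"
proof (rule compact_closed_bounded[OF closed_exhaustion])
  have "exhaustion \<Omega> p n \<subseteq> cball p (real n)" by (auto simp: exhaustion_def)
  then show "bounded (exhaustion \<Omega> p n)" by (rule bounded_subset[OF bounded_cball])
qed

text \<open>Members of the local spaces are measurable only on sets compactly inside \<Omega>.
  Countably many interiors of exhausting sets, together with the complement, glue these pieces to
  one measurable function on the whole space.\<close>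

lemma measurable_locally:
  fixes f :: "'a \<Rightarrow> ereal"
  assumes \<Omega>: "open \<Omega>"
    and f: "\<And>\<Omega>'. open \<Omega>' \<Longrightarrow> compactly_inside \<Omega>' \<Omega> \<Longrightarrow> f \<in> borel_measurable (restrict_space M \<Omega>')"
  shows "(\<lambda>x. real_of_ereal (f x) * indicator \<Omega> x) \<in> borel_measurable M"
proof -
  fix p :: 'a
  define U where "U n = interior (exhaustion \<Omega> p n)" for n
  have UK: "U n \<subseteq> exhaustion \<Omega> p n" for n by (simp add: U_def interior_subset)
  have cov: "\<Omega> \<subseteq> (\<Union>n. U n)"
  proof
    fix x assume "x \<in> \<Omega>"
    then obtain \<delta> n where "0 < \<delta>" "ball x \<delta> \<subseteq> exhaustion \<Omega> p n" using exhaustion_ball[OF \<Omega>] by blast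
    then have "x \<in> U n" unfolding U_def mem_interior by blast
    then show "x \<in> (\<Union>n. U n)" by blast
  qed
  have ci: "compactly_inside (U n) \<Omega>" for n
  proof -
    have "closure (U n) \<subseteq> exhaustion \<Omega> p n" by (rule closure_minimal[OF UK closed_exhaustion])
    moreover from this have "compact (closure (U n))"
      using compact_Int_closed[OF compact_exhaustion[of \<Omega> p n] closed_closure[of "U n"]]
        by (simp add: Int_absorb1)
    ultimately show ?thesis using exhaustion_subset unfolding compactly_inside_def by blast
  qed
  show ?thesis
  proof (rule measurable_piecewise_restrict[of "insert (- \<Omega>) (range U)"])
    show "countable (insert (- \<Omega>) (range U))" by simp
    show "space M \<subseteq> \<Union> (insert (- \<Omega>) (range U))" using cov by auto
    fix A assume A: "A \<in> insert (- \<Omega>) (range U)"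
    then have "A = - \<Omega> \<or> (\<exists>n. A = U n)" by auto
    then have "A \<in> sets M" using \<Omega> by (metis U_def closed_Compl closed_in_sets open_in_sets open_interior)
    then show "A \<inter> space M \<in> sets M" by simp
    show "(\<lambda>x. real_of_ereal (f x) * indicator \<Omega> x) \<in> borel_measurable (restrict_space M A)"
    proof (cases "A = - \<Omega>")
      case True
      then have "(\<lambda>x. real_of_ereal (f x) * indicator \<Omega> x) \<in> borel_measurable (restrict_space M A) \<longleftrightarrow>
        (\<lambda>x. 0 :: real) \<in> borel_measurable (restrict_space M A)"
        by (intro measurable_cong) (auto simp: space_restrict_space)
      then show ?thesis by simp
    next
      case False
      then obtain n where n: "A = U n" using A by blast
      have "(\<lambda>x. real_of_ereal (f x)) \<in> borel_measurable (restrict_space M A)"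
        unfolding n by (intro borel_measurable_real_of_ereal f ci) (simp add: U_def)
      moreover have "(\<lambda>x. real_of_ereal (f x) * indicator \<Omega> x) \<in> borel_measurable (restrict_space M A) \<longleftrightarrow>
        (\<lambda>x. real_of_ereal (f x)) \<in> borel_measurable (restrict_space M A)"
        using UK exhaustion_subset n by (intro measurable_cong) (force simp: space_restrict_space)
      ultimately show ?thesis by simp
    qed
  qed
qed

end

section \<open>Mean oscillations and total variation\<close>

context poincare_space
begin

lemma integrable_on_ball:
  fixes f :: "'a \<Rightarrow> real"
  assumes "integrable M f" shows "set_integrable M (ball x r) f"
  unfolding set_integrable_def by (rule integrable_mult_indicator[OF ball_in_sets assms])

text \<open>The factor 2 counts the L^1 distance once directly and once through the difference of
  the two means.\<close>

lemma osc_le_add: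
  assumes r: "0 < r" and f: "set_integrable M (ball x r) f" and g: "set_integrable M (ball x r) g"
    and [measurable]: "f \<in> borel_measurable M" "g \<in> borel_measurable M"
  shows "osc f x r \<le> osc g x r + ennreal (2 / vol x r) * (\<integral>\<^sup>+y\<in>ball x r. ennreal \<bar>f y - g y\<bar> \<partial>M)"
proof -
  note [measurable] = ball_in_sets
  define V where "V = vol x r"
  have V: "V > 0" using r by (simp add: V_def vol_pos)
  have fg: "set_integrable M (ball x r) (\<lambda>y. f y - g y)" using f g by (rule set_integral_diff)
  define d where "d = (LINT y:ball x r|M. \<bar>f y - g y\<bar>)"
  have D: "(\<integral>\<^sup>+y\<in>ball x r. ennreal \<bar>f y - g y\<bar> \<partial>M) = ennreal d"
    unfolding d_def by (rule set_nn_integral_abs[OF fg])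
  have d0: "d \<ge> 0" unfolding d_def set_lebesgue_integral_def by (intro integral_nonneg_AE) auto
  have "mean f x r - mean g x r = (LINT y:ball x r|M. f y - g y) / V"
    using set_integral_diff(2)[OF f g] by (simp add: mean_def V_def diff_divide_distrib)
  moreover have "\<bar>LINT y:ball x r|M. f y - g y\<bar> \<le> d"
    unfolding d_def using set_integral_norm_bound[OF fg] by simp
  ultimately have m: "\<bar>mean f x r - mean g x r\<bar> \<le> d / V" using V by (simp add: divide_right_mono)
  have "(\<integral>\<^sup>+y\<in>ball x r. ennreal \<bar>f y - mean f x r\<bar> \<partial>M) \<le>
    (\<integral>\<^sup>+y. (ennreal \<bar>g y - mean g x r\<bar> * indicator (ball x r) y + ennreal \<bar>f y - g y\<bar> * indicator (ball x r)
      y)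
       + ennreal (d / V) * indicator (ball x r) y \<partial>M)"
  proof (rule nn_integral_mono)
    fix y
    have "\<bar>f y - mean f x r\<bar> \<le> \<bar>g y - mean g x r\<bar> + \<bar>f y - g y\<bar> + d / V" using m by linarith
    then have "ennreal \<bar>f y - mean f x r\<bar> \<le> ennreal (\<bar>g y - mean g x r\<bar> + \<bar>f y - g y\<bar> + d / V)"
      by (rule ennreal_leI)
    also have "\<dots> = ennreal \<bar>g y - mean g x r\<bar> + ennreal \<bar>f y - g y\<bar> + ennreal (d / V)"
      using d0 V by (subst ennreal_plus, simp, simp)+ simp
    finally show "ennreal \<bar>f y - mean f x r\<bar> * indicator (ball x r) y \<le>
      (ennreal \<bar>g y - mean g x r\<bar> * indicator (ball x r) y + ennreal \<bar>f y - g y\<bar> * indicator (ball x r) y)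
       + ennreal (d / V) * indicator (ball x r) y"
      by (auto simp: indicator_def)
  qed
  also have "\<dots> = (\<integral>\<^sup>+y\<in>ball x r. ennreal \<bar>g y - mean g x r\<bar> \<partial>M) + ennreal d + ennreal (d / V) * ennreal V"
    by (subst nn_integral_add, measurable)+ (simp add: nn_integral_cmult_indicator D emeasure_ball V_def)
  also have "\<dots> = (\<integral>\<^sup>+y\<in>ball x r. ennreal \<bar>g y - mean g x r\<bar> \<partial>M) + ennreal (2 * d)"
    using V d0 by (simp add: add.assoc flip: ennreal_mult'' ennreal_plus)
  finally have "osc f x r \<le> ennreal (1 / V) * ((\<integral>\<^sup>+y\<in>ball x r. ennreal \<bar>g y - mean g x r\<bar> \<partial>M) +
     ennreal (2 * d))"
    unfolding osc_def V_def by (rule mult_left_mono) simp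
  also have "\<dots> = osc g x r + ennreal (1 / V) * ennreal (2 * d)"
    by (simp add: osc_def V_def distrib_left)
  also have "ennreal (1 / V) * ennreal (2 * d) = ennreal (2 / V) * ennreal d"
    using V d0 by (simp flip: ennreal_mult'')
  finally show ?thesis by (simp add: D V_def)
qed

lemma osc_measurable:
  assumes h: "h \<in> borel_measurable M" and f: "f \<in> borel_measurable M"
  shows "(\<lambda>x. osc f x (h x)) \<in> borel_measurable M"
    and "(\<lambda>x. mean f x (h x)) \<in> borel_measurable M"
proof -
  have f2: "(\<lambda>w. f (snd w)) \<in> borel_measurable (M \<Otimes>\<^sub>M M)" by (rule measurable_compose[OF measurable_snd f])
  have "(\<lambda>w. indicator (ball (fst w) (h (fst w))) (snd w) *\<^sub>R f (snd w)) \<in> borel_measurable (M \<Otimes>\<^sub>M M)"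
    by (intro borel_measurable_scaleR indicator_ball_measurable_pair[OF h] f2)
  then have "(\<lambda>x. LINT y:ball x (h x)|M. f y) \<in> borel_measurable M"
    unfolding set_lebesgue_integral_def
    using borel_measurable_lebesgue_integral[of "\<lambda>x y. indicator (ball x (h x)) y *\<^sub>R f y" M]
      by (simp add: case_prod_beta')
  then show m: "(\<lambda>x. mean f x (h x)) \<in> borel_measurable M"
    unfolding mean_def by (intro borel_measurable_divide vol_measurable h)
  have "(\<lambda>w. ennreal \<bar>f (snd w) - mean f (fst w) (h (fst w))\<bar> * indicator (ball (fst w) (h (fst w))) (snd w))
     \<in> borel_measurable (M \<Otimes>\<^sub>M M)"
    by (intro borel_measurable_times_ennreal indicator_ball_measurable_pair[OF h] measurable_compose[OF _
      measurable_ennreal]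
       borel_measurable_abs borel_measurable_diff f2 measurable_compose[OF measurable_fst m])
  from borel_measurable_nn_integral_fst[OF this]
  show "(\<lambda>x. osc f x (h x)) \<in> borel_measurable M"
    unfolding osc_def using vol_measurable[OF h]
    by (intro borel_measurable_times_ennreal measurable_compose[OF _ measurable_ennreal]
      borel_measurable_divide) auto
qed

text \<open>After the exchange the inner integrand no longer depends on the integration variable, so
  it contributes at most the volume of the ball of doubled radius; this costs the second factor
  \<kappa>.\<close>

lemma tonelli_average_const:
  assumes adm: "admissible \<Omega> \<rho>" and \<Omega>: "open \<Omega>" and a: "0 < a" "a \<le> 4 * \<Lambda>"
    and h: "h \<in> borel_measurable M"
  shows "(\<integral>\<^sup>+x\<in>\<Omega>. ennreal (1 / vol x (a * \<rho> x)) * (\<integral>\<^sup>+z\<in>ball x (a * \<rho> x). h z \<partial>M) \<partial>M)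
    \<le> ennreal (\<kappa> * \<kappa>) * (\<integral>\<^sup>+z\<in>\<Omega>. h z \<partial>M)"
proof -
  have "(\<integral>\<^sup>+x\<in>\<Omega>. ennreal (1 / vol x (a * \<rho> x)) * (\<integral>\<^sup>+z\<in>ball x (a * \<rho> x). h z \<partial>M) \<partial>M)
    \<le> ennreal \<kappa> * (\<integral>\<^sup>+z\<in>\<Omega>. ennreal (1 / vol z (a * \<rho> z)) * (\<integral>\<^sup>+x\<in>ball z (2 * a * \<rho> z) \<inter> \<Omega>. h z \<partial>M) \<partial>M)"
    using h by (intro tonelli_average[OF adm \<Omega> a]) (simp add: case_prod_beta' measurable_compose[OF
      measurable_snd])
  also have "\<dots> \<le> ennreal \<kappa> * (\<integral>\<^sup>+z. ennreal \<kappa> * (h z * indicator \<Omega> z) \<partial>M)"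
  proof (intro mult_left_mono nn_integral_mono)
    fix z
    show "ennreal (1 / vol z (a * \<rho> z)) * (\<integral>\<^sup>+x\<in>ball z (2 * a * \<rho> z) \<inter> \<Omega>. h z \<partial>M) * indicator \<Omega> z \<le>
       ennreal \<kappa> * (h z * indicator \<Omega> z)"
    proof (cases "z \<in> \<Omega>")
      case True
      then have z: "0 < a * \<rho> z" using a admissible_pos[OF adm] by simp
      have "(\<integral>\<^sup>+x\<in>ball z (2 * a * \<rho> z) \<inter> \<Omega>. h z \<partial>M) \<le> (\<integral>\<^sup>+x\<in>ball z (2 * a * \<rho> z). h z \<partial>M)"
        by (intro nn_integral_mono) (auto simp: indicator_def)
      also have "\<dots> = h z * ennreal (vol z (2 * a * \<rho> z))"
        by (simp add: nn_integral_cmult_indicator emeasure_ball)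
      also have "vol z (2 * a * \<rho> z) \<le> \<kappa> * vol z (a * \<rho> z)"
      proof -
        have "2 * (a * \<rho> z) \<le> 32 * \<Lambda> * (a * \<rho> z)" using z \<Lambda>_ge_1 by (intro mult_right_mono) auto
        then show ?thesis using z by (intro vol_\<kappa>) (auto simp: mult.assoc)
      qed
      finally have "(\<integral>\<^sup>+x\<in>ball z (2 * a * \<rho> z) \<inter> \<Omega>. h z \<partial>M) \<le> h z * ennreal (\<kappa> * vol z (a * \<rho> z))"
        by (simp add: mult_left_mono ennreal_leI)
      then have "ennreal (1 / vol z (a * \<rho> z)) * (\<integral>\<^sup>+x\<in>ball z (2 * a * \<rho> z) \<inter> \<Omega>. h z \<partial>M) \<le>
        ennreal (1 / vol z (a * \<rho> z)) * (h z * ennreal (\<kappa> * vol z (a * \<rho> z)))" by (rule mult_left_mono) simp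
      also have "\<dots> = (ennreal (1 / vol z (a * \<rho> z)) * ennreal (\<kappa> * vol z (a * \<rho> z))) * h z"
        by (simp add: ac_simps)
      also have "ennreal (1 / vol z (a * \<rho> z)) * ennreal (\<kappa> * vol z (a * \<rho> z)) = ennreal \<kappa>"
        using \<kappa>_ge_1 vol_pos[OF z, of z] by (simp flip: ennreal_mult'')
      finally show ?thesis using True by simp
    qed simp
  qed simp
  also have "\<dots> = ennreal (\<kappa> * \<kappa>) * (\<integral>\<^sup>+z\<in>\<Omega>. h z \<partial>M)"
    using h \<kappa>_ge_1 open_in_sets[OF \<Omega>]
    by (subst nn_integral_cmult) (auto simp: ennreal_mult mult.assoc)
  finally show ?thesis .
qed

text \<open>The only place where the approximating sequence is used. For each member the Poincare
  inequality at radius 4 \<rho> x is integrated against 1/\<rho>, which cancels the radius up to the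
  factor 4, and the exchange of integrals returns the integral of the gradient at the cost \<kappa>
  * \<kappa>. For fixed x the oscillations pass to \<open>u\<close> by L^1 convergence on one ball
  compactly inside \<Omega>; Fatou's lemma does the rest. The bound is independent of
  \<rho>.\<close>

lemma osc_integral_le_variation:
  fixes w :: "nat \<Rightarrow> 'a \<Rightarrow> ereal"
  assumes adm: "admissible \<Omega> \<rho>" and \<Omega>: "open \<Omega>" and u: "integrable M u"
    and uU: "\<And>y. y \<in> \<Omega> \<Longrightarrow> u y = real_of_ereal (U y)"
    and w: "\<And>i. w i \<in> N11_loc M \<Omega>" and g: "\<And>i. weak_upper_gradient M \<Omega> (w i) (g i)"
    and conv: "converges_L1_loc M \<Omega> w U"
  shows "(\<integral>\<^sup>+x\<in>\<Omega>. ennreal (1 / \<rho> x) * osc u x (4 * \<rho> x) \<partial>M)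
    \<le> ennreal (4 * CP * (\<kappa> * \<kappa>)) * liminf (\<lambda>i. \<integral>\<^sup>+x\<in>\<Omega>. g i x \<partial>M)"
proof -
  note [measurable] = admissible_measurable[OF adm] open_in_sets[OF \<Omega>]
  define v where "v i y = real_of_ereal (w i y) * indicator \<Omega> y" for i y
  have w_L1: "w i \<in> L1 M \<Omega>'" if "open \<Omega>'" "compactly_inside \<Omega>' \<Omega>" for i \<Omega>'
    using w[of i] that unfolding N11_loc_def N11_def N11_norm_def L1_def by (auto simp: less_top[symmetric])
  have v_meas: "v i \<in> borel_measurable M" for i
    unfolding v_def using w_L1 by (intro measurable_locally[OF \<Omega>]) (simp add: L1_def)
  have rho4: "(\<lambda>x. 4 * \<rho> x) \<in> borel_measurable M" by measurable
  have step: "(\<integral>\<^sup>+x\<in>\<Omega>. ennreal (1 / \<rho> x) * osc (v i) x (4 * \<rho> x) \<partial>M) \<le>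
     ennreal (4 * CP * (\<kappa> * \<kappa>)) * (\<integral>\<^sup>+x\<in>\<Omega>. g i x \<partial>M)" for i
  proof -
    have gm: "(\<lambda>y. g i y * indicator \<Omega> y) \<in> borel_measurable M"
      using g[of i] unfolding weak_upper_gradient_def
      by (subst borel_measurable_restrict_space_iff_ennreal[symmetric]) auto
    have "(\<integral>\<^sup>+x\<in>\<Omega>. ennreal (1 / \<rho> x) * osc (v i) x (4 * \<rho> x) \<partial>M) \<le>
      (\<integral>\<^sup>+x. ennreal (4 * CP) * (ennreal (1 / vol x (4 * \<Lambda> * \<rho> x)) * (\<integral>\<^sup>+z\<in>ball x (4 * \<Lambda> * \<rho> x). g i z *
        indicator \<Omega> z \<partial>M) * indicator \<Omega> x) \<partial>M)"
    proof (intro nn_integral_mono)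
      fix x
      show "ennreal (1 / \<rho> x) * osc (v i) x (4 * \<rho> x) * indicator \<Omega> x \<le>
        ennreal (4 * CP) * (ennreal (1 / vol x (4 * \<Lambda> * \<rho> x)) * (\<integral>\<^sup>+z\<in>ball x (4 * \<Lambda> * \<rho> x). g i z * indicator
          \<Omega> z \<partial>M) * indicator \<Omega> x)"
      proof (cases "x \<in> \<Omega>")
        case True
        have p: "\<rho> x > 0" using adm True by (rule admissible_pos)
        have lp: "\<Lambda> * \<rho> x > 0" using p \<Lambda>_ge_1 by simp
        have "cball x (8 * \<Lambda> * \<rho> x) \<subseteq> ball x (16 * \<Lambda> * \<rho> x)" using lp by (auto simp: mult.assoc)
        also have "\<dots> \<subseteq> \<Omega>" using adm True by (rule admissible_ball) simp
        finally have cb: "cball x (8 * \<Lambda> * \<rho> x) \<subseteq> \<Omega>" .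
        have sub: "ball x (2 * \<Lambda> * (4 * \<rho> x)) \<subseteq> \<Omega>" using ball_subset_cball[of x "8 * \<Lambda> * \<rho> x"] cb
          by (auto simp: mult.assoc mult.left_commute)
        have L1: "w i \<in> L1 M (ball x (2 * \<Lambda> * (4 * \<rho> x)))"
          by (intro w_L1 compactly_inside_subset[OF _ cb]) (auto simp: mult.assoc mult.left_commute)
        have "ball x (4 * \<rho> x) \<subseteq> \<Omega>"
          using lp p \<Lambda>_ge_1 by (intro admissible_ball[OF adm True] mult_right_mono) auto
        then have vw: "v i y = real_of_ereal (w i y)" if "y \<in> ball x (4 * \<rho> x)" for y
          using that by (auto simp: v_def subset_iff)
        have "osc (v i) x (4 * \<rho> x) \<le> ennreal (CP * (4 * \<rho> x) / vol x (\<Lambda> * (4 * \<rho> x))) *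
           (\<integral>\<^sup>+z\<in>ball x (\<Lambda> * (4 * \<rho> x)). g i z \<partial>M)"
          using p by (intro local_poincare[OF _ sub g open_in_sets[OF \<Omega>] L1 vw]) auto
        also have "(\<integral>\<^sup>+z\<in>ball x (\<Lambda> * (4 * \<rho> x)). g i z \<partial>M) =
           (\<integral>\<^sup>+z\<in>ball x (4 * \<Lambda> * \<rho> x). g i z * indicator \<Omega> z \<partial>M)"
        proof -
          have "ball x (4 * \<Lambda> * \<rho> x) \<subseteq> \<Omega>" using cb lp by (auto simp: mult.assoc)
          then show ?thesis by (intro nn_integral_cong) (auto simp: indicator_def mult.assoc
            mult.left_commute)
        qed
        finally have "osc (v i) x (4 * \<rho> x) \<le> ennreal (CP * (4 * \<rho> x) / vol x (4 * \<Lambda> * \<rho> x)) *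
           (\<integral>\<^sup>+z\<in>ball x (4 * \<Lambda> * \<rho> x). g i z * indicator \<Omega> z \<partial>M)"
          by (simp add: mult.assoc mult.left_commute)
        then have "ennreal (1 / \<rho> x) * osc (v i) x (4 * \<rho> x) \<le>
           ennreal (1 / \<rho> x) * (ennreal (CP * (4 * \<rho> x) / vol x (4 * \<Lambda> * \<rho> x)) * (\<integral>\<^sup>+z\<in>ball x (4 * \<Lambda> * \<rho> x). g
          i z * indicator \<Omega> z \<partial>M))"
          by (rule mult_left_mono) simp
        also have "\<dots> = (ennreal (1 / \<rho> x) * ennreal (CP * (4 * \<rho> x) / vol x (4 * \<Lambda> * \<rho> x))) *
           (\<integral>\<^sup>+z\<in>ball x (4 * \<Lambda> * \<rho> x). g i z * indicator \<Omega> z \<partial>M)"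
          by (simp add: mult.assoc)
        also have "ennreal (1 / \<rho> x) * ennreal (CP * (4 * \<rho> x) / vol x (4 * \<Lambda> * \<rho> x)) =
           ennreal (4 * CP) * ennreal (1 / vol x (4 * \<Lambda> * \<rho> x))"
          using p CP_pos by (simp flip: ennreal_mult'')
        finally show ?thesis using True by (simp add: mult.assoc)
      qed simp
    qed
    also have "\<dots> \<le> ennreal (4 * CP) * (ennreal (\<kappa> * \<kappa>) * (\<integral>\<^sup>+z\<in>\<Omega>. g i z * indicator \<Omega> z \<partial>M))"
    proof -
      have m: "(\<lambda>x. ennreal (1 / vol x (4 * \<Lambda> * \<rho> x)) * (\<integral>\<^sup>+z\<in>ball x (4 * \<Lambda> * \<rho> x). g i z *
         indicator \<Omega> z \<partial>M) * indicator \<Omega> x) \<in> borel_measurable M"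
      proof -
        have r: "(\<lambda>x. 4 * \<Lambda> * \<rho> x) \<in> borel_measurable M" by measurable
        have "(\<lambda>w. g i (snd w) * indicator \<Omega> (snd w) * indicator (ball (fst w) (4 * \<Lambda> * \<rho> (fst w))) (snd w)) \<in>
           borel_measurable (M \<Otimes>\<^sub>M M)"
          by (intro borel_measurable_times_ennreal[OF measurable_compose[OF measurable_snd gm]]
            indicator_ball_measurable_pair[OF r])
        from borel_measurable_nn_integral_fst[OF this] show ?thesis
          using vol_measurable[OF r] open_in_sets[OF \<Omega>]
          by (intro borel_measurable_times_ennreal measurable_compose[OF _ measurable_ennreal]
            borel_measurable_divide borel_measurable_indicator) auto
      qed
      show ?thesis
        by (subst nn_integral_cmult[OF m])
          (rule mult_left_mono[OF tonelli_average_const[OF adm \<Omega> _ _ gm]], use \<Lambda>_ge_1 in auto)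
    qed
    also have "\<dots> = ennreal (4 * CP * (\<kappa> * \<kappa>)) * (\<integral>\<^sup>+z\<in>\<Omega>. g i z \<partial>M)"
    proof -
      have "(\<integral>\<^sup>+z\<in>\<Omega>. g i z * indicator \<Omega> z \<partial>M) = (\<integral>\<^sup>+z\<in>\<Omega>. g i z \<partial>M)"
        by (intro nn_integral_cong) (auto simp: indicator_def)
      then show ?thesis using CP_pos \<kappa>_ge_1 by (simp add: ennreal_mult mult.assoc)
    qed
    finally show ?thesis .
  qed
  have "(\<integral>\<^sup>+x\<in>\<Omega>. ennreal (1 / \<rho> x) * osc u x (4 * \<rho> x) \<partial>M) \<le>
     (\<integral>\<^sup>+x. liminf (\<lambda>i. ennreal (1 / \<rho> x) * osc (v i) x (4 * \<rho> x) * indicator \<Omega> x) \<partial>M)"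
  proof (rule nn_integral_mono)
    fix x
    show "ennreal (1 / \<rho> x) * osc u x (4 * \<rho> x) * indicator \<Omega> x \<le>
       liminf (\<lambda>i. ennreal (1 / \<rho> x) * osc (v i) x (4 * \<rho> x) * indicator \<Omega> x)"
    proof (cases "x \<in> \<Omega>")
      case True
      have p: "\<rho> x > 0" using adm True by (rule admissible_pos)
      define B where "B = ball x (4 * \<rho> x)"
      have "4 * \<rho> x \<le> 8 * \<Lambda> * \<rho> x" "8 * \<Lambda> * \<rho> x < 16 * \<Lambda> * \<rho> x" using p \<Lambda>_ge_1 by auto
      then have "B \<subseteq> cball x (8 * \<Lambda> * \<rho> x)" "cball x (8 * \<Lambda> * \<rho> x) \<subseteq> ball x (16 * \<Lambda> * \<rho> x)"
        unfolding B_def by auto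
      then have ci: "compactly_inside B \<Omega>" and B\<Omega>: "B \<subseteq> \<Omega>"
        using admissible_ball[OF adm True, of "16 * \<Lambda> * \<rho> x"] compactly_inside_subset by (blast, blast)
      have Bo: "open B" by (simp add: B_def)
      have vint: "set_integrable M B (v i)" for i
      proof -
        have "(\<integral>\<^sup>+y. ennreal (norm (indicator B y *\<^sub>R v i y)) \<partial>M) \<le> L1_norm M B (w i)"
          unfolding L1_norm_def
        proof (rule nn_integral_mono)
          fix y show "ennreal (norm (indicator B y *\<^sub>R v i y)) \<le> e2ennreal \<bar>w i y\<bar> * indicator B y"
            using B\<Omega> by (cases "w i y") (auto simp: v_def indicator_def e2ennreal_ereal)
        qed
        also have "\<dots> < \<infinity>" using w_L1[OF Bo ci, of i] by (simp add: L1_def)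
        finally show ?thesis unfolding set_integrable_def using v_meas[of i]
          by (intro integrableI_bounded borel_measurable_scaleR borel_measurable_indicator) (auto simp: B_def)
      qed
      have cl: "ennreal \<bar>u y - v i y\<bar> * indicator B y \<le> e2ennreal \<bar>w i y - U y\<bar> * indicator B y" for i y
      proof (cases "y \<in> B")
        case True
        then have "y \<in> \<Omega>" using B\<Omega> by blast
        then show ?thesis using True
          by (cases "w i y"; cases "U y") (auto simp: v_def uU e2ennreal_ereal abs_minus_commute)
      qed simp
      have "ennreal (1 / \<rho> x) * osc u x (4 * \<rho> x) \<le> ennreal (1 / \<rho> x) * osc (v i) x (4 * \<rho> x)
           + ennreal (2 / (\<rho> x * vol x (4 * \<rho> x))) * L1_norm M B (\<lambda>y. w i y - U y)" for i
      proof -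
        have "osc u x (4 * \<rho> x) \<le> osc (v i) x (4 * \<rho> x) + ennreal (2 / vol x (4 * \<rho> x)) *
           (\<integral>\<^sup>+y\<in>B. ennreal \<bar>u y - v i y\<bar> \<partial>M)"
          unfolding B_def using p borel_measurable_integrable[OF u] v_meas
          by (intro osc_le_add integrable_on_ball[OF u] vint[of i, unfolded B_def]) auto
        also have "(\<integral>\<^sup>+y\<in>B. ennreal \<bar>u y - v i y\<bar> \<partial>M) \<le> L1_norm M B (\<lambda>y. w i y - U y)"
          unfolding L1_norm_def by (intro nn_integral_mono cl)
        finally have "osc u x (4 * \<rho> x) \<le> osc (v i) x (4 * \<rho> x) + ennreal (2 / vol x (4 * \<rho> x)) *
           L1_norm M B (\<lambda>y. w i y - U y)"
          by (simp add: mult_left_mono add_left_mono)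
        then have "ennreal (1 / \<rho> x) * osc u x (4 * \<rho> x) \<le>
           ennreal (1 / \<rho> x) * (osc (v i) x (4 * \<rho> x) + ennreal (2 / vol x (4 * \<rho> x)) * L1_norm M B
          (\<lambda>y. w i y - U y))"
          by (rule mult_left_mono) simp
        also have "\<dots> = ennreal (1 / \<rho> x) * osc (v i) x (4 * \<rho> x) +
           (ennreal (1 / \<rho> x) * ennreal (2 / vol x (4 * \<rho> x))) * L1_norm M B (\<lambda>y. w i y - U y)"
          by (simp add: distrib_left mult.assoc)
        also have "ennreal (1 / \<rho> x) * ennreal (2 / vol x (4 * \<rho> x)) = ennreal (2 / (\<rho> x * vol x (4 * \<rho> x)))"
          using p by (simp flip: ennreal_mult'')
        finally show ?thesis .
      qed
      moreover have "(\<lambda>i. ennreal (2 / (\<rho> x * vol x (4 * \<rho> x))) * L1_norm M B (\<lambda>y. w i y - U y)) \<longlonglongrightarrow> ennreal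
         (2 / (\<rho> x * vol x (4 * \<rho> x))) * 0"
        using conv Bo ci unfolding converges_L1_loc_def by (intro ennreal_tendsto_cmult) auto
      ultimately have "ennreal (1 / \<rho> x) * osc u x (4 * \<rho> x) \<le>
         liminf (\<lambda>i. ennreal (1 / \<rho> x) * osc (v i) x (4 * \<rho> x))"
        by (intro le_liminf_add_null) auto
      then show ?thesis using True by simp
    qed simp
  qed
  also have "\<dots> \<le> liminf (\<lambda>i. \<integral>\<^sup>+x\<in>\<Omega>. ennreal (1 / \<rho> x) * osc (v i) x (4 * \<rho> x) \<partial>M)"
    using osc_measurable(1)[OF rho4 v_meas] open_in_sets[OF \<Omega>] admissible_measurable[OF adm]
    by (intro nn_integral_liminf borel_measurable_times_ennreal borel_measurable_indicator
        measurable_compose[OF _ measurable_ennreal] borel_measurable_divide) auto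
  also have "\<dots> \<le> liminf (\<lambda>i. ennreal (4 * CP * (\<kappa> * \<kappa>)) * (\<integral>\<^sup>+x\<in>\<Omega>. g i x \<partial>M))"
    by (intro Liminf_mono always_eventually allI step)
  also have "\<dots> = ennreal (4 * CP * (\<kappa> * \<kappa>)) * liminf (\<lambda>i. \<integral>\<^sup>+x\<in>\<Omega>. g i x \<partial>M)"
    by (rule Liminf_compose_continuous_mono[where f="\<lambda>x. ennreal (4 * CP * (\<kappa> * \<kappa>)) * x"])
      (auto intro!: monoI mult_left_mono ennreal_continuous_on_cmult continuous_on_id)
  finally show ?thesis .
qed

end

subsection \<open>Convolution at variable scale\<close>

lemma abs_integral_le:
  fixes f g :: "'a \<Rightarrow> real"
  assumes "integrable M f" "integrable M g" "\<And>x. \<bar>f x\<bar> \<le> g x"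
  shows "\<bar>integral\<^sup>L M f\<bar> \<le> integral\<^sup>L M g"
  by (rule order.trans[OF integral_abs_bound integral_mono]) (use assms in auto)

context poincare_space
begin

text \<open>The tent is Lipschitz in \<open>r\<close> and in \<open>x\<close>, so numerator and
  denominator of \<open>conv\<close> are Lipschitz when the radius varies with the centre.\<close>

definition kern :: "real \<Rightarrow> 'a \<Rightarrow> 'a \<Rightarrow> real" where
  "kern r x y = max 0 (r - dist x y)"

definition mass :: "real \<Rightarrow> 'a \<Rightarrow> real" where
  "mass r x = (LINT y|M. kern r x y)"

definition conv :: "real \<Rightarrow> ('a \<Rightarrow> real) \<Rightarrow> 'a \<Rightarrow> real" where
  "conv r f x = (LINT y|M. kern r x y * f y) / mass r x"

text \<open>The same average for nonnegative functions, with infinite values allowed: it can be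
  applied to powers of \<open>u\<close> before their integrability is known.\<close>

definition kavg :: "real \<Rightarrow> ('a \<Rightarrow> ennreal) \<Rightarrow> 'a \<Rightarrow> ennreal" where
  "kavg r h x = (\<integral>\<^sup>+y. ennreal (kern r x y / mass r x) * h y \<partial>M)"

lemma kern_nonneg [simp]: "0 \<le> kern r x y" by (simp add: kern_def)

lemma kern_le: "0 < r \<Longrightarrow> kern r x y \<le> r * indicator (ball x (r)) y"
  by (auto simp: kern_def indicator_def)

lemma kern_measurable [measurable]: "kern r x \<in> borel_measurable M"
  unfolding kern_def[abs_def] by (intro continuous_measurable continuous_intros)

lemma integrable_ball: "integrable M (\<lambda>y. c * indicator (ball x r) y :: real)"
  using emeasure_ball_finite[of x r]
    by (intro integrable_mult_right integrable_real_indicator ball_in_sets) auto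

lemma ball_diff_integrable:
  assumes "integrable M f"
  shows "integrable M (\<lambda>z. indicator (ball y r) z * (f z - c) :: real)"
proof -
  have "integrable M (\<lambda>z. indicator (ball y r) z * f z)"
    using integrable_on_ball[OF assms, of y r] by (simp add: set_integrable_def)
  moreover have "integrable M (\<lambda>z. indicator (ball y r) z * c)"
    using integrable_ball[of c y r] by (simp only: mult.commute)
  ultimately show ?thesis unfolding right_diff_distrib by (rule Bochner_Integration.integrable_diff)
qed

lemma kern_integrable: "0 < r \<Longrightarrow> integrable M (kern r x)"
  by (rule Bochner_Integration.integrable_bound[OF integrable_ball[of "r" x "r"]])
    (auto intro!: AE_I2 simp: kern_le)

lemma kern_mult_integrable:
  assumes "0 < r" "integrable M f"
  shows "integrable M (\<lambda>y. kern r x y * f y)"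
proof (rule Bochner_Integration.integrable_bound)
  show "integrable M (\<lambda>y. r * f y)" using assms(2) by simp
  show "(\<lambda>y. kern r x y * f y) \<in> borel_measurable M"
    using borel_measurable_integrable[OF assms(2)] by measurable
  have "kern r x y \<le> r" for y using assms(1) by (simp add: kern_def)
  then show "AE y in M. norm (kern r x y * f y) \<le> norm (r * f y)"
    using assms(1) by (auto simp: abs_mult intro!: mult_right_mono)
qed

text \<open>On the ball of half the radius the tent is at least r/2. The volume of that ball is
  replaced by the one at radius 4 r, the radius at which oscillations are measured.\<close>

lemma mass_ge:
  assumes "0 < r"
  shows "r * vol x (4 * r) / (2 * \<kappa>) \<le> mass r x"
proof -
  have "4 * r \<le> 32 * \<Lambda> * (r / 2)" using assms \<Lambda>_ge_1 by simp
  then have "vol x (4 * r) \<le> \<kappa> * vol x (r / 2)" using assms by (intro vol_\<kappa>) auto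
  then have "r * vol x (4 * r) / (2 * \<kappa>) \<le> r * (\<kappa> * vol x (r / 2)) / (2 * \<kappa>)"
    using assms \<kappa>_ge_1 by (intro divide_right_mono mult_left_mono) auto
  also have "\<dots> = (LINT y|M. r / 2 * indicator (ball x (r / 2)) y)"
    using \<kappa>_ge_1 by (simp add: vol_def)
  also have "\<dots> \<le> mass r x"
    unfolding mass_def using assms
    by (intro integral_mono integrable_ball kern_integrable) (auto simp: kern_def indicator_def)
  finally show ?thesis .
qed

lemma mass_pos: "0 < r \<Longrightarrow> 0 < mass r x"
  using mass_ge[of r x] vol_pos[of "4 * r" x] \<kappa>_ge_1
  by (smt (verit) divide_pos_pos mult_pos_pos)

lemma kern_div_mass_le:
  assumes "0 < r"
  shows "kern r x y / mass r x \<le> 2 * \<kappa> / vol x (4 * r) * indicator (ball x (r)) y"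
proof -
  define V where "V = vol x (4 * r)"
  have V: "V > 0" using assms by (simp add: V_def vol_pos)
  have lower: "0 < r * V / (2 * \<kappa>)" using assms V \<kappa>_ge_1 by simp
  have "kern r x y / mass r x \<le> (r * indicator (ball x (r)) y) / (r * V / (2 * \<kappa>))"
    using mass_ge[OF assms, of x] lower kern_le[OF assms, of x] assms unfolding V_def
    by (intro frac_le) auto
  then show ?thesis using assms unfolding V_def by (simp add: field_simps)
qed

lemma kavg_le:
  assumes r: "0 < r" and [measurable]: "h \<in> borel_measurable M"
  shows "kavg r h x \<le> ennreal (2 * \<kappa> / vol x (4 * r)) * (\<integral>\<^sup>+y\<in>ball x (r). h y \<partial>M)"
proof -
  note [measurable] = ball_in_sets
  have "kavg r h x \<le> (\<integral>\<^sup>+y. ennreal (2 * \<kappa> / vol x (4 * r)) * (h y * indicator (ball x (r)) y) \<partial>M)"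
    unfolding kavg_def
  proof (rule nn_integral_mono)
    fix y
    have "ennreal (kern r x y / mass r x) \<le> ennreal (2 * \<kappa> / vol x (4 * r) * indicator (ball x (r)) y)"
      by (rule ennreal_leI[OF kern_div_mass_le[OF r]])
    then have "ennreal (kern r x y / mass r x) * h y \<le>
       ennreal (2 * \<kappa> / vol x (4 * r) * indicator (ball x (r)) y) * h y"
      by (rule mult_right_mono) simp
    then show "ennreal (kern r x y / mass r x) * h y \<le>
       ennreal (2 * \<kappa> / vol x (4 * r)) * (h y * indicator (ball x (r)) y)"
      by (auto simp: indicator_def split: if_splits)
  qed
  also have "\<dots> = ennreal (2 * \<kappa> / vol x (4 * r)) * (\<integral>\<^sup>+y\<in>ball x (r). h y \<partial>M)"
    by (rule nn_integral_cmult) measurable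
  finally show ?thesis .
qed

lemma kavg_mono: "(\<And>y. h y \<le> k y) \<Longrightarrow> kavg r h x \<le> kavg r k x"
  unfolding kavg_def by (intro nn_integral_mono mult_left_mono) auto

lemma kavg_add:
  assumes [measurable]: "h \<in> borel_measurable M" "k \<in> borel_measurable M"
  shows "kavg r (\<lambda>y. h y + k y) x = kavg r h x + kavg r k x"
  unfolding kavg_def distrib_left by (rule nn_integral_add) measurable

lemma kavg_cmult:
  assumes [measurable]: "h \<in> borel_measurable M"
  shows "kavg r (\<lambda>y. c * h y) x = c * kavg r h x"
  unfolding kavg_def mult.left_commute[of _ c] by (rule nn_integral_cmult) measurable

lemma kavg_const:
  assumes "0 < r"
  shows "kavg r (\<lambda>y. c) x = c"
proof -
  have "(\<integral>\<^sup>+y. ennreal (kern r x y / mass r x) \<partial>M) = ennreal (LINT y|M. kern r x y / mass r x)"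
    using kern_integrable[OF assms, of x] mass_pos[OF assms, of x] by (intro nn_integral_eq_integral) auto
  also have "(LINT y|M. kern r x y / mass r x) = 1"
    using mass_pos[OF assms, of x] by (simp add: mass_def)
  finally show ?thesis unfolding kavg_def by (subst nn_integral_multc) auto
qed

lemma kern_mult_diff_integrable:
  assumes "0 < r" "integrable M f"
  shows "integrable M (\<lambda>y. kern r x y * (f y - c))"
  unfolding right_diff_distrib
  by (intro Bochner_Integration.integrable_diff kern_mult_integrable[OF assms] integrable_mult_left[OF
    kern_integrable[OF assms(1)]])

lemma conv_minus_const:
  assumes "0 < r" "integrable M f"
  shows "conv r f x - c = (LINT y|M. kern r x y * (f y - c)) / mass r x"
proof -
  have "(LINT y|M. kern r x y * (f y - c)) = (LINT y|M. kern r x y * f y) - c * mass r x"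
    unfolding right_diff_distrib mass_def
    using kern_mult_integrable[OF assms, of x] kern_integrable[OF assms(1), of x]
      by (subst Bochner_Integration.integral_diff) auto
  then show ?thesis using mass_pos[OF assms(1), of x] by (simp add: conv_def diff_divide_distrib)
qed

lemma abs_conv_minus_const_le:
  assumes "0 < r" "integrable M f"
  shows "ennreal \<bar>conv r f x - c\<bar> \<le> kavg r (\<lambda>y. ennreal \<bar>f y - c\<bar>) x"
proof -
  have "conv r f x - c = (LINT y|M. kern r x y * (f y - c) / mass r x)"
    unfolding conv_minus_const[OF assms] by simp
  also have "ennreal \<bar>\<dots>\<bar> \<le> (\<integral>\<^sup>+y. ennreal (norm (kern r x y * (f y - c) / mass r x)) \<partial>M)"
    using kern_mult_diff_integrable[OF assms, of x c]
    by (intro order.trans[OF _ integral_norm_bound_ennreal]) auto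
  also have "\<dots> = kavg r (\<lambda>y. ennreal \<bar>f y - c\<bar>) x"
    unfolding kavg_def using mass_pos[OF assms(1), of x]
    by (intro nn_integral_cong) (auto simp: abs_mult simp flip: ennreal_mult'')
  finally show ?thesis .
qed

text \<open>Young's inequality is the tangent line bound for the convex function \<open>t \<mapsto> t\<^sup>q\<close>, and
  integrating it against the kernel gives Jensen's inequality.\<close>

lemma conv_powr_le:
  assumes r: "0 < r" and f: "integrable M f" and q: "1 < q"
  shows "ennreal (\<bar>conv r f x\<bar> powr q) \<le> kavg r (\<lambda>y. ennreal (\<bar>f y\<bar> powr q)) x"
proof -
  have [measurable]: "f \<in> borel_measurable M" using f by (rule borel_measurable_integrable)
  define a where "a = \<bar>conv r f x\<bar>"
  have a: "0 \<le> a" by (simp add: a_def)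
  have aq: "a powr (q - 1) * a = a powr q"
    using a powr_mult_base[of a "q - 1"] by (simp add: mult.commute)
  have young: "q * a powr (q - 1) * t \<le> t powr q + (q - 1) * a powr q" if "0 \<le> t" for t
  proof -
    have conj: "1 / q + 1 / (q / (q - 1)) = 1" using q by (simp add: field_simps)
    have "t * a powr (q - 1) \<le> t powr q / q + (a powr (q - 1)) powr (q / (q - 1)) / (q / (q - 1))"
      using q by (intro Youngs_inequality conj that) (auto simp: field_simps)
    also have "(a powr (q - 1)) powr (q / (q - 1)) = a powr q" using q by (simp add: powr_powr)
    finally have "q * (t * a powr (q - 1)) \<le> q * (t powr q / q + a powr q / (q / (q - 1)))"
      using q by (intro mult_left_mono) auto
    also have "\<dots> = t powr q + (q - 1) * a powr q" using q by (simp add: field_simps)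
    finally show ?thesis by (simp add: ac_simps)
  qed
  have "ennreal (q * a powr q) = ennreal (q * a powr (q - 1)) * ennreal a"
    using a q by (simp add: aq mult.assoc flip: ennreal_mult'')
  also have "\<dots> \<le> ennreal (q * a powr (q - 1)) * kavg r (\<lambda>y. ennreal \<bar>f y\<bar>) x"
    using abs_conv_minus_const_le[OF r f, of x 0] by (intro mult_left_mono) (auto simp: a_def)
  also have "\<dots> = kavg r (\<lambda>y. ennreal (q * a powr (q - 1)) * ennreal \<bar>f y\<bar>) x"
    by (subst kavg_cmult) auto
  also have "\<dots> \<le> kavg r (\<lambda>y. ennreal (\<bar>f y\<bar> powr q) + ennreal ((q - 1) * a powr q)) x"
    using q young by (intro kavg_mono) (auto simp flip: ennreal_mult'' ennreal_plus intro!: ennreal_leI)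
  also have "\<dots> = kavg r (\<lambda>y. ennreal (\<bar>f y\<bar> powr q)) x + ennreal ((q - 1) * a powr q)"
    by (subst kavg_add) (auto simp: kavg_const[OF r])
  finally have *: "ennreal (q * a powr q) \<le>
     kavg r (\<lambda>y. ennreal (\<bar>f y\<bar> powr q)) x + ennreal ((q - 1) * a powr q)" .
  then show ?thesis
  \<comment> \<open>The common term can be cancelled over the reals when the average is finite;
    otherwise there is nothing to prove.\<close>
  proof (cases "kavg r (\<lambda>y. ennreal (\<bar>f y\<bar> powr q)) x")
    case (real b)
    then have "ennreal (q * a powr q) \<le> ennreal (b + (q - 1) * a powr q)"
      using * q by (simp add: ennreal_plus)
    then have "q * a powr q \<le> b + (q - 1) * a powr q"
      using q real by (subst (asm) ennreal_le_iff) (auto intro!: add_nonneg_nonneg)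
    then have "a powr q \<le> b" by (simp add: left_diff_distrib)
    then show ?thesis using real by (simp add: a_def ennreal_leI)
  qed simp
qed

text \<open>Averaging is bounded on L^1: the kernel is at most 2 \<kappa> times the normalized
  indicator of its ball, and the exchange of integrals contributes two more factors \<kappa>. The
  set \<open>S'\<close> localizes the bound to the points seen from \<open>S\<close>.\<close>

lemma kavg_integral_le:
  assumes adm: "admissible \<Omega> \<rho>" and \<Omega>: "open \<Omega>" and h[measurable]: "h \<in> borel_measurable M"
    and S: "S \<subseteq> \<Omega>" "\<And>x. x \<in> S \<Longrightarrow> ball x (\<rho> x) \<subseteq> S'" and [measurable]: "S' \<in> sets M"
  shows "(\<integral>\<^sup>+x\<in>S. kavg (\<rho> x) h x \<partial>M) \<le> ennreal (2 * \<kappa> ^ 3) * (\<integral>\<^sup>+x\<in>S'. h x \<partial>M)"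
proof -
  note [measurable] = open_in_sets[OF \<Omega>]
  define k where "k y = ennreal (2 * \<kappa>) * (h y * indicator S' y)" for y
  have [measurable]: "k \<in> borel_measurable M" unfolding k_def by measurable
  have "(\<integral>\<^sup>+x\<in>S. kavg (\<rho> x) h x \<partial>M) \<le>
     (\<integral>\<^sup>+x\<in>\<Omega>. ennreal (1 / vol x (1 * \<rho> x)) * (\<integral>\<^sup>+z\<in>ball x (1 * \<rho> x). k z \<partial>M) \<partial>M)"
  proof (rule nn_integral_mono)
    fix x
    show "kavg (\<rho> x) h x * indicator S x \<le> ennreal (1 / vol x (1 * \<rho> x)) * (\<integral>\<^sup>+z\<in>ball x (1 * \<rho> x). k z \<partial>M) *
       indicator \<Omega> x"
    proof (cases "x \<in> S")
      case True
      then have x: "x \<in> \<Omega>" using S by blast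
      have p: "0 < \<rho> x" using adm x by (rule admissible_pos)
      have "kavg (\<rho> x) h x \<le> ennreal (2 * \<kappa> / vol x (4 * \<rho> x)) * (\<integral>\<^sup>+y\<in>ball x (\<rho> x). h y \<partial>M)"
        by (rule kavg_le[OF p h])
      also have "\<dots> \<le> ennreal (1 / vol x (\<rho> x) * (2 * \<kappa>)) * (\<integral>\<^sup>+y\<in>ball x (\<rho> x). h y \<partial>M)"
      proof -
        have "vol x (\<rho> x) \<le> vol x (4 * \<rho> x)" using p by (intro vol_mono subset_ball) simp
        then have "2 * \<kappa> / vol x (4 * \<rho> x) \<le> 2 * \<kappa> / vol x (\<rho> x)"
          using vol_pos[OF p, of x] \<kappa>_ge_1 by (intro divide_left_mono) auto
        then show ?thesis by (intro mult_right_mono ennreal_leI) auto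
      qed
      also have "\<dots> = ennreal (1 / vol x (\<rho> x)) * (ennreal (2 * \<kappa>) * (\<integral>\<^sup>+y\<in>ball x (\<rho> x). h y \<partial>M))"
      proof -
        have "ennreal (1 / vol x (\<rho> x) * (2 * \<kappa>)) = ennreal (1 / vol x (\<rho> x)) * ennreal (2 * \<kappa>)"
          using \<kappa>_ge_1 by (intro ennreal_mult'') simp
        then show ?thesis by (simp only: mult.assoc)
      qed
      also have "(\<integral>\<^sup>+y\<in>ball x (\<rho> x). h y \<partial>M) = (\<integral>\<^sup>+y\<in>ball x (\<rho> x). h y * indicator S' y \<partial>M)"
        using S(2)[OF True] by (intro nn_integral_cong) (auto simp: indicator_def)
      also have "ennreal (2 * \<kappa>) * \<dots> = (\<integral>\<^sup>+y\<in>ball x (\<rho> x). k y \<partial>M)"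
        unfolding k_def by (subst nn_integral_cmult[symmetric]) (auto simp: ac_simps)
      finally show ?thesis using True x by simp
    qed simp
  qed
  also have "\<dots> \<le> ennreal (\<kappa> * \<kappa>) * (\<integral>\<^sup>+z\<in>\<Omega>. k z \<partial>M)"
    using \<Lambda>_ge_1 by (intro tonelli_average_const[OF adm \<Omega>]) auto
  also have "\<dots> \<le> ennreal (\<kappa> * \<kappa>) * (\<integral>\<^sup>+z. ennreal (2 * \<kappa>) * (h z * indicator S' z) \<partial>M)"
    by (intro mult_left_mono nn_integral_mono) (auto simp: k_def indicator_def)
  also have "\<dots> = ennreal (2 * \<kappa> ^ 3) * (\<integral>\<^sup>+x\<in>S'. h x \<partial>M)"
  proof -
    have "ennreal (\<kappa> * \<kappa>) * ennreal (2 * \<kappa>) = ennreal (2 * \<kappa> ^ 3)"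
      using \<kappa>_ge_1 by (subst ennreal_mult''[symmetric]) (auto simp: power3_eq_cube ac_simps)
    then show ?thesis by (subst nn_integral_cmult) (simp_all add: mult.assoc[symmetric])
  qed
  finally show ?thesis .
qed

lemma osc_eq:
  assumes "integrable M u"
  shows "osc u y r = ennreal ((LINT z:ball y r|M. \<bar>u z - mean u y r\<bar>) / vol y r)"
proof -
  have i: "set_integrable M (ball y r) (\<lambda>z. u z - mean u y r)"
    using ball_diff_integrable[OF assms] by (simp add: set_integrable_def)
  show ?thesis
    unfolding osc_def set_nn_integral_abs[OF i] by (simp flip: ennreal_mult')
qed

text \<open>Convolution reproduces constants, so the mean \<open>m\<close> of \<open>u\<close> on a
  ball about the third point \<open>y\<close> may be subtracted first; only the oscillation
  \<open>W\<close> is left in the numerators \<open>N\<close>. Their difference is at most 2 d W,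
  that of the masses at most 2 d V, and the quotient rule gives the factor 2 + 4 \<kappa>^2 \<le> 6
  \<kappa>^2. Dividing by the mass yields 12 \<kappa>^4, and replacing \<rho> x by \<rho> y doubles
  it. The freedom in \<open>y\<close> is what \<open>local_lipschitz_gradient\<close>
  demands.\<close>

lemma conv_gradient_aux:
  assumes adm: "admissible \<Omega> \<rho>" and u: "integrable M u" and x0: "x0 \<in> \<Omega>"
    and x: "dist x0 x < \<rho> x0 / 4" and x': "dist x0 x' < \<rho> x0 / 4" and y: "dist x0 y < \<rho> x0 / 4"
  shows "\<bar>conv (\<rho> x) u x - conv (\<rho> x') u x'\<bar> \<le>
     24 * \<kappa> ^ 4 / \<rho> y * ((LINT z:ball y (4 * \<rho> y)|M. \<bar>u z - mean u y (4 * \<rho> y)\<bar>) / vol y (4 * \<rho> y)) * dist x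
       x'"
proof -
  define r where "r = \<rho> x0"
  have r: "r > 0" using adm x0 by (simp add: r_def admissible_pos)
  have near: "w \<in> \<Omega>" "3/4 * r \<le> \<rho> w" "\<rho> w \<le> 5/4 * r" if "dist x0 w < r / 4" for w
  proof -
    have "r / 4 \<le> 4 * \<Lambda> * r" using r \<Lambda>_ge_1 by simp
    then have "dist x0 w < 4 * \<Lambda> * \<rho> x0" using that by (simp add: r_def)
    from admissible_near[OF adm x0 this] show "w \<in> \<Omega>" "3/4 * r \<le> \<rho> w" "\<rho> w \<le> 5/4 * r" by (auto simp: r_def)
  qed
  note nx = near[OF x[folded r_def]] and nx' = near[OF x'[folded r_def]] and ny = near[OF y[folded r_def]]
  define B where "B = ball y (4 * \<rho> y)"
  define V where "V = vol y (4 * \<rho> y)"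
  define m where "m = mean u y (4 * \<rho> y)"
  define W where "W = (LINT z:B|M. \<bar>u z - m\<bar>)"
  define d where "d = dist x x'"
  have V: "V > 0" using ny r by (simp add: V_def vol_pos)
  have ym: "integrable M (\<lambda>z. indicator B z * (u z - m))"
    unfolding B_def by (rule ball_diff_integrable[OF u])
  then have yabs: "integrable M (\<lambda>z. indicator B z * \<bar>u z - m\<bar>)"
    using integrable_abs[OF ym] by (simp add: abs_mult)
  have W: "W = (LINT z|M. indicator B z * \<bar>u z - m\<bar>)" by (simp add: W_def set_lebesgue_integral_def)
  have W0: "W \<ge> 0" unfolding W by (intro integral_nonneg_AE) auto
  have inB: "indicator (ball w (\<rho> w)) z \<le> (indicator B z :: real)" if "dist x0 w < r / 4" for w z
  proof -
    have "ball w (\<rho> w) \<subseteq> B"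
    proof
      fix z assume z: "z \<in> ball w (\<rho> w)"
      have "dist y z \<le> dist y x0 + dist x0 w + dist w z"
        using dist_triangle[of y z x0] dist_triangle[of x0 z w] by linarith
      also have "\<dots> < 4 * \<rho> y" using z near[OF that] y[folded r_def] that ny r by (auto simp: dist_commute)
      finally show "z \<in> B" by (simp add: B_def)
    qed
    then show ?thesis by (auto simp: indicator_def)
  qed
  have kB: "kern (\<rho> w) w z \<le> \<rho> w * indicator B z" if "dist x0 w < r / 4" for w z
  proof -
    have p: "\<rho> w > 0" using near[OF that] r by linarith
    show ?thesis using kern_le[OF p, of w z] inB[OF that, of z] p
      by (meson mult_left_mono less_imp_le order.trans)
  qed
  define N where "N w = (LINT z|M. kern (\<rho> w) w z * (u z - m))" for w
  have px: "\<rho> x > 0" "\<rho> x' > 0" using nx nx' r by auto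
  note ix = kern_mult_diff_integrable[OF px(1) u, of x m] kern_mult_diff_integrable[OF px(2) u, of x' m]
  \<comment> \<open>One \<open>d\<close> comes from moving the centre, the other from the change of
    the radius; outside \<open>B\<close> both kernels vanish.\<close>
  have kd: "\<bar>kern (\<rho> x) x z - kern (\<rho> x') x' z\<bar> \<le> 2 * d * indicator B z" for z
  proof (cases "z \<in> B")
    case True
    have "\<bar>\<rho> x - \<rho> x'\<bar> \<le> dist x x' / (16 * \<Lambda>)" using adm by (simp add: admissible_def)
    also have "\<dots> \<le> dist x x' / 1" using \<Lambda>_ge_1 by (intro divide_left_mono) auto
    finally have "\<bar>\<rho> x - \<rho> x'\<bar> \<le> d" by (simp add: d_def)
    moreover have "\<bar>dist x z - dist x' z\<bar> \<le> d"
      unfolding d_def using dist_triangle[of x z x'] dist_triangle[of x' z x] by (auto simp: dist_commute)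
    ultimately show ?thesis using True by (auto simp: kern_def max_def)
  next
    case False
    then have "kern (\<rho> x) x z = 0" "kern (\<rho> x') x' z = 0"
      using kB[OF x[folded r_def], of z] kB[OF x'[folded r_def], of z] kern_nonneg[of
        "\<rho> x" x z] kern_nonneg[of "\<rho> x'" x' z]
      by auto
    then show ?thesis using False by simp
  qed
  have N_diff: "\<bar>N x - N x'\<bar> \<le> 2 * d * W"
  proof -
    have "N x - N x' = (LINT z|M. kern (\<rho> x) x z * (u z - m) - kern (\<rho> x') x' z * (u z - m))"
      unfolding N_def using ix by simp
    also have "\<bar>\<dots>\<bar> \<le> (LINT z|M. 2 * d * (indicator B z * \<bar>u z - m\<bar>))"
    proof -
      have "\<bar>kern (\<rho> x) x z * (u z - m) - kern (\<rho> x') x' z * (u z - m)\<bar> \<le> 2 * d * (indicator B z * \<bar>u z - m\<bar>)"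
        for z
        unfolding left_diff_distrib[symmetric] abs_mult mult.assoc[symmetric]
          by (rule mult_right_mono[OF kd]) simp
      then show ?thesis
        using abs_integral_le[OF Bochner_Integration.integrable_diff[OF ix] integrable_mult_right[OF yabs, of
          "2 * d"]]
        by simp
    qed
    finally show ?thesis by (simp add: W)
  qed
  have N_bound: "\<bar>N x'\<bar> \<le> \<rho> x' * W"
  proof -
    have "\<bar>kern (\<rho> x') x' z * (u z - m)\<bar> \<le> \<rho> x' * (indicator B z * \<bar>u z - m\<bar>)" for z
      unfolding abs_mult mult.assoc[symmetric] using kB[OF x'[folded r_def], of z]
        by (intro mult_right_mono) auto
    then show ?thesis
      unfolding N_def W using abs_integral_le[OF ix(2) integrable_mult_right[OF yabs, of "\<rho> x'"]] by simp
  qed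
  have mass_diff: "\<bar>mass (\<rho> x) x - mass (\<rho> x') x'\<bar> \<le> 2 * d * V"
  proof -
    have "mass (\<rho> x) x - mass (\<rho> x') x' = (LINT z|M. kern (\<rho> x) x z - kern (\<rho> x') x' z)"
      unfolding mass_def using kern_integrable[OF px(1), of x] kern_integrable[OF px(2), of x'] by simp
    also have "\<bar>\<dots>\<bar> \<le> (LINT z|M. 2 * d * indicator B z)"
      using abs_integral_le[OF Bochner_Integration.integrable_diff[OF kern_integrable[OF px(1), of x]
        kern_integrable[OF px(2), of x']]
          integrable_ball[of "2 * d" y "4 * \<rho> y"]] kd by (simp add: B_def)
    also have "\<dots> = 2 * d * V" by (simp add: B_def V_def vol_def)
    finally show ?thesis .
  qed
  \<comment> \<open>The masses at \<open>x\<close> and \<open>x'\<close> are bounded in terms of the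
    single volume \<open>V\<close> at \<open>y\<close>, so that the volumes cancel in the
    quotient.\<close>
  have mass_low: "\<rho> w * V / (2 * \<kappa>\<^sup>2) \<le> mass (\<rho> w) w" if w: "dist x0 w < r / 4" for w
  proof -
    have p: "\<rho> w > 0" using near[OF w] r by linarith
    have "dist w y \<le> r / 2" using dist_triangle[of w y x0] w y[folded r_def] by (auto simp: dist_commute)
    then have "dist w y + 4 * \<rho> y \<le> 8 * (4 * \<rho> w)" using near[OF w] ny r by auto
    also have "\<dots> \<le> 32 * \<Lambda> * (4 * \<rho> w)" using p \<Lambda>_ge_1 by (intro mult_right_mono) auto
    finally have "V \<le> \<kappa> * vol w (4 * \<rho> w)" unfolding V_def using p by (intro vol_\<kappa>) auto
    then have "\<rho> w * V / (2 * \<kappa>\<^sup>2) \<le> \<rho> w * (\<kappa> * vol w (4 * \<rho> w)) / (2 * \<kappa>\<^sup>2)"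
      using p \<kappa>_ge_1 by (intro divide_right_mono mult_left_mono) auto
    also have "\<dots> = \<rho> w * vol w (4 * \<rho> w) / (2 * \<kappa>)" using \<kappa>_ge_1 by (simp add: power2_eq_square)
    also have "\<dots> \<le> mass (\<rho> w) w" by (rule mass_ge[OF p])
    finally show ?thesis .
  qed
  note ml = mass_low[OF x[folded r_def]] mass_low[OF x'[folded r_def]]
  have mp: "mass (\<rho> x) x > 0" "mass (\<rho> x') x' > 0" using px by (auto intro: mass_pos)
  have k2: "1 \<le> \<kappa>\<^sup>2" using \<kappa>_ge_1 by (simp add: one_le_power)
  have d0: "d \<ge> 0" by (simp add: d_def)
  have quot: "\<bar>N x' / mass (\<rho> x') x'\<bar> \<le> 2 * \<kappa>\<^sup>2 * W / V"
  proof -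
    have "0 < \<rho> x' * V / (2 * \<kappa>\<^sup>2)" using px V k2 by (intro divide_pos_pos mult_pos_pos) auto
    then have "\<bar>N x' / mass (\<rho> x') x'\<bar> \<le> (\<rho> x' * W) / (\<rho> x' * V / (2 * \<kappa>\<^sup>2))"
      unfolding abs_divide using N_bound ml(2) mp(2) px W0 by (intro frac_le) auto
    also have "\<dots> = 2 * \<kappa>\<^sup>2 * W / V" using px by simp
    finally show ?thesis .
  qed
  have "conv (\<rho> x) u x - conv (\<rho> x') u x' = N x / mass (\<rho> x) x - N x' / mass (\<rho> x') x'"
    using conv_minus_const[OF px(1) u, of x m] conv_minus_const[OF px(2) u, of x' m] by (simp add: N_def)
  \<comment> \<open>Quotient rule arranged so that the second quotient appears as a whole;
    \<open>quot\<close> bounds it by the oscillation.\<close>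
  also have "\<dots> = ((N x - N x') + N x' / mass (\<rho> x') x' * (mass (\<rho> x') x' - mass (\<rho> x) x)) / mass (\<rho> x) x"
    using mp by (simp add: field_simps)
  also have "\<bar>\<dots>\<bar> \<le> (2 * d * W + 2 * \<kappa>\<^sup>2 * W / V * (2 * d * V)) / mass (\<rho> x) x"
  proof -
    have "\<bar>N x' / mass (\<rho> x') x' * (mass (\<rho> x') x' - mass (\<rho> x) x)\<bar> \<le> 2 * \<kappa>\<^sup>2 * W / V * (2 * d * V)"
      unfolding abs_mult using quot mass_diff W0 V by (intro mult_mono) (auto simp: abs_minus_commute)
    then have "\<bar>(N x - N x') + N x' / mass (\<rho> x') x' * (mass (\<rho> x') x' - mass (\<rho> x) x)\<bar> \<le>
       2 * d * W + 2 * \<kappa>\<^sup>2 * W / V * (2 * d * V)"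
      using N_diff by linarith
    then show ?thesis using mp by (simp add: abs_divide divide_right_mono)
  qed
  also have "2 * d * W + 2 * \<kappa>\<^sup>2 * W / V * (2 * d * V) = d * W * (2 + 4 * \<kappa>\<^sup>2)"
    using V by (simp add: field_simps)
  also have "d * W * (2 + 4 * \<kappa>\<^sup>2) / mass (\<rho> x) x \<le> d * W * (6 * \<kappa>\<^sup>2) / (\<rho> x * V / (2 * \<kappa>\<^sup>2))"
    using ml(1) k2 d0 W0 px V by (intro frac_le mult_left_mono divide_pos_pos mult_pos_pos) auto
  also have "\<dots> = 12 * \<kappa> ^ 4 * d * W / V * (1 / \<rho> x)" by (simp add: power2_eq_square power4_eq_xxxx mult_ac)
  also have "\<dots> \<le> 12 * \<kappa> ^ 4 * d * W / V * (2 / \<rho> y)"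
  proof (intro mult_left_mono)
    have "\<rho> y \<le> 2 * \<rho> x" "\<rho> y > 0" using nx ny r by linarith+
    then show "1 / \<rho> x \<le> 2 / \<rho> y" using px by (simp add: field_simps)
    show "0 \<le> 12 * \<kappa> ^ 4 * d * W / V" using d0 W0 V \<kappa>_ge_1 by simp
  qed
  finally show ?thesis unfolding V_def d_def W_def B_def m_def by (simp add: ac_simps)
qed

lemma conv_gradient:
  assumes adm: "admissible \<Omega> \<rho>" and \<Omega>: "open \<Omega>" and u: "integrable M u"
  shows "local_lipschitz_gradient \<Omega> (\<lambda>x. conv (\<rho> x) u x) (\<lambda>y. ennreal (24 * \<kappa> ^ 4) *
     (ennreal (1 / \<rho> y) * osc u y (4 * \<rho> y)))"
  unfolding local_lipschitz_gradient_def
proof (intro ballI exI conjI)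
  fix x0 assume x0: "x0 \<in> \<Omega>"
  have p: "\<rho> x0 > 0" using adm x0 by (rule admissible_pos)
  show "open (ball x0 (\<rho> x0 / 4))" by simp
  show "x0 \<in> ball x0 (\<rho> x0 / 4)" using p by simp
  fix y z w assume yzw: "y \<in> ball x0 (\<rho> x0 / 4) \<inter> \<Omega>" "z \<in> ball x0 (\<rho> x0 / 4) \<inter> \<Omega>" "w \<in> ball x0 (\<rho> x0 / 4) \<inter> \<Omega>"
  have py: "\<rho> y > 0" using yzw adm by (intro admissible_pos) auto
  define L where "L = (LINT z:ball y (4 * \<rho> y)|M. \<bar>u z - mean u y (4 * \<rho> y)\<bar>) / vol y (4 * \<rho> y)"
  have L0: "L \<ge> 0" unfolding L_def set_lebesgue_integral_def
    by (intro divide_nonneg_nonneg integral_nonneg_AE) auto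
  have "ennreal \<bar>conv (\<rho> z) u z - conv (\<rho> w) u w\<bar> \<le> ennreal (24 * \<kappa> ^ 4 / \<rho> y * L * dist z w)"
    unfolding L_def using yzw by (intro ennreal_leI conv_gradient_aux[OF adm u x0]) auto
  also have "\<dots> = ennreal (24 * \<kappa> ^ 4) * (ennreal (1 / \<rho> y) * osc u y (4 * \<rho> y)) * ennreal (dist z w)"
    unfolding osc_eq[OF u] L_def[symmetric] using L0 py \<kappa>_ge_1 by (simp flip: ennreal_mult'')
  finally show "ennreal \<bar>conv (\<rho> z) u z - conv (\<rho> w) u w\<bar> \<le>
     ennreal (24 * \<kappa> ^ 4) * (ennreal (1 / \<rho> y) * osc u y (4 * \<rho> y)) * ennreal (dist z w)" .
qed

text \<open>At a fixed point x the difference of \<open>u x\<close> and a mean of \<open>u\<close>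
  is not controlled by an oscillation. So \<open>u\<close> near x is compared with
  \<open>u x\<close> through the mean \<open>m z\<close> at a variable point z, and the bound is
  averaged over z. After the exchange of integrals x runs through a ball about z, and the difference
  of \<open>u x\<close> and \<open>m z\<close> integrates to the oscillation at z.\<close>

lemma kavg_oscillation_integral_le:
  assumes adm: "admissible \<Omega> \<rho>" and \<Omega>: "open \<Omega>" and u: "integrable M u"
  shows "(\<integral>\<^sup>+x\<in>\<Omega>. ennreal (1 / \<rho> x) * kavg (\<rho> x) (\<lambda>y. ennreal \<bar>u y - u x\<bar>) x \<partial>M)
    \<le> ennreal (2 * \<kappa>\<^sup>2 * (2 * \<kappa>\<^sup>2 + 1)) * (\<integral>\<^sup>+x\<in>\<Omega>. ennreal (1 / \<rho> x) * osc u x (4 * \<rho> x) \<partial>M)"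
proof -
  note \<rho>m = admissible_measurable[OF adm]
  note \<Omega>m = open_in_sets[OF \<Omega>]
  have um: "u \<in> borel_measurable M" using u by (rule borel_measurable_integrable)
  have r4: "(\<lambda>x. 4 * \<rho> x) \<in> borel_measurable M" using \<rho>m by measurable
  note om = osc_measurable[OF r4 um]
  define A where "A z = osc u z (4 * \<rho> z)" for z
  define m where "m z = mean u z (4 * \<rho> z)" for z
  have [measurable]: "A \<in> borel_measurable M" "m \<in> borel_measurable M" "u \<in> borel_measurable M"
    "\<rho> \<in> borel_measurable M"
    using om um \<rho>m by (auto simp: A_def[abs_def] m_def[abs_def])
  \<comment> \<open>A bound for the weighted error at x that is valid for every z in the ball of
    radius \<rho> x; it contains the scale and the mean at z, as the exchange requires.\<close>
  define H where "H x z = ennreal (2 / \<rho> z) * (ennreal (2 * \<kappa>\<^sup>2) * A z + ennreal \<bar>u x - m z\<bar>)" for x z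
  have Hm: "case_prod H \<in> borel_measurable (M \<Otimes>\<^sub>M M)" unfolding H_def by measurable
  have pt: "ennreal (1 / \<rho> x) * kavg (\<rho> x) (\<lambda>y. ennreal \<bar>u y - u x\<bar>) x \<le> H x z" if x: "x \<in> \<Omega>"
    and z: "z \<in> ball x (\<rho> x)" for x z
  proof -
    have p: "\<rho> x > 0" using adm x by (rule admissible_pos)
    have "\<rho> x \<le> 4 * \<Lambda> * \<rho> x" using p \<Lambda>_ge_1 by simp
    then have d4: "dist x z < 4 * \<Lambda> * \<rho> x" using z by simp
    note near = admissible_near[OF adm x d4]
    have pz: "\<rho> z > 0" using near p by linarith
    have "kavg (\<rho> x) (\<lambda>y. ennreal \<bar>u y - u x\<bar>) x \<le>
       kavg (\<rho> x) (\<lambda>y. ennreal \<bar>u y - m z\<bar> + ennreal \<bar>u x - m z\<bar>) x"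
      by (intro kavg_mono) (auto simp flip: ennreal_plus intro!: ennreal_leI)
    also have "\<dots> = kavg (\<rho> x) (\<lambda>y. ennreal \<bar>u y - m z\<bar>) x + ennreal \<bar>u x - m z\<bar>"
      by (subst kavg_add) (auto simp: kavg_const[OF p])
    also have "kavg (\<rho> x) (\<lambda>y. ennreal \<bar>u y - m z\<bar>) x \<le>
       ennreal (2 * \<kappa> / vol x (4 * \<rho> x)) * (\<integral>\<^sup>+y\<in>ball x (\<rho> x). ennreal \<bar>u y - m z\<bar> \<partial>M)"
      by (rule kavg_le[OF p]) measurable
    also have "\<dots> \<le> ennreal (2 * \<kappa>\<^sup>2 / vol z (4 * \<rho> z)) * (\<integral>\<^sup>+y\<in>ball z (4 * \<rho> z). ennreal \<bar>u y - m z\<bar> \<partial>M)"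
    proof -
      have "dist x z + 4 * \<rho> z \<le> 8 * (4 * \<rho> x)" using z near p by auto
      also have "\<dots> \<le> 32 * \<Lambda> * (4 * \<rho> x)" using p \<Lambda>_ge_1 by (intro mult_right_mono) auto
      finally have v: "vol z (4 * \<rho> z) \<le> \<kappa> * vol x (4 * \<rho> x)" using p by (intro vol_\<kappa>) auto
      have vp: "0 < vol x (4 * \<rho> x)" "0 < vol z (4 * \<rho> z)" using p pz by (auto intro: vol_pos)
      have "vol z (4 * \<rho> z) * (2 * \<kappa>) \<le> \<kappa> * vol x (4 * \<rho> x) * (2 * \<kappa>)" using v \<kappa>_ge_1
        by (intro mult_right_mono) auto
      then have v1: "2 * \<kappa> / vol x (4 * \<rho> x) \<le> 2 * \<kappa>\<^sup>2 / vol z (4 * \<rho> z)"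
        using vp by (simp add: field_simps power2_eq_square)
      have "ball x (\<rho> x) \<subseteq> ball z (4 * \<rho> z)"
      proof
        fix w assume "w \<in> ball x (\<rho> x)"
        then show "w \<in> ball z (4 * \<rho> z)" using z near p dist_triangle[of z w x] by (auto simp: dist_commute)
      qed
      then have v2: "(\<integral>\<^sup>+y\<in>ball x (\<rho> x). ennreal \<bar>u y - m z\<bar> \<partial>M) \<le>
         (\<integral>\<^sup>+y\<in>ball z (4 * \<rho> z). ennreal \<bar>u y - m z\<bar> \<partial>M)"
        by (intro nn_integral_mono mult_left_mono) (auto simp: indicator_def)
      show ?thesis by (rule mult_mono[OF ennreal_leI[OF v1] v2]) auto
    qed
    also have "\<dots> = ennreal (2 * \<kappa>\<^sup>2) * A z"
      unfolding A_def osc_def m_def mult.assoc[symmetric] by (simp flip: ennreal_mult'')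
    finally have e: "kavg (\<rho> x) (\<lambda>y. ennreal \<bar>u y - u x\<bar>) x \<le> ennreal (2 * \<kappa>\<^sup>2) * A z + ennreal \<bar>u x - m z\<bar>"
      by (simp add: add_right_mono)
    have "1 / \<rho> x \<le> 2 / \<rho> z" using near p pz by (simp add: field_simps)
    then show ?thesis unfolding H_def by (intro mult_mono e ennreal_leI) auto
  qed
  have "(\<integral>\<^sup>+x\<in>\<Omega>. ennreal (1 / \<rho> x) * kavg (\<rho> x) (\<lambda>y. ennreal \<bar>u y - u x\<bar>) x \<partial>M) \<le>
    (\<integral>\<^sup>+x\<in>\<Omega>. ennreal (1 / vol x (1 * \<rho> x)) * (\<integral>\<^sup>+z\<in>ball x (1 * \<rho> x). H x z \<partial>M) \<partial>M)"
  proof (rule nn_integral_mono)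
    fix x
    show "ennreal (1 / \<rho> x) * kavg (\<rho> x) (\<lambda>y. ennreal \<bar>u y - u x\<bar>) x * indicator \<Omega> x \<le>
      ennreal (1 / vol x (1 * \<rho> x)) * (\<integral>\<^sup>+z\<in>ball x (1 * \<rho> x). H x z \<partial>M) * indicator \<Omega> x"
    proof (cases "x \<in> \<Omega>")
      case True
      have p: "\<rho> x > 0" using adm True by (rule admissible_pos)
      define c where "c = ennreal (1 / \<rho> x) * kavg (\<rho> x) (\<lambda>y. ennreal \<bar>u y - u x\<bar>) x"
      \<comment> \<open>The quantity \<open>c\<close> does not depend on z, so it equals its own
        average over the ball and inherits the averaged bound.\<close>
      have "c = (ennreal (1 / vol x (\<rho> x)) * ennreal (vol x (\<rho> x))) * c"
        using vol_pos[OF p, of x] by (simp flip: ennreal_mult'')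
      also have "\<dots> = ennreal (1 / vol x (\<rho> x)) * (\<integral>\<^sup>+z. c * indicator (ball x (\<rho> x)) z \<partial>M)"
        by (simp add: nn_integral_cmult_indicator emeasure_ball ac_simps)
      also have "\<dots> \<le> ennreal (1 / vol x (\<rho> x)) * (\<integral>\<^sup>+z\<in>ball x (\<rho> x). H x z \<partial>M)"
        using pt[OF True] by (intro mult_left_mono nn_integral_mono) (auto simp: indicator_def c_def)
      finally show ?thesis using True by (simp add: c_def)
    qed simp
  qed
  also have "\<dots> \<le>
     ennreal \<kappa> * (\<integral>\<^sup>+z\<in>\<Omega>. ennreal (1 / vol z (1 * \<rho> z)) * (\<integral>\<^sup>+x\<in>ball z (2 * 1 * \<rho> z) \<inter> \<Omega>. H x z \<partial>M) \<partial>M)"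
    using \<Lambda>_ge_1 by (intro tonelli_average[OF adm \<Omega> _ _ Hm]) auto
  also have "\<dots> \<le>
     ennreal \<kappa> * (\<integral>\<^sup>+z. ennreal (2 * \<kappa> * (2 * \<kappa>\<^sup>2 + 1)) * (ennreal (1 / \<rho> z) * A z * indicator \<Omega> z) \<partial>M)"
  proof (intro mult_left_mono nn_integral_mono)
    fix z
    show "ennreal (1 / vol z (1 * \<rho> z)) * (\<integral>\<^sup>+x\<in>ball z (2 * 1 * \<rho> z) \<inter> \<Omega>. H x z \<partial>M) * indicator \<Omega> z \<le>
      ennreal (2 * \<kappa> * (2 * \<kappa>\<^sup>2 + 1)) * (ennreal (1 / \<rho> z) * A z * indicator \<Omega> z)"
    proof (cases "z \<in> \<Omega>")
      case True
      have p: "\<rho> z > 0" using adm True by (rule admissible_pos)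
      note [measurable] = ball_in_sets
      define V where "V = vol z (4 * \<rho> z)"
      have V: "V > 0" using p by (simp add: V_def vol_pos)
      have AV: "(\<integral>\<^sup>+x\<in>ball z (4 * \<rho> z). ennreal \<bar>u x - m z\<bar> \<partial>M) = ennreal V * A z"
        unfolding A_def osc_def m_def mult.assoc[symmetric] V_def[symmetric] using V
          by (simp flip: ennreal_mult'')
      have "(\<integral>\<^sup>+x\<in>ball z (2 * 1 * \<rho> z) \<inter> \<Omega>. H x z \<partial>M) \<le> (\<integral>\<^sup>+x\<in>ball z (4 * \<rho> z). H x z \<partial>M)"
        using p by (intro nn_integral_mono) (auto simp: indicator_def)
      also have "\<dots> = (\<integral>\<^sup>+x. ennreal (2 / \<rho> z) * ((ennreal (2 * \<kappa>\<^sup>2) * A z) * indicator (ball z (4 * \<rho> z)) x +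
         ennreal \<bar>u x - m z\<bar> * indicator (ball z (4 * \<rho> z)) x) \<partial>M)"
        by (intro nn_integral_cong) (auto simp: H_def indicator_def)
      also have "\<dots> = ennreal (2 / \<rho> z) * (ennreal (2 * \<kappa>\<^sup>2) * A z * ennreal V + ennreal V * A z)"
        by (subst nn_integral_cmult, measurable, subst nn_integral_add, measurable)
          (simp add: AV nn_integral_cmult_indicator emeasure_ball V_def)
      also have "ennreal (2 * \<kappa>\<^sup>2) * A z * ennreal V + ennreal V * A z = ennreal (V * (2 * \<kappa>\<^sup>2 + 1)) * A z"
        using V by (simp add: ennreal_mult'' ennreal_plus distrib_left distrib_right ac_simps)
      finally have "ennreal (1 / vol z (\<rho> z)) * (\<integral>\<^sup>+x\<in>ball z (2 * 1 * \<rho> z) \<inter> \<Omega>. H x z \<partial>M) \<le>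
        ennreal (1 / vol z (\<rho> z)) * (ennreal (2 / \<rho> z) * (ennreal (V * (2 * \<kappa>\<^sup>2 + 1)) * A z))"
        by (rule mult_left_mono) simp
      also have "\<dots> = ennreal (1 / vol z (\<rho> z) * (2 / \<rho> z) * (V * (2 * \<kappa>\<^sup>2 + 1))) * A z"
        using V p by (simp add: mult.assoc[symmetric] flip: ennreal_mult'')
      also have "\<dots> \<le> ennreal (2 * \<kappa> * (2 * \<kappa>\<^sup>2 + 1) * (1 / \<rho> z)) * A z"
      proof (intro mult_right_mono ennreal_leI)
        have "4 * \<rho> z \<le> 32 * \<Lambda> * \<rho> z" using p \<Lambda>_ge_1 by simp
        then have "V \<le> \<kappa> * vol z (\<rho> z)" unfolding V_def using p by (intro vol_\<kappa>) auto
        then have "1 / vol z (\<rho> z) * V \<le> \<kappa>" using vol_pos[OF p, of z] by (simp add: field_simps)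
        then have "(1 / vol z (\<rho> z) * V) * (2 / \<rho> z * (2 * \<kappa>\<^sup>2 + 1)) \<le> \<kappa> * (2 / \<rho> z * (2 * \<kappa>\<^sup>2 + 1))"
          using p by (intro mult_right_mono) auto
        moreover have "1 / vol z (\<rho> z) * V * (2 / \<rho> z * c) = 1 / vol z (\<rho> z) * (2 / \<rho> z) * (V * c)"
          "\<kappa> * (2 / \<rho> z * c) = 2 * \<kappa> * c * (1 / \<rho> z)" for c by simp_all
        ultimately show "1 / vol z (\<rho> z) * (2 / \<rho> z) * (V * (2 * \<kappa>\<^sup>2 + 1)) \<le>
           2 * \<kappa> * (2 * \<kappa>\<^sup>2 + 1) * (1 / \<rho> z)"
          by (simp only:)
      qed simp
      also have "\<dots> = ennreal (2 * \<kappa> * (2 * \<kappa>\<^sup>2 + 1)) * (ennreal (1 / \<rho> z) * A z)"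
        unfolding mult.assoc[of _ _ "A z", symmetric] using p by (subst ennreal_mult'') auto
      finally show ?thesis using True by simp
    qed simp
  qed simp
  also have "\<dots> = ennreal (2 * \<kappa>\<^sup>2 * (2 * \<kappa>\<^sup>2 + 1)) * (\<integral>\<^sup>+x\<in>\<Omega>. ennreal (1 / \<rho> x) * A x \<partial>M)"
  proof -
    have "ennreal \<kappa> * ennreal (2 * \<kappa> * (2 * \<kappa>\<^sup>2 + 1)) = ennreal (2 * \<kappa>\<^sup>2 * (2 * \<kappa>\<^sup>2 + 1))"
      using \<kappa>_ge_1 by (subst ennreal_mult''[symmetric]) (auto simp: power2_eq_square ac_simps)
    then show ?thesis using \<Omega>m by (subst nn_integral_cmult) (simp_all add: mult.assoc[symmetric])
  qed
  finally show ?thesis unfolding A_def .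
qed

end

subsection \<open>Sobolev inequality for locally Lipschitz functions\<close>

text \<open>The induction runs with the remaining tail subtracted; \<open>max n J\<close> expresses
  that nothing has been summed before index \<open>J\<close>.\<close>

lemma sum_tail_half_le: "(\<Sum>i<n. if i < J then 0 else (1/2) ^ i) \<le> 2 * (1/2 :: real) ^ J"
proof -
  have "(\<Sum>i<n. if i < J then 0 else (1/2) ^ i) \<le> 2 * (1/2 :: real) ^ J - 2 * (1/2) ^ max n J"
  proof (induction n)
    case (Suc n)
    show ?case
    proof (cases "n < J")
      case True
      then show ?thesis using Suc by (simp add: max_def split: if_splits)
    next
      case False
      then show ?thesis using Suc by (simp add: max_def)
    qed
  qed simp
  also have "\<dots> \<le> 2 * (1/2) ^ J" by simp
  finally show ?thesis .
qed

lemma ex_power_between: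
  fixes b y :: real
  assumes b: "1 < b" and y: "1 \<le> y"
  obtains n where "b ^ n \<le> y" "y < b ^ Suc n"
proof -
  obtain N where N: "y < b ^ N" using real_arch_pow[OF b] by blast
  define m where "m = (LEAST n. y < b ^ n)"
  have m: "y < b ^ m" unfolding m_def using N by (rule LeastI)
  have "m \<noteq> 0" using m y by (intro notI) simp
  then obtain n where n: "m = Suc n" using not0_implies_Suc by blast
  have "\<not> y < b ^ n" using not_less_Least[of n "\<lambda>n. y < b ^ n"] n by (simp add: m_def)
  then show thesis using that[of n] m n by simp
qed

text \<open>The bound on \<open>C\<close> says that halving a radius i times divides the volume by
  at most (2^s)^i.\<close>

locale sobolev_space = poincare_space M C CP \<Lambda> for M :: "'a::complete_space measure" and C CP \<Lambda> +
  fixes s :: real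
  assumes s_gt_1: "1 < s" and C_le: "C \<le> 2 powr s"
begin

lemma set_integrable_bounded:
  fixes h :: "'a \<Rightarrow> real"
  assumes "h \<in> borel_measurable M" "\<And>y. 0 \<le> h y \<and> h y \<le> t"
  shows "set_integrable M (ball x r) h"
  unfolding set_integrable_def
proof (rule Bochner_Integration.integrable_bound[OF integrable_ball[of t x r]])
  show "(\<lambda>y. indicator (ball x r) y *\<^sub>R h y) \<in> borel_measurable M"
    using assms(1) by (intro borel_measurable_scaleR borel_measurable_indicator ball_in_sets)
  show "AE y in M. norm (indicator (ball x r) y *\<^sub>R h y) \<le> norm (t * indicator (ball x r) y)"
  proof (rule AE_I2)
    fix y show "norm (indicator (ball x r) y *\<^sub>R h y) \<le> norm (t * indicator (ball x r) y)"
      using assms(2)[of y] by (auto simp: indicator_def)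
  qed
qed

lemma mean_diff_const:
  assumes "0 < r" "set_integrable M (ball x r) h"
  shows "mean h x r - c = (LINT y:ball x r|M. h y - c) / vol x r"
proof -
  have i: "set_integrable M (ball x r) (\<lambda>y. c)"
    using integrable_ball[of c x r] unfolding set_integrable_def by (simp add: mult.commute)
  have "(LINT y:ball x r|M. c) = c * vol x r"
    unfolding set_lebesgue_integral_def by (simp add: vol_def)
  then have "(LINT y:ball x r|M. h y - c) = (LINT y:ball x r|M. h y) - c * vol x r"
    using set_integral_diff(2)[OF assms(2) i] by simp
  then show ?thesis using vol_pos[OF assms(1), of x] by (simp add: mean_def diff_divide_distrib)
qed

lemma abs_mean_diff_const_le:
  assumes r: "0 < r" and h: "set_integrable M (ball x r) h"
  shows "ennreal \<bar>mean h x r - c\<bar> \<le> ennreal (1 / vol x r) * (\<integral>\<^sup>+y\<in>ball x r. ennreal \<bar>h y - c\<bar> \<partial>M)"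
proof -
  have V: "vol x r > 0" using r by (rule vol_pos)
  have i: "set_integrable M (ball x r) (\<lambda>y. c)"
    using integrable_ball[of c x r] unfolding set_integrable_def by (simp add: mult.commute)
  note hc = set_integral_diff(1)[OF h i]
  have "\<bar>LINT y:ball x r|M. h y - c\<bar> \<le> (LINT y:ball x r|M. \<bar>h y - c\<bar>)"
    using set_integral_norm_bound[OF hc] by simp
  then have "\<bar>mean h x r - c\<bar> \<le> 1 / vol x r * (LINT y:ball x r|M. \<bar>h y - c\<bar>)"
    unfolding mean_diff_const[OF assms] using V by (simp add: abs_divide divide_right_mono)
  then have "ennreal \<bar>mean h x r - c\<bar> \<le> ennreal (1 / vol x r * (LINT y:ball x r|M. \<bar>h y - c\<bar>))"
    by (rule ennreal_leI)
  also have "\<dots> = ennreal (1 / vol x r) * (\<integral>\<^sup>+y\<in>ball x r. ennreal \<bar>h y - c\<bar> \<partial>M)"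
    unfolding set_nn_integral_abs[OF hc] using V by (intro ennreal_mult') simp
  finally show ?thesis .
qed

lemma mean_half_diff:
  assumes r: "0 < r" and h: "set_integrable M (ball x r) h"
  shows "ennreal \<bar>mean h x (r / 2) - mean h x r\<bar> \<le> ennreal C * osc h x r"
proof -
  have V: "vol x r > 0" "vol x (r/2) > 0" using r by (auto intro: vol_pos)
  have sub: "ball x (r/2) \<subseteq> ball x r" using r by (intro subset_ball) simp
  have h': "set_integrable M (ball x (r/2)) h" by (rule set_integrable_subset[OF h ball_in_sets sub])
  have "ennreal \<bar>mean h x (r / 2) - mean h x r\<bar> \<le>
     ennreal (1 / vol x (r/2)) * (\<integral>\<^sup>+y\<in>ball x (r/2). ennreal \<bar>h y - mean h x r\<bar> \<partial>M)"
    using r by (intro abs_mean_diff_const_le h') simp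
  also have "\<dots> \<le> ennreal (C * (1 / vol x r)) * (\<integral>\<^sup>+y\<in>ball x r. ennreal \<bar>h y - mean h x r\<bar> \<partial>M)"
  proof (rule mult_mono[OF ennreal_leI])
    have "vol x r \<le> C * vol x (r/2)" using vol_doubling[of "r/2" x] r by simp
    then show "1 / vol x (r/2) \<le> C * (1 / vol x r)" using V by (simp add: field_simps)
    show "(\<integral>\<^sup>+y\<in>ball x (r/2). ennreal \<bar>h y - mean h x r\<bar> \<partial>M) \<le> (\<integral>\<^sup>+y\<in>ball x r. ennreal \<bar>h y - mean h x r\<bar> \<partial>M)"
      using sub by (intro nn_integral_mono mult_left_mono) (auto simp: indicator_def)
  qed auto
  also have "\<dots> = ennreal C * osc h x r"
    unfolding osc_def mult.assoc[symmetric] using C_ge_1 by (subst ennreal_mult') auto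
  finally show ?thesis .
qed

lemma mean_near_const:
  assumes r: "0 < r" and h: "set_integrable M (ball x r) h" and e: "0 \<le> e" "\<And>y. y \<in> ball x r \<Longrightarrow> \<bar>h y - c\<bar> \<le> e"
  shows "\<bar>mean h x r - c\<bar> \<le> e"
proof -
  have V: "vol x r > 0" using r by (rule vol_pos)
  have "ennreal \<bar>mean h x r - c\<bar> \<le> ennreal (1 / vol x r) * (\<integral>\<^sup>+y\<in>ball x r. ennreal \<bar>h y - c\<bar> \<partial>M)"
    by (rule abs_mean_diff_const_le[OF r h])
  also have "\<dots> \<le> ennreal (1 / vol x r) * (\<integral>\<^sup>+y. ennreal e * indicator (ball x r) y \<partial>M)"
    using e by (intro mult_left_mono nn_integral_mono) (auto simp: indicator_def intro: ennreal_leI)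
  also have "\<dots> = ennreal e"
    using V e by (simp add: nn_integral_cmult_indicator emeasure_ball mult.left_commute flip: ennreal_mult'')
  finally show ?thesis using e by (simp add: ennreal_le_iff)
qed

text \<open>The first \<open>J\<close> terms of the telescoping sum form a geometric series of ratio
  2^(s-1), and \<open>weak_threshold R m0 * N * (2 powr (s - 1)) ^ J / 8\<close> bounds it. The
  factor 8 makes this part at most t/8 when the product without it is at most t.\<close>

definition weak_threshold :: "real \<Rightarrow> real \<Rightarrow> real" where
  "weak_threshold R m0 = 8 * (C * CP) * R / (m0 * (2 powr (s - 1) - 1))"

text \<open>Collects 16 C CP R from the density level, \<kappa> from tripling balls, and a factor 2
  from rounding \<open>J\<close> to an integer.\<close>

definition weak_const :: "real \<Rightarrow> real \<Rightarrow> real" where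
  "weak_const R m0 = 32 * \<kappa> * (C * CP) * R * weak_threshold R m0 powr (1 / (s - 1))"

text \<open>
  Telescope \<open>h x - mean h x R\<close> over the balls of radius \<open>R / 2 ^ i\<close>. The terms with \<open>i < J\<close> are controlled by
  the total mass \<open>N\<close> and the lower mass bound, so some ball with \<open>i \<ge> J\<close> must have large density. The
  choice of \<open>J\<close> in \<open>weak_type\<close> balances both parts.
\<close>

lemma large_density_ball:
  fixes h :: "'a \<Rightarrow> real"
  assumes \<Omega>: "open \<Omega>" and x: "x \<in> \<Omega>" and R: "0 < R" and B: "ball x (2 * \<Lambda> * R) \<subseteq> \<Omega>"
    and m0: "0 < m0" "\<And>i. m0 / (2 powr s) ^ i \<le> vol x (R / 2 ^ i)"
    and h: "h \<in> borel_measurable M" "\<And>y. 0 \<le> h y \<and> h y \<le> t" "isCont h x" "h x = t" "0 < t"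
    and wug: "weak_upper_gradient M \<Omega> (\<lambda>y. ereal (h y)) g"
    and mean: "mean h x R \<le> t / 2"
    and N: "0 < N" "(\<integral>\<^sup>+y\<in>ball x (\<Lambda> * R). g y \<partial>M) \<le> ennreal N"
    and J: "weak_threshold R m0 * N * (2 powr (s - 1)) ^ J \<le> t"
  shows "\<exists>i. ennreal (t * 2 ^ J / (16 * (C * CP) * R) * vol x (\<Lambda> * (R / 2 ^ i))) \<le>
     (\<integral>\<^sup>+y\<in>ball x (\<Lambda> * (R / 2 ^ i)). g y \<partial>M)"
proof (rule ccontr)
  assume neg: "\<not> ?thesis"
  define Q where "Q = C * CP"
  define \<beta> where "\<beta> = (2::real) powr (s - 1)"
  have \<beta>: "\<beta> > 1" unfolding \<beta>_def using s_gt_1 by simp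
  have b2: "2 powr s = 2 * \<beta>" unfolding \<beta>_def by (simp add: powr_diff)
  have Q: "Q > 0" using C_ge_1 CP_pos by (simp add: Q_def)
  define r where "r i = R / 2 ^ i" for i :: nat
  have r: "0 < r i" "r i \<le> R" for i
  proof -
    show "0 < r i" using R by (simp add: r_def)
    have "R * 1 \<le> R * 2 ^ i" using R by (intro mult_left_mono) auto
    then show "r i \<le> R" by (simp add: r_def field_simps)
  qed
  have L0: "\<Lambda> > 0" using \<Lambda>_ge_1 by simp
  \<comment> \<open>Density level for which the tail of the telescoping sum, with ratio 1/2 from
    index \<open>J\<close> on, adds up to exactly t/8.\<close>
  define \<theta> where "\<theta> = t * 2 ^ J / (16 * Q * R)"
  have \<theta>: "\<theta> > 0" using h(5) Q R by (simp add: \<theta>_def)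
  have sub: "ball x (\<Lambda> * r i) \<subseteq> ball x (\<Lambda> * R)" for i
    using r[of i] L0 by (intro subset_ball mult_left_mono) auto
  have nuN: "(\<integral>\<^sup>+y\<in>ball x (\<Lambda> * r i). g y \<partial>M) \<le> ennreal N" for i
  proof -
    have "(\<integral>\<^sup>+y\<in>ball x (\<Lambda> * r i). g y \<partial>M) \<le> (\<integral>\<^sup>+y\<in>ball x (\<Lambda> * R). g y \<partial>M)"
      using sub[of i] by (intro nn_integral_mono mult_left_mono) (auto simp: indicator_def)
    then show ?thesis using N(2) by (rule order.trans)
  qed
  have hi: "set_integrable M (ball x r') h" for r' by (rule set_integrable_bounded[OF h(1,2)])
  have hball: "osc h x (r i) \<le> ennreal (CP * r i / vol x (\<Lambda> * r i)) * (\<integral>\<^sup>+y\<in>ball x (\<Lambda> * r i). g y \<partial>M)" for i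
  proof (rule local_poincare[OF r(1) _ wug open_in_sets[OF \<Omega>]])
    have "2 * \<Lambda> * r i \<le> 2 * \<Lambda> * R" using r(2)[of i] L0 by (intro mult_left_mono) auto
    then show "ball x (2 * \<Lambda> * r i) \<subseteq> \<Omega>" using subset_ball B by blast
    have "(\<integral>\<^sup>+y\<in>ball x (2 * \<Lambda> * r i). e2ennreal \<bar>ereal (h y)\<bar> \<partial>M) \<le>
       (\<integral>\<^sup>+y. ennreal t * indicator (ball x (2 * \<Lambda> * r i)) y \<partial>M)"
      using h(2) by (intro nn_integral_mono mult_right_mono) (auto simp: e2ennreal_ereal intro!: ennreal_leI)
    also have "\<dots> < \<infinity>"
      using h(5) by (simp add: nn_integral_cmult_indicator emeasure_ball flip: ennreal_mult'')
    finally show "(\<lambda>y. ereal (h y)) \<in> L1 M (ball x (2 * \<Lambda> * r i))"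
      using h(1) by (auto simp: L1_def L1_norm_def intro!: measurable_restrict_space1 borel_measurable_ereal)
  qed simp
  \<comment> \<open>Below \<open>J\<close> the mass bound \<open>N\<close> and the lower volume
    bound are used: the radius shrinks by 2 and the volume by at most 2^s per step, whence the ratio
    2^(s-1). From \<open>J\<close> on the negated claim bounds the density by \<theta>.\<close>
  define D where "D i = (if i < J then Q * R * N / m0 * \<beta> ^ i else 0) + Q * R * \<theta> *
     (if i < J then 0 else (1/2) ^ i)" for i
  have step: "\<bar>mean h x (r (Suc i)) - mean h x (r i)\<bar> \<le> D i" for i
  proof -
    define \<nu> where "\<nu> = (\<integral>\<^sup>+y\<in>ball x (\<Lambda> * r i). g y \<partial>M)"
    define V where "V = vol x (\<Lambda> * r i)"
    have V: "V > 0" unfolding V_def using L0 r(1)[of i] by (intro vol_pos) simp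
    have "\<nu> \<le> ennreal N" using nuN[of i] by (simp add: \<nu>_def)
    then obtain n where n: "\<nu> = ennreal n" "0 \<le> n" "n \<le> N"
      using N(1) by (cases \<nu>) (auto simp: ennreal_le_iff top_unique)
    have D0: "0 \<le> D i" unfolding D_def using Q R N m0 \<beta> \<theta>
      by (auto intro!: mult_nonneg_nonneg divide_nonneg_nonneg)
    have "n < \<theta> * V"
    proof (rule ccontr)
      assume "\<not> n < \<theta> * V"
      then have "ennreal (\<theta> * V) \<le> \<nu>" using n by (simp add: ennreal_leI)
      then show False using neg unfolding \<nu>_def V_def \<theta>_def Q_def r_def by blast
    qed
    have rs: "r (Suc i) = r i / 2" by (simp add: r_def)
    have "ennreal \<bar>mean h x (r (Suc i)) - mean h x (r i)\<bar> \<le> ennreal C * osc h x (r i)"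
      unfolding rs by (rule mean_half_diff[OF r(1) hi])
    also have "\<dots> \<le> ennreal C * (ennreal (CP * r i / V) * ennreal n)"
      using hball[of i] n by (intro mult_left_mono) (auto simp: V_def \<nu>_def)
    also have "\<dots> = ennreal (Q * r i * (n / V))"
      using C_ge_1 CP_pos r(1)[of i] V n by (simp add: Q_def mult.assoc flip: ennreal_mult)
    finally have 1: "\<bar>mean h x (r (Suc i)) - mean h x (r i)\<bar> \<le> Q * r i * (n / V)"
      using Q r(1)[of i] n V by (subst (asm) ennreal_le_iff) (auto intro!: mult_nonneg_nonneg)
    have "Q * r i * (n / V) \<le> D i"
    proof (cases "i < J")
      case True
      have "m0 / (2 * \<beta>) ^ i \<le> vol x (r i)" using m0(2)[of i] by (simp add: b2 r_def)
      also have "\<dots> \<le> V" unfolding V_def using r(1)[of i] \<Lambda>_ge_1 by (intro vol_mono subset_ball) simp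
      finally have mV: "m0 / (2 * \<beta>) ^ i \<le> V" .
      have mp: "0 < m0 / (2 * \<beta>) ^ i" using m0 \<beta> by simp
      have "n / V \<le> N / (m0 / (2 * \<beta>) ^ i)" using n mV mp N by (intro frac_le) auto
      then have "Q * r i * (n / V) \<le> Q * r i * (N / (m0 / (2 * \<beta>) ^ i))"
        using Q r(1)[of i] by (intro mult_left_mono) auto
      also have "\<dots> = Q * R * N / m0 * \<beta> ^ i" using \<beta> by (simp add: r_def power_mult_distrib)
      finally show ?thesis using True by (simp add: D_def)
    next
      case False
      have "n / V \<le> \<theta>" using \<open>n < \<theta> * V\<close> V by (simp add: field_simps)
      then have "Q * r i * (n / V) \<le> Q * r i * \<theta>" using Q r(1)[of i] by (intro mult_left_mono) auto
      also have "\<dots> = Q * R * \<theta> * (1/2) ^ i" by (simp add: r_def power_one_over field_simps)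
      finally show ?thesis using False by (simp add: D_def)
    qed
    then show ?thesis using 1 by linarith
  qed
  have tele: "\<bar>mean h x (r n) - mean h x (r 0)\<bar> \<le> (\<Sum>i<n. D i)" for n
  proof (induction n)
    case (Suc n)
    then show ?case using step[of n] by simp
  qed simp
  have sumD: "(\<Sum>i<n. D i) \<le> t / 4" for n
  proof -
    have "(\<Sum>i<n. if i < J then Q * R * N / m0 * \<beta> ^ i else 0) \<le> (\<Sum>i<J. Q * R * N / m0 * \<beta> ^ i)"
    proof -
      have "(\<Sum>i<n. if i < J then Q * R * N / m0 * \<beta> ^ i else 0) =
         (\<Sum>i\<in>{..<n} \<inter> {..<J}. Q * R * N / m0 * \<beta> ^ i)"
        by (subst sum.inter_restrict) auto
      also have "\<dots> \<le> (\<Sum>i<J. Q * R * N / m0 * \<beta> ^ i)"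
        using Q R N m0 \<beta> by (intro sum_mono2) (auto intro!: mult_nonneg_nonneg divide_nonneg_nonneg)
      finally show ?thesis .
    qed
    also have "\<dots> = Q * R * N / m0 * ((\<beta> ^ J - 1) / (\<beta> - 1))"
      unfolding sum_distrib_left[symmetric] using \<beta> by (subst geometric_sum) auto
    also have "\<dots> \<le> Q * R * N / m0 * (\<beta> ^ J / (\<beta> - 1))"
      using Q R N m0 \<beta> by (intro mult_left_mono divide_right_mono) auto
    also have "\<dots> = weak_threshold R m0 * N * \<beta> ^ J / 8"
      unfolding weak_threshold_def Q_def[symmetric] \<beta>_def[symmetric] by simp
    also have "\<dots> \<le> t / 8" using J unfolding \<beta>_def by simp
    finally have 1: "(\<Sum>i<n. if i < J then Q * R * N / m0 * \<beta> ^ i else 0) \<le> t / 8" .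
    have "(\<Sum>i<n. Q * R * \<theta> * (if i < J then 0 else (1/2) ^ i)) \<le> Q * R * \<theta> * (2 * (1/2) ^ J)"
      unfolding sum_distrib_left[symmetric] using Q R \<theta> by (intro mult_left_mono sum_tail_half_le) auto
    also have "\<dots> = t / 8" using Q R by (simp add: \<theta>_def power_one_over)
    finally show ?thesis using 1 unfolding D_def sum.distrib by linarith
  qed
  \<comment> \<open>By continuity small balls have mean at least 7t/8, whereas the telescoping sum
    allows at most t/2 + t/4; this is the contradiction.\<close>
  obtain \<delta> where \<delta>: "\<delta> > 0" "\<And>y. dist x y < \<delta> \<Longrightarrow> \<bar>h y - t\<bar> < t / 8"
  proof -
    have "t / 8 > 0" using h(5) by simp
    with h(3) obtain d where "d > 0" "\<And>y. dist y x < d \<Longrightarrow> dist (h y) (h x) < t / 8"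
      unfolding continuous_at_eps_delta by blast
    then have "\<bar>h y - t\<bar> < t / 8" if "dist x y < d" for y
      using that h(4) by (simp add: dist_commute dist_real_def abs_minus_commute)
    then show thesis using that[of d] \<open>d > 0\<close> by blast
  qed
  obtain n where n: "(1/2) ^ n < \<delta> / R" using real_arch_pow_inv[of "\<delta> / R" "1/2"] \<delta> R by auto
  have "r n < \<delta>" using n R by (simp add: r_def power_one_over field_simps)
  then have "\<bar>h y - t\<bar> \<le> t / 8" if "y \<in> ball x (r n)" for y
    using \<delta>(2)[of y] that by simp
  then have "\<bar>mean h x (r n) - t\<bar> \<le> t / 8"
    using h(5) by (intro mean_near_const[OF r(1) hi]) simp_all
  moreover have "mean h x (r 0) \<le> t / 2" using mean by (simp add: r_def)
  ultimately show False using tele[of n] sumD[of n] h(5) by linarith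
qed

text \<open>Every point of the compact set where \<open>h\<close> attains the level \<open>t\<close>
  is the centre of a ball on which the gradient has density at least \<theta>. Finitely many of them
  cover, a disjoint subfamily covers after tripling, and disjointness bounds the total gradient by
  \<open>N\<close>; so the measure is at most \<kappa> N / \<theta>.\<close>

lemma weak_type:
  fixes h :: "'a \<Rightarrow> real"
  assumes \<Omega>: "open \<Omega>" and R: "0 < R" and B: "ball x0 ((1 + 2 * \<Lambda>) * R) \<subseteq> \<Omega>"
    and m0: "0 < m0" "\<And>x i. x \<in> cball x0 R \<Longrightarrow> m0 / (2 powr s) ^ i \<le> vol x (R / 2 ^ i)"
    and h: "h \<in> borel_measurable M" "\<And>y. 0 \<le> h y \<and> h y \<le> t" "continuous_on \<Omega> h" "0 < t"
    and wug: "weak_upper_gradient M \<Omega> (\<lambda>y. ereal (h y)) g"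
    and mean: "\<And>x. x \<in> cball x0 R \<Longrightarrow> mean h x R \<le> t / 2"
    and N: "0 < N" "(\<integral>\<^sup>+y\<in>ball x0 ((1 + 2 * \<Lambda>) * R). g y \<partial>M) \<le> ennreal N"
    and t: "weak_threshold R m0 * N \<le> t"
  shows "emeasure M {x \<in> cball x0 R. h x = t} \<le> ennreal (weak_const R m0 * (N / t) powr (s / (s - 1)))"
proof -
  define B1 where "B1 = ball x0 ((1 + 2 * \<Lambda>) * R)"
  define Q where "Q = C * CP"
  define \<beta> where "\<beta> = (2::real) powr (s - 1)"
  define c1 where "c1 = weak_threshold R m0"
  have \<beta>: "\<beta> > 1" unfolding \<beta>_def using s_gt_1 by simp
  have Q: "Q > 0" using C_ge_1 CP_pos by (simp add: Q_def)
  have L0: "\<Lambda> > 0" using \<Lambda>_ge_1 by simp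
  have c1: "c1 > 0" unfolding c1_def weak_threshold_def using Q R m0 \<beta> unfolding Q_def \<beta>_def by simp
  have Y1: "1 \<le> t / (c1 * N)" using t c1 N(1) by (simp add: c1_def)
  \<comment> \<open>The largest admissible \<open>J\<close>: the larger it is, the higher the
    density level \<theta> and the better the bound. The hypothesis on \<open>t\<close> makes J = 0
    admissible.\<close>
  obtain J where J: "\<beta> ^ J \<le> t / (c1 * N)" "t / (c1 * N) < \<beta> ^ Suc J" using ex_power_between[OF \<beta> Y1] .
  have J': "c1 * N * \<beta> ^ J \<le> t" using J(1) c1 N(1) by (simp add: field_simps)
  define \<theta> where "\<theta> = t * 2 ^ J / (16 * Q * R)"
  have \<theta>: "\<theta> > 0" using h(4) Q R by (simp add: \<theta>_def)
  have sub1: "ball x (2 * \<Lambda> * R) \<subseteq> B1" if "x \<in> cball x0 R" for x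
  proof
    fix y assume "y \<in> ball x (2 * \<Lambda> * R)"
    then show "y \<in> B1" using that dist_triangle[of x0 y x] by (auto simp: B1_def distrib_right)
  qed
  have sub2: "ball x (\<Lambda> * R) \<subseteq> B1" if "x \<in> cball x0 R" for x
  proof -
    have "ball x (\<Lambda> * R) \<subseteq> ball x (2 * \<Lambda> * R)" using L0 R by (intro subset_ball) simp
    then show ?thesis using sub1[OF that] by blast
  qed
  have cb\<Omega>: "x \<in> \<Omega>" if "x \<in> cball x0 R" for x
  proof -
    have "x \<in> ball x (2 * \<Lambda> * R)" using L0 R by simp
    then show ?thesis using sub1[OF that] B unfolding B1_def by blast
  qed
  define E where "E = {x \<in> cball x0 R. h x = t}"
  have E_sub: "E \<subseteq> cball x0 R" by (auto simp: E_def)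
  have "continuous_on (cball x0 R) h" by (rule continuous_on_subset[OF h(3)]) (use cb\<Omega> in blast)
  then have "closed {x \<in> cball x0 R. h x = t}" by (rule continuous_closed_preimage_constant) simp
  then have E: "compact E" unfolding E_def
    by (rule compact_closed_bounded) (rule bounded_subset[OF bounded_cball[of x0 R]], auto)
  define r where "r i = R / 2 ^ i" for i :: nat
  have r: "0 < r i" "r i \<le> R" for i
  proof -
    show "0 < r i" using R by (simp add: r_def)
    have "R * 1 \<le> R * 2 ^ i" using R by (intro mult_left_mono) auto
    then show "r i \<le> R" by (simp add: r_def field_simps)
  qed
  have ex: "\<exists>i. ennreal (\<theta> * vol x (\<Lambda> * r i)) \<le> (\<integral>\<^sup>+y\<in>ball x (\<Lambda> * r i). g y \<partial>M)" if x: "x \<in> E" for x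
  proof -
    have xc: "x \<in> cball x0 R" using x by (simp add: E_def)
    have "(\<integral>\<^sup>+y\<in>ball x (\<Lambda> * R). g y \<partial>M) \<le> (\<integral>\<^sup>+y\<in>B1. g y \<partial>M)"
      using sub2[OF xc] by (intro nn_integral_mono mult_left_mono) (auto simp: indicator_def)
    then have N': "(\<integral>\<^sup>+y\<in>ball x (\<Lambda> * R). g y \<partial>M) \<le> ennreal N" using N(2) unfolding B1_def
      by (rule order.trans)
    have "isCont h x" using h(3) cb\<Omega>[OF xc] \<Omega> by (simp add: continuous_on_eq_continuous_at)
    moreover have "h x = t" using x by (simp add: E_def)
    ultimately show ?thesis
      unfolding \<theta>_def Q_def r_def
      using sub1[OF xc] B m0 xc J' N' unfolding B1_def c1_def \<beta>_def
      by (intro large_density_ball[OF \<Omega> cb\<Omega>[OF xc] R _ _ _ h(1,2) _ _ h(4) wug mean[OF xc] N(1)]) auto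
  qed
  then obtain ix where ix: "\<And>x. x \<in> E \<Longrightarrow> ennreal (\<theta> * vol x (\<Lambda> * r (ix x))) \<le>
     (\<integral>\<^sup>+y\<in>ball x (\<Lambda> * r (ix x)). g y \<partial>M)" by metis
  define rr where "rr x = \<Lambda> * r (ix x)" for x
  have rr: "0 < rr x" "rr x \<le> \<Lambda> * R" for x using r L0 by (auto simp: rr_def)
  obtain I where I: "I \<subseteq> E" "finite I" "E \<subseteq> (\<Union>x\<in>I. ball x (rr x))"
    by (rule compactE_image[OF E, of E "\<lambda>x. ball x (rr x)"]) (use rr in auto)
  obtain J' where J': "J' \<subseteq> I" "disjoint_family_on (\<lambda>j. ball j (rr j)) J'"
    "\<And>i. i \<in> I \<Longrightarrow> \<exists>j\<in>J'. ball i (rr i) \<subseteq> ball j (3 * rr j)"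
    using finite_ball_covering[OF I(2), of "\<lambda>x. x" rr] by metis
  have finJ: "finite J'" using J'(1) I(2) by (rule finite_subset)
  have "emeasure M E \<le> emeasure M (\<Union>j\<in>J'. ball j (3 * rr j))"
  proof (rule emeasure_mono)
    show "E \<subseteq> (\<Union>j\<in>J'. ball j (3 * rr j))" using I(3) J'(3) by blast
    show "(\<Union>j\<in>J'. ball j (3 * rr j)) \<in> sets M" by (intro open_in_sets open_UN) auto
  qed
  also have "\<dots> \<le> (\<Sum>j\<in>J'. emeasure M (ball j (3 * rr j)))"
    using finJ by (intro emeasure_subadditive_finite) auto
  also have "\<dots> \<le> (\<Sum>j\<in>J'. ennreal (\<kappa> / \<theta>) * (\<integral>\<^sup>+y\<in>ball j (rr j). g y \<partial>M))"
  proof (rule sum_mono)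
    fix j assume "j \<in> J'"
    then have "j \<in> E" using J'(1) I(1) by blast
    have "3 * rr j \<le> 32 * \<Lambda> * rr j" using rr[of j] \<Lambda>_ge_1 by (intro mult_right_mono) auto
    then have "vol j (3 * rr j) \<le> \<kappa> * vol j (rr j)" using rr by (intro vol_\<kappa>) auto
    also have "\<dots> = \<kappa> / \<theta> * (\<theta> * vol j (rr j))" using \<theta> by simp
    finally have "emeasure M (ball j (3 * rr j)) \<le> ennreal (\<kappa> / \<theta> * (\<theta> * vol j (rr j)))"
      unfolding emeasure_ball by (rule ennreal_leI)
    also have "\<dots> = ennreal (\<kappa> / \<theta>) * ennreal (\<theta> * vol j (rr j))" using \<theta> by (intro ennreal_mult'') simp
    also have "\<dots> \<le> ennreal (\<kappa> / \<theta>) * (\<integral>\<^sup>+y\<in>ball j (rr j). g y \<partial>M)"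
      using ix[OF \<open>j \<in> E\<close>] by (intro mult_left_mono) (auto simp: rr_def)
    finally show "emeasure M (ball j (3 * rr j)) \<le> ennreal (\<kappa> / \<theta>) * (\<integral>\<^sup>+y\<in>ball j (rr j). g y \<partial>M)" .
  qed
  also have "\<dots> = ennreal (\<kappa> / \<theta>) * (\<Sum>j\<in>J'. \<integral>\<^sup>+y\<in>ball j (rr j). g y \<partial>M)" by (simp add: sum_distrib_left)
  also have "(\<Sum>j\<in>J'. \<integral>\<^sup>+y\<in>ball j (rr j). g y \<partial>M) \<le> ennreal N"
  proof -
    \<comment> \<open>The gradient is measurable only relative to \<Omega>, which contains all the
      balls; multiplying by the indicator of \<Omega> permits the interchange of sum and
      integral.\<close>
    have gm: "(\<lambda>y. g y * indicator \<Omega> y) \<in> borel_measurable M"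
      using wug open_in_sets[OF \<Omega>] unfolding weak_upper_gradient_def
      by (subst borel_measurable_restrict_space_iff_ennreal[symmetric]) auto
    have jsub: "ball j (rr j) \<subseteq> B1" if "j \<in> J'" for j
    proof -
      have "j \<in> cball x0 R" using that J'(1) I(1) E_sub by blast
      from sub2[OF this] subset_ball[OF rr(2)[of j], of j] show ?thesis by blast
    qed
    have B1\<Omega>: "B1 \<subseteq> \<Omega>" using B by (simp add: B1_def)
    have "(\<Sum>j\<in>J'. \<integral>\<^sup>+y\<in>ball j (rr j). g y \<partial>M) =
       (\<Sum>j\<in>J'. \<integral>\<^sup>+y. (g y * indicator \<Omega> y) * indicator (ball j (rr j)) y \<partial>M)"
    proof (intro sum.cong nn_integral_cong refl)
      fix j y assume "j \<in> J'"
      then have "ball j (rr j) \<subseteq> \<Omega>" using jsub B1\<Omega> by blast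
      then show "g y * indicator (ball j (rr j)) y = (g y * indicator \<Omega> y) * indicator (ball j (rr j)) y"
        by (auto simp: indicator_def)
    qed
    also have "\<dots> = (\<integral>\<^sup>+y. (\<Sum>j\<in>J'. (g y * indicator \<Omega> y) * indicator (ball j (rr j)) y) \<partial>M)"
      by (intro nn_integral_sum[symmetric] borel_measurable_times_ennreal[OF gm] borel_measurable_indicator
        ball_in_sets)
    also have "\<dots> \<le> (\<integral>\<^sup>+y\<in>B1. g y \<partial>M)"
    proof (rule nn_integral_mono)
      fix y
      have "(\<Sum>j\<in>J'. indicator (ball j (rr j)) y) = (indicator (\<Union>j\<in>J'. ball j (rr j)) y :: ennreal)"
        using indicator_UN_disjoint[OF finJ J'(2), of y] by (rule sym)
      also have "\<dots> \<le> indicator B1 y"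
      proof -
        have "(\<Union>j\<in>J'. ball j (rr j)) \<subseteq> B1" using jsub by blast
        then show ?thesis unfolding indicator_def by (simp del: mem_ball UN_iff) blast
      qed
      finally have "(g y * indicator \<Omega> y) * (\<Sum>j\<in>J'. indicator (ball j (rr j)) y) \<le>
         (g y * indicator \<Omega> y) * indicator B1 y"
        by (intro mult_left_mono) auto
      then show "(\<Sum>j\<in>J'. (g y * indicator \<Omega> y) * indicator (ball j (rr j)) y) \<le> g y * indicator B1 y"
        unfolding sum_distrib_left by (rule order.trans) (auto simp: indicator_def)
    qed
    also have "\<dots> \<le> ennreal N" using N(2) by (simp add: B1_def)
    finally show ?thesis .
  qed
  also have "ennreal (\<kappa> / \<theta>) * ennreal N = ennreal (\<kappa> / \<theta> * N)" using N(1)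
    by (intro ennreal_mult''[symmetric]) simp
  also have "\<kappa> / \<theta> * N \<le> weak_const R m0 * (N / t) powr (s / (s - 1))"
  proof -
    \<comment> \<open>Since \<beta> to the power \<open>e\<close> is 2, maximality of
      \<open>J\<close> bounds 2^-J by a multiple of (N/t)^e. Together with the factor N/t from
      \<theta> the exponent becomes 1 + 1/(s-1) = s/(s-1): this is where the Sobolev exponent
      arises.\<close>
    define e where "e = 1 / (s - 1)"
    have e: "e > 0" using s_gt_1 by (simp add: e_def)
    have be: "\<beta> powr e = 2" unfolding \<beta>_def e_def using s_gt_1 by (simp add: powr_powr)
    have "(t / (c1 * N)) powr e \<le> (\<beta> ^ Suc J) powr e"
      using J(2) Y1 e by (intro powr_mono2) auto
    also have "\<dots> = 2 ^ Suc J"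
    proof -
      have "(\<beta> ^ Suc J) powr e = (\<beta> powr real (Suc J)) powr e" using \<beta> by (subst powr_realpow) auto
      also have "\<dots> = (\<beta> powr e) powr real (Suc J)" by (simp only: powr_powr mult.commute)
      also have "\<dots> = 2 ^ Suc J" unfolding be by (rule powr_realpow) simp
      finally show ?thesis .
    qed
    finally have 1: "(t / (c1 * N)) powr e \<le> 2 * 2 ^ J" by simp
    have tp: "0 < t / (c1 * N)" using Y1 by linarith
    have "1 / 2 ^ J \<le> 2 / (t / (c1 * N)) powr e"
    proof -
      have "1 / P \<le> 2 / X" if "X \<le> 2 * P" "0 < X" "0 < P" for X P :: real
        using that by (simp add: field_simps)
      then show ?thesis using 1 tp by (metis powr_gt_zero zero_less_power zero_less_numeral order_less_irrefl)
    qed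
    also have "\<dots> = 2 * (c1 * N / t) powr e"
      using tp c1 N(1) h(4) by (simp add: powr_divide field_simps)
    finally have 2: "1 / 2 ^ J \<le> 2 * (c1 * N / t) powr e" .
    have "\<kappa> / \<theta> * N = 16 * \<kappa> * Q * R * (N / t) * (1 / 2 ^ J)" using h(4) by (simp add: \<theta>_def field_simps)
    also have "\<dots> \<le> 16 * \<kappa> * Q * R * (N / t) * (2 * (c1 * N / t) powr e)"
      using 2 \<kappa>_ge_1 Q R N(1) h(4) by (intro mult_left_mono) auto
    also have "(c1 * N / t) powr e = c1 powr e * (N / t) powr e"
      using c1 N(1) h(4) powr_mult[of c1 "N / t" e] by simp
    also have "16 * \<kappa> * Q * R * (N / t) * (2 * (c1 powr e * (N / t) powr e)) =
       32 * \<kappa> * Q * R * c1 powr e * ((N / t) powr 1 * (N / t) powr e)"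
      using N(1) h(4) by simp
    also have "(N / t) powr 1 * (N / t) powr e = (N / t) powr (s / (s - 1))"
      unfolding powr_add[symmetric] e_def using s_gt_1 by (simp add: field_simps)
    finally show ?thesis unfolding weak_const_def Q_def c1_def e_def .
  qed
  finally show ?thesis unfolding E_def by (simp add: ennreal_leI mult_left_mono)
qed

text \<open>The end points of the level interval have ratio 6 < 2^3, so at most three consecutive
  dyadic levels can contain a given value.\<close>

lemma sum_truncation_indicators_le:
  fixes t1 :: real
  assumes "0 < t1"
  shows "(\<Sum>k. indicator {y. t1 * 2 ^ k / 2 < f y \<and> f y < 3 * (t1 * 2 ^ k)} y) \<le> (3 :: ennreal)"
proof -
  define K where "K = {k::nat. t1 * 2 ^ k / 2 < f y \<and> f y < 3 * (t1 * 2 ^ k)}"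
  have "\<exists>k0. K \<subseteq> {k0..k0 + 2}"
  proof (cases "K = {}")
    case False
    define k0 where "k0 = (LEAST k. k \<in> K)"
    have "\<exists>k. k \<in> K" using False by blast
    then have k0: "k0 \<in> K" unfolding k0_def by (rule LeastI_ex)
    have "k0 \<le> k \<and> k \<le> k0 + 2" if k: "k \<in> K" for k
    proof
      show "k0 \<le> k" unfolding k0_def using k by (rule Least_le)
      show "k \<le> k0 + 2"
      proof (rule ccontr)
        assume "\<not> k \<le> k0 + 2"
        then have "k0 + 3 \<le> k" by simp
        then have "t1 * 2 ^ (k0 + 3) \<le> t1 * 2 ^ k" using assms by (intro mult_left_mono power_increasing) auto
        then have "8 * (t1 * 2 ^ k0) \<le> t1 * 2 ^ k" by (simp add: power_add)
        moreover have "t1 * 2 ^ k / 2 < 3 * (t1 * 2 ^ k0)" using k k0 by (auto simp: K_def)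
        moreover have "0 < t1 * 2 ^ k0" using assms by simp
        ultimately show False by linarith
      qed
    qed
    then show ?thesis by (intro exI[of _ k0]) auto
  qed auto
  then obtain k0 where k0: "K \<subseteq> {k0..k0 + 2}" by blast
  have "(\<Sum>k. indicator {y. t1 * 2 ^ k / 2 < f y \<and> f y < 3 * (t1 * 2 ^ k)} y :: ennreal)
      = (\<Sum>k\<in>{k0..k0 + 2}. indicator {y. t1 * 2 ^ k / 2 < f y \<and> f y < 3 * (t1 * 2 ^ k)} y)"
    using k0 by (intro suminf_finite) (auto simp: K_def indicator_def)
  also have "\<dots> \<le> (\<Sum>k\<in>{k0..k0 + 2}. 1)" by (intro sum_mono) (auto simp: indicator_def)
  also have "\<dots> = 3" by simp
  finally show ?thesis .
qed

text \<open>The truncation is constant where f < t and where f > 2t. The wider window from t/2 to 3t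
  makes these two open sets and the window cover \<Omega>, so each point has a neighbourhood on
  which one case applies throughout.\<close>

lemma truncation_gradient:
  assumes \<Omega>: "open \<Omega>" and f: "continuous_on \<Omega> f" and loc: "local_lipschitz_gradient \<Omega> f G"
    and t: "0 < (t::real)"
  shows "local_lipschitz_gradient \<Omega> (\<lambda>y. min (max (f y - t) 0) t) (\<lambda>y. G y * indicator {y. t / 2 < f y \<and> f y <
     3 * t} y)"
  unfolding local_lipschitz_gradient_def
proof
  fix x assume x: "x \<in> \<Omega>"
  define h where "h y = min (max (f y - t) 0) t" for y
  define I where "I y = (G y * indicator {y. t / 2 < f y \<and> f y < 3 * t} y)" for y
  show "\<exists>U. open U \<and> x \<in> U \<and> (\<forall>y\<in>U \<inter> \<Omega>. \<forall>z\<in>U \<inter> \<Omega>. \<forall>w\<in>U \<inter> \<Omega>. ennreal \<bar>h z - h w\<bar> \<le> I y * ennreal (dist z w))"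
  proof -
    consider "f x \<le> t / 2" | "3 * t \<le> f x" | "t / 2 < f x" "f x < 3 * t" by linarith
    then show ?thesis
    proof cases
      case 1
      have "open (\<Omega> \<inter> f -` {..<t})" by (rule continuous_open_preimage[OF f \<Omega>]) simp
      then show ?thesis using 1 x t by (intro exI[of _ "\<Omega> \<inter> f -` {..<t}"]) (auto simp: h_def)
    next
      case 2
      have "open (\<Omega> \<inter> f -` {2 * t<..})" by (rule continuous_open_preimage[OF f \<Omega>]) simp
      then show ?thesis using 2 x t by (intro exI[of _ "\<Omega> \<inter> f -` {2 * t<..}"]) (auto simp: h_def)
    next
      case 3
      obtain U where U: "open U" "x \<in> U"
        "\<And>y z w. y \<in> U \<inter> \<Omega> \<Longrightarrow> z \<in> U \<inter> \<Omega> \<Longrightarrow> w \<in> U \<inter> \<Omega> \<Longrightarrow> ennreal \<bar>f z - f w\<bar> \<le> G y * ennreal (dist z w)"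
        using loc x unfolding local_lipschitz_gradient_def by meson
      have o: "open (\<Omega> \<inter> f -` {t/2<..<3*t})" by (rule continuous_open_preimage[OF f \<Omega>]) simp
      show ?thesis
      proof (intro exI[of _ "U \<inter> (\<Omega> \<inter> f -` {t/2<..<3*t})"] conjI ballI)
        show "open (U \<inter> (\<Omega> \<inter> f -` {t/2<..<3*t}))" using U(1) o by (rule open_Int)
        show "x \<in> U \<inter> (\<Omega> \<inter> f -` {t/2<..<3*t})" using U(2) x 3 by simp
        fix y z w assume yzw: "y \<in> U \<inter> (\<Omega> \<inter> f -` {t/2<..<3*t}) \<inter> \<Omega>" "z \<in> U \<inter> (\<Omega> \<inter> f -` {t/2<..<3*t}) \<inter> \<Omega>"
          "w \<in> U \<inter> (\<Omega> \<inter> f -` {t/2<..<3*t}) \<inter> \<Omega>"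
        have "\<bar>h z - h w\<bar> \<le> \<bar>f z - f w\<bar>" unfolding h_def by (auto simp: min_def max_def)
        then have "ennreal \<bar>h z - h w\<bar> \<le> ennreal \<bar>f z - f w\<bar>" by (rule ennreal_leI)
        also have "\<dots> \<le> G y * ennreal (dist z w)" using yzw by (intro U(3)) auto
        also have "G y = I y" using yzw by (simp add: I_def)
        finally show "ennreal \<bar>h z - h w\<bar> \<le> I y * ennreal (dist z w)" .
      qed
    qed
  qed
qed

text \<open>
  The weak type estimate is applied to the truncations of \<open>f\<close> at the levels \<open>t1 * 2 ^ k\<close>. Their gradients
  live on sets of overlap at most three, so the estimates can be summed (Maz'ya's truncation method).
\<close>

lemma sobolev_ball:
  assumes \<Omega>: "open \<Omega>" and R: "0 < R" and B: "ball x0 ((1 + 2 * \<Lambda>) * R) \<subseteq> \<Omega>" and AN: "0 \<le> A" "0 \<le> N"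
  shows "\<exists>K. \<forall>f G. f \<in> borel_measurable M \<longrightarrow> (\<forall>y. 0 \<le> f y) \<longrightarrow> continuous_on \<Omega> f \<longrightarrow>
     local_lipschitz_gradient \<Omega> f G \<longrightarrow> G \<in> borel_measurable M \<longrightarrow>
     (\<integral>\<^sup>+y\<in>ball x0 ((1 + 2 * \<Lambda>) * R). ennreal (f y) \<partial>M) \<le> ennreal A \<longrightarrow>
     (\<integral>\<^sup>+y\<in>ball x0 ((1 + 2 * \<Lambda>) * R). G y \<partial>M) \<le> ennreal N \<longrightarrow>
     (\<integral>\<^sup>+y\<in>ball x0 R. ennreal (f y powr (s / (s - 1))) \<partial>M) \<le> ennreal K"
proof -
  define q where "q = s / (s - 1)"
  have q: "1 < q" using s_gt_1 by (simp add: q_def field_simps)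
  define B1 where "B1 = ball x0 ((1 + 2 * \<Lambda>) * R)"
  define m0 where "m0 = vol x0 R / \<kappa>"
  have m0: "0 < m0" using vol_pos[OF R, of x0] \<kappa>_ge_1 by (simp add: m0_def)
  have m0_le: "m0 \<le> vol x R" if "x \<in> cball x0 R" for x
  proof -
    have "2 * R \<le> 32 * \<Lambda> * R" using R \<Lambda>_ge_1 by (intro mult_right_mono) auto
    moreover have "dist x x0 \<le> R" using that by (simp add: dist_commute)
    ultimately have "vol x0 R \<le> \<kappa> * vol x R" using R by (intro vol_\<kappa>) linarith+
    then show ?thesis using \<kappa>_ge_1 by (simp add: m0_def field_simps)
  qed
  \<comment> \<open>The homogeneous dimension enters here, through the comparison of the doubling
    constant with 2^s.\<close>
  have lower: "m0 / (2 powr s) ^ i \<le> vol x (R / 2 ^ i)" if "x \<in> cball x0 R" for x i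
  proof -
    have "vol x (2 ^ i * (R / 2 ^ i)) \<le> C ^ i * vol x (R / 2 ^ i)" using R by (intro vol_doubling_power) simp
    also have "\<dots> \<le> (2 powr s) ^ i * vol x (R / 2 ^ i)" using C_le C_ge_1
      by (intro mult_right_mono power_mono) auto
    finally have "m0 \<le> (2 powr s) ^ i * vol x (R / 2 ^ i)" using m0_le[OF that] by simp
    then show ?thesis by (simp add: field_simps)
  qed
  define c1 where "c1 = weak_threshold R m0"
  have \<beta>: "2 powr (s - 1) > (1::real)" using s_gt_1 by simp
  have c1: "c1 \<ge> 0" unfolding c1_def weak_threshold_def using C_ge_1 CP_pos R m0 \<beta> by simp
  define K1 where "K1 = weak_const R m0"
  have K1: "K1 \<ge> 0" unfolding K1_def weak_const_def using C_ge_1 CP_pos R \<kappa>_ge_1 by simp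
  \<comment> \<open>The lowest level is high enough that every truncation has mean at most half its
    level (2 A / m0) and that the threshold of the weak type estimate is met for masses up to N + 1;
    the summand 1 keeps it positive.\<close>
  define t1 where "t1 = 1 + 2 * A / m0 + c1 * (N + 1)"
  have t1: "t1 \<ge> 1" "2 * A / m0 \<le> t1" "c1 * (N + 1) \<le> t1" using AN m0 c1 by (auto simp: t1_def)
  define t where "t k = t1 * 2 ^ k" for k :: nat
  have tk: "t1 \<le> t k" for k
    using mult_left_mono[of 1 "2 ^ k" t1] t1(1) by (simp add: t_def)
  have tpos: "0 < t k" for k using tk[of k] t1 by linarith
  \<comment> \<open>The constant is fixed before \<open>f\<close> and \<open>G\<close> appear, since
    the bound has to hold uniformly for convolutions at all scales.\<close>
  define K where "K = (2 * t1) powr q * vol x0 R + 4 powr q * K1 * (N + 1) powr (q - 1) * (3 * N + 2)"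
  have main: "(\<integral>\<^sup>+y\<in>ball x0 R. ennreal (f y powr q) \<partial>M) \<le> ennreal K"
    if f: "f \<in> borel_measurable M" "\<And>y. 0 \<le> f y" "continuous_on \<Omega> f"
      and loc: "local_lipschitz_gradient \<Omega> f G" and G: "G \<in> borel_measurable M"
      and fA: "(\<integral>\<^sup>+y\<in>B1. ennreal (f y) \<partial>M) \<le> ennreal A" and GN: "(\<integral>\<^sup>+y\<in>B1. G y \<partial>M) \<le> ennreal N" for f G
  proof -
    note [measurable] = f(1) G ball_in_sets
    have [measurable]: "B1 \<in> sets M" by (simp add: B1_def)
    define h where "h k y = min (max (f y - t k) 0) (t k)" for k y
    define Gk where "Gk k y = G y * indicator {y. t k / 2 < f y \<and> f y < 3 * t k} y" for k y
    have "{y \<in> space M. t k / 2 < f y \<and> f y < 3 * t k} \<in> sets M" for k by measurable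
    then have [measurable]: "{y. t k / 2 < f y \<and> f y < 3 * t k} \<in> sets M" for k by simp
    have Gk_meas [measurable]: "Gk k \<in> borel_measurable M" for k unfolding Gk_def by measurable
    have hm: "h k \<in> borel_measurable M" for k unfolding h_def by measurable
    have h0: "0 \<le> h k y \<and> h k y \<le> t k" for k y using tpos[of k] by (auto simp: h_def)
    have hc: "continuous_on \<Omega> (h k)" for k unfolding h_def by (intro continuous_intros f(3))
    have wug: "weak_upper_gradient M \<Omega> (\<lambda>y. ereal (h k y)) (Gk k)" for k
      using truncation_gradient[OF \<Omega> f(3) loc tpos, of k]
      by (intro local_lipschitz_gradient_weak_upper_gradient measurable_restrict_space1 Gk_meas)
        (simp add: h_def[abs_def] Gk_def[abs_def])
    define I where "I k = (\<integral>\<^sup>+y\<in>B1. Gk k y \<partial>M)" for k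
    have IN: "I k \<le> ennreal N" for k
    proof -
      have "I k \<le> (\<integral>\<^sup>+y\<in>B1. G y \<partial>M)"
        unfolding I_def Gk_def by (intro nn_integral_mono) (auto simp: indicator_def)
      then show ?thesis using GN by (rule order.trans)
    qed
    have Isum: "(\<Sum>k. I k) \<le> ennreal (3 * N)"
    proof -
      have "(\<Sum>k. I k) = (\<integral>\<^sup>+y. (\<Sum>k. Gk k y * indicator B1 y) \<partial>M)"
        unfolding I_def by (rule nn_integral_suminf[symmetric]) measurable
      also have "\<dots> \<le> (\<integral>\<^sup>+y. 3 * (G y * indicator B1 y) \<partial>M)"
      proof (rule nn_integral_mono)
        fix y
        have "(\<Sum>k. Gk k y * indicator B1 y) =
           (\<Sum>k. (G y * indicator B1 y) * indicator {y. t1 * 2 ^ k / 2 < f y \<and> f y < 3 * (t1 * 2 ^ k)} y)"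
          by (simp add: Gk_def t_def ac_simps)
        also have "\<dots> = (G y * indicator B1 y) * (\<Sum>k. indicator {y. t1 * 2 ^ k / 2 < f y \<and> f y < 3 *
           (t1 * 2 ^ k)} y)"
          by (rule ennreal_suminf_cmult)
        also have "\<dots> \<le> (G y * indicator B1 y) * 3"
          using t1(1) by (intro mult_left_mono sum_truncation_indicators_le) auto
        finally show "(\<Sum>k. Gk k y * indicator B1 y) \<le> 3 * (G y * indicator B1 y)" by (simp add: mult.commute)
      qed
      also have "\<dots> = 3 * (\<integral>\<^sup>+y\<in>B1. G y \<partial>M)" by (rule nn_integral_cmult) measurable
      also have "\<dots> \<le> 3 * ennreal N" using GN by (rule mult_left_mono) simp
      also have "\<dots> = ennreal (3 * N)" using AN by (simp add: ennreal_mult)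
      finally show ?thesis .
    qed
    \<comment> \<open>The weak type estimate needs a strictly positive mass bound; the added
      geometric sequence provides it without destroying summability.\<close>
    define Nk where "Nk k = enn2real (I k) + (1/2) ^ k" for k
    have Ik: "I k = ennreal (enn2real (I k))" for k using IN[of k] by (cases "I k") (auto simp: top_unique)
    have In: "enn2real (I k) \<le> N" for k using IN[of k] AN by (metis Ik ennreal_le_iff)
    have half: "(1/2) ^ k \<le> (1::real)" for k by (simp add: power_le_one)
    have Nk: "0 < Nk k" "Nk k \<le> N + 1" "I k \<le> ennreal (Nk k)" for k
    proof -
      show "0 < Nk k" unfolding Nk_def by (intro add_nonneg_pos) auto
      show "Nk k \<le> N + 1" using In[of k] half[of k] by (simp add: Nk_def)
      show "I k \<le> ennreal (Nk k)" by (subst Ik) (auto simp: Nk_def intro!: ennreal_leI)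
    qed
    have Nk_sum: "(\<Sum>k. ennreal (Nk k)) \<le> ennreal (3 * N + 2)"
    proof -
      have "(\<Sum>k. ennreal (Nk k)) = (\<Sum>k. I k + ennreal ((1/2) ^ k))"
      proof (rule suminf_cong)
        fix k show "ennreal (Nk k) = I k + ennreal ((1/2) ^ k)"
          unfolding Nk_def by (subst (2) Ik) (simp add: ennreal_plus)
      qed
      also have "\<dots> = (\<Sum>k. I k) + (\<Sum>k. ennreal ((1/2) ^ k))" by (rule suminf_add[symmetric]) auto
      also have "(\<Sum>k. ennreal ((1/2) ^ k)) = ennreal 2"
        by (subst suminf_ennreal2) (auto simp: suminf_geometric)
      also have "(\<Sum>k. I k) + ennreal 2 \<le> ennreal (3 * N) + ennreal 2" using Isum by (rule add_right_mono)
      also have "\<dots> = ennreal (3 * N + 2)" using AN by (simp add: ennreal_plus)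
      finally show ?thesis .
    qed
    define E where "E k = {x \<in> cball x0 R. h k x = t k}" for k
    have E_meas [measurable]: "E k \<in> sets M" for k
    proof -
      have v: "h k -` {t k} \<in> sets M" using measurable_sets[OF hm[of k], of "{t k}"] by simp
      have "E k = cball x0 R \<inter> h k -` {t k}" by (auto simp: E_def)
      then show ?thesis using sets.Int[OF closed_in_sets[OF closed_cball] v] by simp
    qed
    have weak: "emeasure M (E k) \<le> ennreal (K1 * (Nk k / t k) powr q)" for k
      unfolding E_def K1_def q_def
    proof (rule weak_type[OF \<Omega> R B m0 lower hm h0 hc tpos wug])
      show "0 < Nk k" by (rule Nk)
      show "(\<integral>\<^sup>+y\<in>ball x0 ((1 + 2 * \<Lambda>) * R). Gk k y \<partial>M) \<le> ennreal (Nk k)" using Nk(3)[of k]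
        by (simp add: I_def B1_def)
      have "weak_threshold R m0 * Nk k \<le> c1 * (N + 1)" unfolding c1_def[symmetric] using Nk(2)[of k] c1
        by (intro mult_left_mono) auto
      then show "weak_threshold R m0 * Nk k \<le> t k" using t1(3) tk[of k] by linarith
      fix x assume x: "x \<in> cball x0 R"
      have sub: "ball x R \<subseteq> B1"
      proof
        fix y assume y: "y \<in> ball x R"
        have "R + R \<le> (1 + 2 * \<Lambda>) * R" using R \<Lambda>_ge_1 by (simp add: distrib_right)
        then show "y \<in> B1" using x y dist_triangle[of x0 y x] by (auto simp: B1_def)
      qed
      have V: "vol x R > 0" by (rule vol_pos[OF R])
      have "ennreal \<bar>mean (h k) x R - 0\<bar> \<le> ennreal (1 / vol x R) * (\<integral>\<^sup>+y\<in>ball x R. ennreal \<bar>h k y - 0\<bar> \<partial>M)"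
        by (rule abs_mean_diff_const_le[OF R set_integrable_bounded[OF hm h0]])
      also have "(\<integral>\<^sup>+y\<in>ball x R. ennreal \<bar>h k y - 0\<bar> \<partial>M) \<le> (\<integral>\<^sup>+y\<in>B1. ennreal (f y) \<partial>M)"
      proof (intro nn_integral_mono mult_mono)
        fix y
        have "\<bar>h k y - 0\<bar> \<le> f y" using f(2)[of y] tpos[of k] by (auto simp: h_def)
        then show "ennreal \<bar>h k y - 0\<bar> \<le> ennreal (f y)" by (rule ennreal_leI)
        show "indicator (ball x R) y \<le> (indicator B1 y :: ennreal)" using sub by (auto simp: indicator_def)
      qed auto
      also have "\<dots> \<le> ennreal A" by (rule fA)
      finally have "ennreal \<bar>mean (h k) x R - 0\<bar> \<le> ennreal (1 / vol x R) * ennreal A"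
        by (simp add: mult_left_mono)
      also have "\<dots> = ennreal (A / vol x R)" using AN V by (simp flip: ennreal_mult'')
      finally have "mean (h k) x R \<le> A / vol x R" using AN V by (simp add: ennreal_le_iff)
      also have "\<dots> \<le> A / m0" using m0_le[OF x] m0 AN by (intro divide_left_mono) auto
      also have "\<dots> \<le> t k / 2" using t1(2) tk[of k] by linarith
      finally show "mean (h k) x R \<le> t k / 2" .
    qed
    \<comment> \<open>Values below 2 t1 are bounded crudely. A larger value lies between 2 t_k and 4
      t_k for some k, and there the k-th truncation attains its maximum t_k.\<close>
    have pt: "ennreal (f y powr q) * indicator (ball x0 R) y \<le>
        ennreal ((2 * t1) powr q) * indicator (ball x0 R) y + (\<Sum>k. ennreal ((4 * t k) powr q) * indicator
          (E k) y)" for y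
    proof (cases "y \<in> ball x0 R")
      case True
      show ?thesis
      proof (cases "f y < 2 * t1")
        case small: True
        have "f y powr q \<le> (2 * t1) powr q" using small f(2)[of y] q by (intro powr_mono2) auto
        then show ?thesis using True by (auto intro!: add_increasing2 ennreal_leI)
      next
        case False
        then have "1 \<le> f y / (2 * t1)" using t1 by simp
        from ex_power_between[OF _ this, of 2] obtain k where k: "2 ^ k \<le>
           f y / (2 * t1)" "f y / (2 * t1) < 2 ^ Suc k" by auto
        have k': "2 * t k \<le> f y" "f y \<le> 4 * t k" using k t1 by (auto simp: t_def field_simps)
        have "y \<in> E k" using True k'(1) tpos[of k] by (auto simp: E_def h_def)
        have "ennreal (f y powr q) \<le> ennreal ((4 * t k) powr q) * indicator (E k) y"
          using \<open>y \<in> E k\<close> k' f(2)[of y] q by (auto intro!: ennreal_leI powr_mono2)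
        also have "\<dots> \<le> (\<Sum>j. ennreal ((4 * t j) powr q) * indicator (E j) y)"
        proof -
          define F where "F j = ennreal ((4 * t j) powr q) * indicator (E j) y" for j
          have "F k \<le> (\<Sum>j. F j)" using sum_le_suminf[of F "{k}"] by simp
          then show ?thesis unfolding F_def .
        qed
        finally show ?thesis using True by (auto intro: add_increasing)
      qed
    qed simp
    have "(\<integral>\<^sup>+y\<in>ball x0 R. ennreal (f y powr q) \<partial>M) \<le>
      (\<integral>\<^sup>+y. ennreal ((2 * t1) powr q) * indicator (ball x0 R) y + (\<Sum>k. ennreal ((4 * t k) powr q) * indicator
        (E k) y) \<partial>M)"
      by (rule nn_integral_mono[OF pt])
    also have "\<dots> = ennreal ((2 * t1) powr q) * ennreal (vol x0 R) + (\<Sum>k. ennreal ((4 * t k) powr q) *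
       emeasure M (E k))"
      by (subst nn_integral_add, measurable, subst nn_integral_suminf, measurable)
        (simp add: nn_integral_cmult_indicator emeasure_ball)
    also have "\<dots> \<le>
       ennreal ((2 * t1) powr q * vol x0 R) + (\<Sum>k. ennreal (4 powr q * K1 * (N + 1) powr (q - 1)) * ennreal
      (Nk k))"
    proof (intro add_mono suminf_le)
      show "ennreal ((2 * t1) powr q) * ennreal (vol x0 R) \<le> ennreal ((2 * t1) powr q * vol x0 R)"
        by (simp add: ennreal_mult)
      fix k
      have "ennreal ((4 * t k) powr q) * emeasure M (E k) \<le>
         ennreal ((4 * t k) powr q) * ennreal (K1 * (Nk k / t k) powr q)"
        by (intro mult_left_mono weak) simp
      also have "\<dots> = ennreal ((4 * t k) powr q * (K1 * (Nk k / t k) powr q))" using K1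
        by (intro ennreal_mult''[symmetric]) simp
      \<comment> \<open>The level cancels because the weak type exponent equals q. As q > 1, all but
        one power of \<open>Nk k\<close> can be bounded by a power of N + 1, which leaves a series
        linear in the gradient masses.\<close>
      also have "(4 * t k) powr q * (K1 * (Nk k / t k) powr q) = 4 powr q * K1 * (Nk k powr (q - 1) * Nk k)"
      proof -
        have "(4 * t k) powr q * (Nk k / t k) powr q = (4 * Nk k) powr q"
          using tpos[of k] Nk(1)[of k] by (subst powr_mult[symmetric]) auto
        also have "\<dots> = 4 powr q * Nk k powr q" using Nk(1)[of k] by (simp add: powr_mult)
        also have "Nk k powr q = Nk k powr (q - 1) * Nk k" using Nk(1)[of k] powr_mult_base[of "Nk k" "q - 1"]
          by (simp add: mult.commute)
        finally show ?thesis by (simp add: ac_simps)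
      qed
      also have "ennreal (4 powr q * K1 * (Nk k powr (q - 1) * Nk k)) \<le>
         ennreal (4 powr q * K1 * ((N + 1) powr (q - 1) * Nk k))"
        using Nk(1)[of k] Nk(2)[of k] K1 q
          by (intro ennreal_leI mult_left_mono mult_right_mono powr_mono2) auto
      also have "\<dots> = ennreal (4 powr q * K1 * (N + 1) powr (q - 1)) * ennreal (Nk k)"
        unfolding mult.assoc[symmetric] using Nk(1)[of k] by (intro ennreal_mult'') simp
      finally show "ennreal ((4 * t k) powr q) * emeasure M (E k) \<le>
         ennreal (4 powr q * K1 * (N + 1) powr (q - 1)) * ennreal (Nk k)" .
    qed auto
    also have "(\<Sum>k. ennreal (4 powr q * K1 * (N + 1) powr (q - 1)) * ennreal (Nk k)) =
       ennreal (4 powr q * K1 * (N + 1) powr (q - 1)) * (\<Sum>k. ennreal (Nk k))"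
      by (rule ennreal_suminf_cmult)
    also have "\<dots> \<le> ennreal (4 powr q * K1 * (N + 1) powr (q - 1)) * ennreal (3 * N + 2)"
      by (rule mult_left_mono[OF Nk_sum]) simp
    also have "\<dots> = ennreal (4 powr q * K1 * (N + 1) powr (q - 1) * (3 * N + 2))"
      using AN by (intro ennreal_mult''[symmetric]) simp
    also have "ennreal ((2 * t1) powr q * vol x0 R) + ennreal (4 powr q * K1 * (N + 1) powr (q - 1) *
       (3 * N + 2)) = ennreal K"
      unfolding K_def using K1 AN by (intro ennreal_plus[symmetric]) auto
    finally show ?thesis by (simp add: add_left_mono)
  qed
  show ?thesis
    unfolding q_def[symmetric] B1_def[symmetric] using main by (intro exI[of _ K]) blast
qed

end

subsection \<open>Integrability of BV functions\<close>

text \<open>Local constants cannot be chained without connecting paths. Pairs closer than a Lebesgue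
  number lie in one neighbourhood; for the others boundedness of \<open>f\<close> divided by the
  Lebesgue number is a Lipschitz constant.\<close>

lemma lipschitz_on_compact:
  fixes f :: "'a::metric_space \<Rightarrow> real"
  assumes K: "compact K" "K \<subseteq> H"
    and loc: "\<And>x. x \<in> H \<Longrightarrow> \<exists>U L. open U \<and> x \<in> U \<and> (\<forall>z\<in>U \<inter> H. \<forall>w\<in>U \<inter> H. \<bar>f z - f w\<bar> \<le> L * dist z w)"
    and cont: "continuous_on K f"
  shows "\<exists>L. L-lipschitz_on K f"
proof -
  define P where "P x U L \<longleftrightarrow> open U \<and> x \<in> U \<and> (\<forall>z\<in>U \<inter> H. \<forall>w\<in>U \<inter> H. \<bar>f z - f w\<bar> \<le> L * dist z w)" for x U L
  have "\<forall>x\<in>H. \<exists>U L. P x U L" using loc unfolding P_def by blast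
  then obtain U L where P: "\<And>x. x \<in> H \<Longrightarrow> P x (U x) (L x)" by metis
  then have UL: "open (U x) \<and> x \<in> U x \<and> (\<forall>z\<in>U x \<inter> H. \<forall>w\<in>U x \<inter> H. \<bar>f z - f w\<bar> \<le> L x * dist z w)" if "x \<in> H"
    for x
    using that unfolding P_def by blast
  have UK: "open (U x)" "x \<in> U x" if "x \<in> K" for x using UL[of x] that K(2) by blast+
  then have "K \<subseteq> (\<Union>x\<in>K. U x)" by blast
  then obtain I where I: "I \<subseteq> K" "finite I" "K \<subseteq> (\<Union>x\<in>I. U x)"
    using compactE_image[OF K(1), of K U] UK(1) by metis
  obtain \<epsilon> where \<epsilon>: "0 < \<epsilon>" "\<And>x. x \<in> K \<Longrightarrow> \<exists>G\<in>U ` I. ball x \<epsilon> \<subseteq> G"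
    by (rule Heine_Borel_lemma[OF K(1), of "U ` I"]) (use I UK(1) in auto)
  have "bounded (f ` K)" using compact_continuous_image[OF cont K(1)] by (rule compact_imp_bounded)
  then obtain b where b: "\<And>x. x \<in> K \<Longrightarrow> \<bar>f x\<bar> \<le> b" unfolding bounded_iff by auto
  define B where "B = max b 0"
  have B: "B \<ge> 0" "\<And>x. x \<in> K \<Longrightarrow> \<bar>f x\<bar> \<le> B" using b by (auto simp: B_def max.coboundedI1)
  define L' where "L' = Max (insert (2 * B / \<epsilon>) (L ` I))"
  have L'1: "2 * B / \<epsilon> \<le> L'" unfolding L'_def using I(2) by (intro Max_ge) auto
  have L'2: "L i \<le> L'" if "i \<in> I" for i unfolding L'_def using I(2) that by (intro Max_ge) auto
  have L'0: "0 \<le> L'" using L'1 B(1) \<epsilon>(1)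
    by (meson divide_nonneg_pos mult_nonneg_nonneg order.trans zero_le_numeral)
  have "L'-lipschitz_on K f"
  proof (rule lipschitz_onI[OF _ L'0])
    fix x y assume xy: "x \<in> K" "y \<in> K"
    show "dist (f x) (f y) \<le> L' * dist x y"
    proof (cases "dist x y < \<epsilon>")
      case True
      obtain i where i: "i \<in> I" "ball x \<epsilon> \<subseteq> U i" using \<epsilon>(2)[OF xy(1)] by blast
      have "x \<in> U i" "y \<in> U i" using i(2) True \<epsilon>(1) by auto
      moreover have "i \<in> H" "x \<in> H" "y \<in> H" using i(1) I(1) K(2) xy by auto
      ultimately have "\<bar>f x - f y\<bar> \<le> L i * dist x y" using UL[of i] by auto
      also have "\<dots> \<le> L' * dist x y" using L'2[OF i(1)] by (intro mult_right_mono) auto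
      finally show ?thesis by (simp add: dist_real_def)
    next
      case False
      have "\<bar>f x - f y\<bar> \<le> 2 * B" using B(2)[OF xy(1)] B(2)[OF xy(2)] by linarith
      also have "\<dots> = 2 * B / \<epsilon> * \<epsilon>" using \<epsilon>(1) by simp
      also have "\<dots> \<le> L' * dist x y" using L'1 L'0 False \<epsilon>(1) by (intro mult_mono) auto
      finally show ?thesis by (simp add: dist_real_def)
    qed
  qed
  then show ?thesis by blast
qed

lemma local_lipschitz_gradient_cong:
  assumes "local_lipschitz_gradient H f G" "\<And>z w. z \<in> H \<Longrightarrow> w \<in> H \<Longrightarrow> \<bar>g z - g w\<bar> \<le> \<bar>f z - f w\<bar>"
  shows "local_lipschitz_gradient H g G"
  unfolding local_lipschitz_gradient_def
proof
  fix x assume "x \<in> H"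
  then obtain U where U: "open U" "x \<in> U"
    "\<forall>y\<in>U \<inter> H. \<forall>z\<in>U \<inter> H. \<forall>w\<in>U \<inter> H. ennreal \<bar>f z - f w\<bar> \<le> G y * ennreal (dist z w)"
    using bspec[OF assms(1)[unfolded local_lipschitz_gradient_def] \<open>x \<in> H\<close>] by (elim exE conjE)
  have "ennreal \<bar>g z - g w\<bar> \<le> G y * ennreal (dist z w)" if "y \<in> U \<inter> H" "z \<in> U \<inter> H" "w \<in> U \<inter> H" for y z w
  proof -
    have "ennreal \<bar>g z - g w\<bar> \<le> ennreal \<bar>f z - f w\<bar>" using that assms(2) by (intro ennreal_leI) auto
    also have "\<dots> \<le> G y * ennreal (dist z w)" using U(3) that by blast
    finally show ?thesis .
  qed
  then show "\<exists>U. open U \<and> x \<in> U \<and> (\<forall>y\<in>U \<inter> H. \<forall>z\<in>U \<inter> H. \<forall>w\<in>U \<inter> H. ennreal \<bar>g z - g w\<bar> \<le>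
     G y * ennreal (dist z w))"
    using U(1,2) by (intro exI[of _ U] conjI ballI)
qed

lemma local_lipschitz_gradient_finite:
  assumes "local_lipschitz_gradient H f G" "x \<in> H" "G x < \<infinity>"
  shows "\<exists>U L. open U \<and> x \<in> U \<and> (\<forall>z\<in>U \<inter> H. \<forall>w\<in>U \<inter> H. \<bar>f z - f w\<bar> \<le> L * dist z w)"
proof -
  obtain U where U: "open U" "x \<in> U"
    "\<forall>y\<in>U \<inter> H. \<forall>z\<in>U \<inter> H. \<forall>w\<in>U \<inter> H. ennreal \<bar>f z - f w\<bar> \<le> G y * ennreal (dist z w)"
    using bspec[OF assms(1)[unfolded local_lipschitz_gradient_def] assms(2)] by (elim exE conjE)
  obtain L where L: "G x = ennreal L" "0 \<le> L" using assms(3) by (cases "G x") auto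
  have "\<bar>f z - f w\<bar> \<le> L * dist z w" if "z \<in> U \<inter> H" "w \<in> U \<inter> H" for z w
  proof -
    have "x \<in> U \<inter> H" using U(2) assms(2) by blast
    then have "ennreal \<bar>f z - f w\<bar> \<le> G x * ennreal (dist z w)" using U(3) that by blast
    then have "ennreal \<bar>f z - f w\<bar> \<le> ennreal (L * dist z w)" unfolding L(1) by (simp add: ennreal_mult'')
    then show ?thesis using L(2) by (subst (asm) ennreal_le_iff) auto
  qed
  then show ?thesis using U(1,2) by (intro exI[of _ U] exI[of _ L] conjI ballI)
qed

lemma local_lipschitz_gradient_continuous:
  assumes loc: "local_lipschitz_gradient H f G" and fin: "\<And>x. x \<in> H \<Longrightarrow> G x < \<infinity>"
  shows "continuous_on H f"
  unfolding continuous_on_iff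
proof (intro ballI allI impI)
  fix x and e :: real assume x: "x \<in> H" and e: "0 < e"
  obtain U L where U: "open U" "x \<in> U" and L: "\<forall>z\<in>U \<inter> H. \<forall>w\<in>U \<inter> H. \<bar>f z - f w\<bar> \<le> L * dist z w"
    using local_lipschitz_gradient_finite[OF loc x fin[OF x]] by blast
  obtain d where d: "d > 0" "ball x d \<subseteq> U" using U open_contains_ball by meson
  define D where "D = min d (e / (\<bar>L\<bar> + 1))"
  show "\<exists>d>0. \<forall>x'\<in>H. dist x' x < d \<longrightarrow> dist (f x') (f x) < e"
  proof (intro exI conjI ballI impI)
    show "D > 0" using d e by (auto simp: D_def)
    fix y assume y: "y \<in> H" "dist y x < D"
    have "y \<in> U" using y d by (auto simp: D_def dist_commute)
    then have "\<bar>f y - f x\<bar> \<le> L * dist y x" using L U(2) x y(1) by blast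
    also have "\<dots> \<le> (\<bar>L\<bar> + 1) * dist y x" by (intro mult_right_mono) auto
    also have "\<dots> < (\<bar>L\<bar> + 1) * (e / (\<bar>L\<bar> + 1))" using y by (intro mult_strict_left_mono) (auto simp: D_def)
    also have "\<dots> = e" by (simp add: add_nonneg_eq_0_iff)
    finally show "dist (f y) (f x) < e" by (simp add: dist_real_def)
  qed
qed

lemma powr_add3_le:
  fixes a b c q :: real
  assumes "0 \<le> a" "0 \<le> b" "0 \<le> c" "0 < q"
  shows "(a + b + c) powr q \<le> 3 powr q * (a powr q + b powr q + c powr q)"
proof -
  define m where "m = max a (max b c)"
  have m: "m \<ge> 0" "a + b + c \<le> 3 * m" using assms by (auto simp: m_def)
  have "(a + b + c) powr q \<le> (3 * m) powr q" using assms m by (intro powr_mono2) auto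
  also have "\<dots> = 3 powr q * m powr q" using m by (simp add: powr_mult)
  also have "m powr q \<le> a powr q + b powr q + c powr q" unfolding m_def by (auto simp: max_def)
  finally show ?thesis by (simp add: mult_left_mono)
qed

section \<open>Scales with prescribed smallness and measurability of convolutions\<close>

context poincare_space
begin

text \<open>An infimal convolution: the largest c-Lipschitz function that stays below the step
  function y \<mapsto> hk (\<phi> y) on \<Omega>. It is positive because nearby points have bounded
  shell index and hence a positive minimum of \<open>hk\<close>, while distant points pay the cost c
  times the distance.\<close>

lemma ex_admissible:
  fixes p :: 'a
  assumes \<Omega>: "open \<Omega>" "\<Omega> \<noteq> {}" and r: "\<And>k. 0 < r k"
  shows "\<exists>\<rho>. admissible \<Omega> \<rho> \<and> (\<forall>k. \<forall>x\<in>exhaustion \<Omega> p k. (\<forall>j<k. x \<notin> exhaustion \<Omega> p j) \<longrightarrow> \<rho> x \<le> r k)"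
proof -
  define c where "c = 1 / (16 * \<Lambda>)"
  have c: "c > 0" using \<Lambda>_ge_1 by (simp add: c_def)
  define \<phi> where "\<phi> x = (LEAST k. x \<in> exhaustion \<Omega> p k)" for x
  \<comment> \<open>The second bound keeps 16 \<Lambda> \<rho> x within the distance 2^-k that
    points of the k-th set have from the complement.\<close>
  define hk where "hk k = min (r k) (c / 2 ^ k)" for k :: nat
  have hk: "0 < hk k" for k using r[of k] c by (simp add: hk_def)
  have ex: "\<exists>k. x \<in> exhaustion \<Omega> p k" if x: "x \<in> \<Omega>" for x
  proof -
    obtain \<delta> n where "0 < \<delta>" "ball x \<delta> \<subseteq> exhaustion \<Omega> p n" using exhaustion_ball[OF \<Omega>(1) x] by blast
    then show ?thesis by (metis centre_in_ball subsetD)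
  qed
  have \<phi>: "x \<in> exhaustion \<Omega> p (\<phi> x)" if "x \<in> \<Omega>" for x unfolding \<phi>_def using ex[OF that] by (rule LeastI_ex)
  define F where "F x y = hk (\<phi> y) + c * dist x y" for x y
  define \<rho> where "\<rho> x = (INF y\<in>\<Omega>. F x y)" for x
  have bdd: "bdd_below (F x ` \<Omega>)" for x
  proof (rule bdd_belowI2[of _ 0])
    fix y show "0 \<le> F x y"
      using less_imp_le[OF hk[of "\<phi> y"]] mult_nonneg_nonneg[OF less_imp_le[OF c] zero_le_dist[of x y]]
      unfolding F_def by linarith
  qed
  have lip: "\<rho> x \<le> \<rho> y + c * dist x y" for x y
  proof -
    have "\<rho> x - c * dist x y \<le> \<rho> y"
      unfolding \<rho>_def[of y]
    proof (rule cINF_greatest[OF \<Omega>(2)])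
      fix z assume "z \<in> \<Omega>"
      then have "\<rho> x \<le> F x z" unfolding \<rho>_def by (intro cINF_lower bdd)
      also have "\<dots> \<le> F y z + c * dist x y"
        unfolding F_def using c dist_triangle[of x z y] by (simp flip: distrib_left)
      finally show "\<rho> x - c * dist x y \<le> F y z" by simp
    qed
    then show ?thesis by simp
  qed
  have le_hk: "\<rho> x \<le> hk (\<phi> x)" if "x \<in> \<Omega>" for x
  proof -
    have "\<rho> x \<le> F x x" unfolding \<rho>_def using that by (intro cINF_lower bdd)
    then show ?thesis by (simp add: F_def)
  qed
  have pos: "0 < \<rho> x" if x: "x \<in> \<Omega>" for x
  proof -
    obtain \<delta> n where \<delta>: "0 < \<delta>" "ball x \<delta> \<subseteq> exhaustion \<Omega> p n" using exhaustion_ball[OF \<Omega>(1) x] by blast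
    define e where "e = min (c * \<delta>) (Min (hk ` {..n}))"
    have "0 < Min (hk ` {..n})" using hk by (subst Min_gr_iff) auto
    then have e: "0 < e" using c \<delta> by (simp add: e_def)
    have "e \<le> \<rho> x"
      unfolding \<rho>_def
    proof (rule cINF_greatest[OF \<Omega>(2)])
      fix y assume y: "y \<in> \<Omega>"
      show "e \<le> F x y"
      proof (cases "dist x y < \<delta>")
        case True
        then have "y \<in> exhaustion \<Omega> p n" using \<delta> by auto
        then have "\<phi> y \<le> n" unfolding \<phi>_def by (rule Least_le)
        then have "Min (hk ` {..n}) \<le> hk (\<phi> y)" by (intro Min_le) auto
        moreover have "0 \<le> c * dist x y" using c by simp
        ultimately show ?thesis unfolding F_def e_def by linarith
      next
        case False
        then have "c * \<delta> \<le> c * dist x y" using c by (intro mult_left_mono) auto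
        then show ?thesis using hk[of "\<phi> y"] unfolding F_def e_def by linarith
      qed
    qed
    then show ?thesis using e by linarith
  qed
  have "admissible \<Omega> \<rho>"
    unfolding admissible_def
  proof (intro conjI allI ballI)
    fix x y
    show "\<bar>\<rho> x - \<rho> y\<bar> \<le> dist x y / (16 * \<Lambda>)"
      using lip[of x y] lip[of y x] by (auto simp: c_def dist_commute abs_le_iff)
  next
    fix x assume x: "x \<in> \<Omega>"
    show "0 < \<rho> x" by (rule pos[OF x])
    show "ball x (16 * \<Lambda> * \<rho> x) \<subseteq> \<Omega>"
    proof (rule ccontr)
      assume "\<not> ball x (16 * \<Lambda> * \<rho> x) \<subseteq> \<Omega>"
      then obtain z where "z \<in> ball x (16 * \<Lambda> * \<rho> x)" and z: "z \<notin> \<Omega>" by blast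
      then have xz: "dist x z < 16 * \<Lambda> * \<rho> x" by simp
      have "1 / 2 ^ \<phi> x \<le> dist x z" using \<phi>[OF x] z by (simp add: exhaustion_def)
      moreover have "\<rho> x \<le> c / 2 ^ \<phi> x" using le_hk[OF x] by (simp add: hk_def)
      then have "16 * \<Lambda> * \<rho> x \<le> 1 / 2 ^ \<phi> x" using \<Lambda>_ge_1 by (simp add: c_def field_simps)
      ultimately show False using xz by linarith
    qed
  qed
  moreover have "\<rho> x \<le> r k" if x: "x \<in> exhaustion \<Omega> p k" "\<forall>j<k. x \<notin> exhaustion \<Omega> p j" for x k
  proof -
    have "x \<in> \<Omega>" using x exhaustion_subset by blast
    have "\<phi> x = k" unfolding \<phi>_def using x by (intro Least_equality) (auto simp: not_less[symmetric])
    then show ?thesis using le_hk[OF \<open>x \<in> \<Omega>\<close>] by (simp add: hk_def)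
  qed
  ultimately show ?thesis by blast
qed

lemma kern_measurable_pair:
  assumes "\<rho> \<in> borel_measurable M"
  shows "(\<lambda>w. kern (\<rho> (fst w)) (fst w) (snd w)) \<in> borel_measurable (M \<Otimes>\<^sub>M M)"
  unfolding kern_def
  by (intro borel_measurable_max borel_measurable_diff measurable_compose[OF measurable_fst assms]
      dist_measurable measurable_fst measurable_snd borel_measurable_const)

lemma mass_measurable:
  assumes "\<rho> \<in> borel_measurable M"
  shows "(\<lambda>x. mass (\<rho> x) x) \<in> borel_measurable M"
  unfolding mass_def
  using borel_measurable_lebesgue_integral[of "\<lambda>x y. kern (\<rho> x) x y" M] kern_measurable_pair[OF assms]
  by (simp add: case_prod_beta')

lemma kavg_measurable_pair:
  assumes \<rho>: "\<rho> \<in> borel_measurable M" and h: "case_prod h \<in> borel_measurable (M \<Otimes>\<^sub>M M)"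
  shows "(\<lambda>x. kavg (\<rho> x) (h x) x) \<in> borel_measurable M"
proof -
  have h': "(\<lambda>w. h (fst w) (snd w)) \<in> borel_measurable (M \<Otimes>\<^sub>M M)" using h by (simp add: case_prod_beta')
  have "(\<lambda>w. ennreal (kern (\<rho> (fst w)) (fst w) (snd w) / mass (\<rho> (fst w)) (fst w)) *
     h (fst w) (snd w)) \<in> borel_measurable (M \<Otimes>\<^sub>M M)"
    by (intro borel_measurable_times_ennreal h' measurable_compose[OF _ measurable_ennreal]
      borel_measurable_divide
        kern_measurable_pair[OF \<rho>] measurable_compose[OF measurable_fst mass_measurable[OF \<rho>]])
  from borel_measurable_nn_integral_fst[OF this] show ?thesis unfolding kavg_def by simp
qed

lemma conv_diff:
  assumes "0 < r" "integrable M f" "integrable M g"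
  shows "conv r (\<lambda>y. f y - g y) x = conv r f x - conv r g x"
  unfolding conv_def right_diff_distrib
  using kern_mult_integrable[OF assms(1,2), of x] kern_mult_integrable[OF assms(1,3), of x]
  by (simp add: diff_divide_distrib)

lemma conv_continuous_on:
  assumes "admissible \<Omega> \<rho>" "open \<Omega>" "integrable M u"
  shows "continuous_on \<Omega> (\<lambda>x. conv (\<rho> x) u x)"
  by (rule local_lipschitz_gradient_continuous[OF conv_gradient[OF assms]])
    (simp add: osc_eq[OF assms(3)] ennreal_mult_less_top)

lemma continuous_on_measurable_restrict:
  fixes f :: "'a \<Rightarrow> real"
  assumes "open \<Omega>" "continuous_on \<Omega> f"
  shows "(\<lambda>x. indicator \<Omega> x * f x) \<in> borel_measurable M"
  using borel_measurable_continuous_on_indicator[of \<Omega> f] assms by (intro borel_measurable_M) auto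

end

text \<open>The assumption \<open>variation\<close>, uniform over all scales, is all that is
  retained of the total variation and the approximating sequence. The function \<open>u\<close> will
  be instantiated with a real-valued zero extension.\<close>

locale bv_space = sobolev_space M C CP \<Lambda> s for M :: "'a::complete_space measure" and C CP \<Lambda> s +
  fixes \<Omega> :: "'a set" and u :: "'a \<Rightarrow> real" and V :: real
  assumes \<Omega>: "open \<Omega>" "\<Omega> \<noteq> {}" and u: "integrable M u" and V: "0 \<le> V"
    and variation: "admissible \<Omega> \<rho> \<Longrightarrow> (\<integral>\<^sup>+x\<in>\<Omega>. ennreal (1 / \<rho> x) * osc u x (4 * \<rho> x) \<partial>M) \<le> ennreal V"
begin

definition q :: real where "q = s / (s - 1)"

lemma q_gt_1: "1 < q" using s_gt_1 by (simp add: q_def field_simps)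

lemma \<Omega>_sets: "\<Omega> \<in> sets M" by (rule open_in_sets[OF \<Omega>(1)])

lemma u_measurable: "u \<in> borel_measurable M" using u by (rule borel_measurable_integrable)

definition grad :: "('a \<Rightarrow> real) \<Rightarrow> 'a \<Rightarrow> ennreal" where
  "grad \<rho> y = ennreal (24 * \<kappa> ^ 4) * (ennreal (1 / \<rho> y) * osc u y (4 * \<rho> y))"

lemma grad_measurable: "admissible \<Omega> \<rho> \<Longrightarrow> grad \<rho> \<in> borel_measurable M"
  unfolding grad_def using osc_measurable(1)[OF _ u_measurable, of
    "\<lambda>x. 4 * \<rho> x"] admissible_measurable[of \<Omega> \<rho>]
  by measurable

lemma grad_integral:
  assumes "admissible \<Omega> \<rho>"
  shows "(\<integral>\<^sup>+x\<in>\<Omega>. grad \<rho> x \<partial>M) \<le> ennreal (24 * \<kappa> ^ 4 * V)"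
proof -
  have m: "(\<lambda>x. ennreal (1 / \<rho> x) * osc u x (4 * \<rho> x) * indicator \<Omega> x) \<in> borel_measurable M"
    using osc_measurable(1)[OF _ u_measurable, of "\<lambda>x. 4 * \<rho> x"] admissible_measurable[OF assms] \<Omega>_sets
    by measurable
  have "(\<integral>\<^sup>+x\<in>\<Omega>. grad \<rho> x \<partial>M) = ennreal (24 * \<kappa> ^ 4) * (\<integral>\<^sup>+x\<in>\<Omega>. ennreal (1 / \<rho> x) * osc u x (4 * \<rho> x) \<partial>M)"
    unfolding grad_def using m by (subst nn_integral_cmult[symmetric]) (simp_all add: mult.assoc)
  also have "\<dots> \<le> ennreal (24 * \<kappa> ^ 4) * ennreal V" by (intro mult_left_mono variation assms) simp
  also have "\<dots> = ennreal (24 * \<kappa> ^ 4 * V)" using V by (intro ennreal_mult''[symmetric])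
  finally show ?thesis .
qed

lemma conv_grad: "admissible \<Omega> \<rho> \<Longrightarrow> local_lipschitz_gradient \<Omega> (\<lambda>x. conv (\<rho> x) u x) (grad \<rho>)"
  unfolding grad_def by (rule conv_gradient[OF _ \<Omega>(1) u])

lemma conv_integral:
  assumes "admissible \<Omega> \<rho>"
  shows "(\<integral>\<^sup>+x\<in>\<Omega>. ennreal \<bar>conv (\<rho> x) u x\<bar> \<partial>M) \<le> ennreal (2 * \<kappa> ^ 3 * (LINT y|M. \<bar>u y\<bar>))"
proof -
  have "(\<integral>\<^sup>+x\<in>\<Omega>. ennreal \<bar>conv (\<rho> x) u x\<bar> \<partial>M) \<le> (\<integral>\<^sup>+x\<in>\<Omega>. kavg (\<rho> x) (\<lambda>y. ennreal \<bar>u y\<bar>) x \<partial>M)"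
  proof (intro nn_integral_mono)
    fix x
    show "ennreal \<bar>conv (\<rho> x) u x\<bar> * indicator \<Omega> x \<le> kavg (\<rho> x) (\<lambda>y. ennreal \<bar>u y\<bar>) x * indicator \<Omega> x"
      using abs_conv_minus_const_le[OF admissible_pos[OF assms, of x] u, of x 0] by (cases "x \<in> \<Omega>") auto
  qed
  also have "\<dots> \<le> ennreal (2 * \<kappa> ^ 3) * (\<integral>\<^sup>+x\<in>UNIV. ennreal \<bar>u x\<bar> \<partial>M)"
  proof (rule kavg_integral_le[OF assms \<Omega>(1)])
    show "(\<lambda>y. ennreal \<bar>u y\<bar>) \<in> borel_measurable M" using u_measurable by measurable
    show "UNIV \<in> sets M" using sets.top[of M] by simp
  qed auto
  also have "(\<integral>\<^sup>+x\<in>UNIV. ennreal \<bar>u x\<bar> \<partial>M) = ennreal (LINT y|M. \<bar>u y\<bar>)"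
    using integrable_abs[OF u] by (simp add: nn_integral_eq_integral)
  also have "ennreal (2 * \<kappa> ^ 3) * ennreal (LINT y|M. \<bar>u y\<bar>) = ennreal (2 * \<kappa> ^ 3 * (LINT y|M. \<bar>u y\<bar>))"
    by (intro ennreal_mult''[symmetric] integral_nonneg_AE) auto
  finally show ?thesis .
qed

definition err_const :: real where "err_const = 2 * \<kappa>\<^sup>2 * (2 * \<kappa>\<^sup>2 + 1) * V"

lemma err_const_nonneg: "0 \<le> err_const" using V by (simp add: err_const_def)

text \<open>On \<open>S\<close> the weight satisfies 1 \<le> r / \<rho> x, so the weighted error
  bound turns into one that is linear in the largest scale \<open>r\<close>.\<close>

lemma kavg_error_integral:
  assumes adm: "admissible \<Omega> \<rho>" and S: "S \<subseteq> \<Omega>" "\<And>x. x \<in> S \<Longrightarrow> \<rho> x \<le> r" and r: "0 \<le> r"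
  shows "(\<integral>\<^sup>+x\<in>S. kavg (\<rho> x) (\<lambda>y. ennreal \<bar>u y - u x\<bar>) x \<partial>M) \<le> ennreal (r * err_const)"
proof -
  define k where "k x = kavg (\<rho> x) (\<lambda>y. ennreal \<bar>u y - u x\<bar>) x" for x
  have "(\<lambda>w. ennreal \<bar>u (snd w) - u (fst w)\<bar>) \<in> borel_measurable (M \<Otimes>\<^sub>M M)"
    by (intro measurable_compose[OF _ measurable_ennreal] borel_measurable_abs borel_measurable_diff
        measurable_compose[OF measurable_snd u_measurable] measurable_compose[OF measurable_fst u_measurable])
  then have km: "k \<in> borel_measurable M"
    unfolding k_def[abs_def] using admissible_measurable[OF adm]
    by (intro kavg_measurable_pair) (simp_all add: case_prod_beta')
  have m: "(\<lambda>x. ennreal (1 / \<rho> x) * k x * indicator \<Omega> x) \<in> borel_measurable M"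
    using km admissible_measurable[OF adm] \<Omega>_sets by measurable
  have "(\<integral>\<^sup>+x\<in>S. k x \<partial>M) \<le> (\<integral>\<^sup>+x. ennreal r * (ennreal (1 / \<rho> x) * k x * indicator \<Omega> x) \<partial>M)"
  proof (rule nn_integral_mono)
    fix x
    show "k x * indicator S x \<le> ennreal r * (ennreal (1 / \<rho> x) * k x * indicator \<Omega> x)"
    proof (cases "x \<in> S")
      case True
      then have x: "x \<in> \<Omega>" using S by blast
      have p: "0 < \<rho> x" using adm x by (rule admissible_pos)
      have "1 \<le> r * (1 / \<rho> x)" using S(2)[OF True] p by (simp add: field_simps)
      then have "ennreal 1 \<le> ennreal (r * (1 / \<rho> x))" by (rule ennreal_leI)
      also have "\<dots> = ennreal r * ennreal (1 / \<rho> x)" using p by (intro ennreal_mult'') simp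
      finally have "1 * k x \<le> (ennreal r * ennreal (1 / \<rho> x)) * k x" by (intro mult_right_mono) auto
      then show ?thesis using True x by (simp add: mult.assoc)
    qed simp
  qed
  also have "\<dots> = ennreal r * (\<integral>\<^sup>+x\<in>\<Omega>. ennreal (1 / \<rho> x) * k x \<partial>M)" by (rule nn_integral_cmult[OF m])
  also have "\<dots> \<le> ennreal r * (ennreal (2 * \<kappa>\<^sup>2 * (2 * \<kappa>\<^sup>2 + 1)) * ennreal V)"
  proof (rule mult_left_mono)
    have "(\<integral>\<^sup>+x\<in>\<Omega>. ennreal (1 / \<rho> x) * k x \<partial>M) \<le>
       ennreal (2 * \<kappa>\<^sup>2 * (2 * \<kappa>\<^sup>2 + 1)) * (\<integral>\<^sup>+x\<in>\<Omega>. ennreal (1 / \<rho> x) * osc u x (4 * \<rho> x) \<partial>M)"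
      unfolding k_def by (rule kavg_oscillation_integral_le[OF adm \<Omega>(1) u])
    also have "\<dots> \<le> ennreal (2 * \<kappa>\<^sup>2 * (2 * \<kappa>\<^sup>2 + 1)) * ennreal V" by (intro mult_left_mono variation adm) simp
    finally show "(\<integral>\<^sup>+x\<in>\<Omega>. ennreal (1 / \<rho> x) * k x \<partial>M) \<le> ennreal (2 * \<kappa>\<^sup>2 * (2 * \<kappa>\<^sup>2 + 1)) * ennreal V" .
  qed simp
  also have "\<dots> = ennreal (r * err_const)"
    unfolding err_const_def using V r by (subst ennreal_mult''[symmetric], simp)+ simp
  finally show ?thesis unfolding k_def .
qed

lemma conv_measurable:
  assumes "admissible \<Omega> \<rho>" "integrable M f"
  shows "(\<lambda>x. indicator \<Omega> x * conv (\<rho> x) f x) \<in> borel_measurable M"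
  by (rule continuous_on_measurable_restrict[OF \<Omega>(1) conv_continuous_on[OF assms(1) \<Omega>(1) assms(2)]])

text \<open>Convolutions at scales tending to 0 have L^1 norms and gradient integrals bounded
  independently of the scale, so the Sobolev inequality bounds their L^q norms by one constant
  \<open>K\<close>. They converge to \<open>u\<close> in L^1 on \<Omega>, and Fatou's lemma carries
  the bound over to \<open>u\<close>.\<close>

lemma powr_integrable_ball:
  assumes R: "0 < R" and B: "ball x0 ((1 + 2 * \<Lambda>) * R) \<subseteq> \<Omega>"
  shows "(\<integral>\<^sup>+y\<in>ball x0 R. ennreal (\<bar>u y\<bar> powr q) \<partial>M) < \<infinity>"
proof -
  fix p :: 'a
  define A where "A = 2 * \<kappa> ^ 3 * (LINT y|M. \<bar>u y\<bar>)"
  define N where "N = 24 * \<kappa> ^ 4 * V"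
  have A: "0 \<le> A" unfolding A_def using \<kappa>_ge_1 by (intro mult_nonneg_nonneg integral_nonneg_AE) auto
  have N: "0 \<le> N" unfolding N_def using \<kappa>_ge_1 V by simp
  obtain K where K: "\<And>f G. f \<in> borel_measurable M \<Longrightarrow> (\<forall>y. 0 \<le> f y) \<Longrightarrow> continuous_on \<Omega> f \<Longrightarrow>
     local_lipschitz_gradient \<Omega> f G \<Longrightarrow> G \<in> borel_measurable M \<Longrightarrow>
     (\<integral>\<^sup>+y\<in>ball x0 ((1 + 2 * \<Lambda>) * R). ennreal (f y) \<partial>M) \<le> ennreal A \<Longrightarrow>
     (\<integral>\<^sup>+y\<in>ball x0 ((1 + 2 * \<Lambda>) * R). G y \<partial>M) \<le> ennreal N \<Longrightarrow>
     (\<integral>\<^sup>+y\<in>ball x0 R. ennreal (f y powr (s / (s - 1))) \<partial>M) \<le> ennreal K"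
    using sobolev_ball[OF \<Omega>(1) R B A N] by blast
  have "\<forall>n. \<exists>\<rho>. admissible \<Omega> \<rho> \<and> (\<forall>x\<in>\<Omega>. \<rho> x \<le> 1 / real (Suc n))"
  proof
    fix n
    obtain \<rho> where \<rho>: "admissible \<Omega> \<rho>" "\<And>k x. x \<in> exhaustion \<Omega> p k \<Longrightarrow> (\<forall>j<k. x \<notin> exhaustion \<Omega> p j) \<Longrightarrow>
       \<rho> x \<le> 1 / real (Suc n)"
      using ex_admissible[OF \<Omega>, of "\<lambda>_. 1 / real (Suc n)" p] by auto
    have "\<rho> x \<le> 1 / real (Suc n)" if x: "x \<in> \<Omega>" for x
    proof -
      obtain \<delta> m where "0 < \<delta>" "ball x \<delta> \<subseteq> exhaustion \<Omega> p m" using exhaustion_ball[OF \<Omega>(1) x] by blast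
      then have "x \<in> exhaustion \<Omega> p m" by (metis centre_in_ball subsetD)
      then obtain k where "x \<in> exhaustion \<Omega> p k" "\<forall>j<k. x \<notin> exhaustion \<Omega> p j"
        using exists_least_iff[of "\<lambda>k. x \<in> exhaustion \<Omega> p k"] by blast
      then show ?thesis by (rule \<rho>(2))
    qed
    then show "\<exists>\<rho>. admissible \<Omega> \<rho> \<and> (\<forall>x\<in>\<Omega>. \<rho> x \<le> 1 / real (Suc n))" using \<rho>(1) by blast
  qed
  then obtain \<rho> where \<rho>: "\<And>n. admissible \<Omega> (\<rho> n)" "\<And>n x. x \<in> \<Omega> \<Longrightarrow> \<rho> n x \<le> 1 / real (Suc n)" by metis
  define v where "v n x = indicator \<Omega> x * conv (\<rho> n x) u x" for n x
  have vm: "v n \<in> borel_measurable M" for n unfolding v_def[abs_def] by (rule conv_measurable[OF \<rho>(1) u])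
  have bound: "(\<integral>\<^sup>+y\<in>ball x0 R. ennreal (\<bar>v n y\<bar> powr q) \<partial>M) \<le> ennreal K" for n
    unfolding q_def
  proof (rule K)
    show "(\<lambda>y. \<bar>v n y\<bar>) \<in> borel_measurable M" using vm by measurable
    have "continuous_on \<Omega> (\<lambda>x. \<bar>conv (\<rho> n x) u x\<bar>)"
      by (intro continuous_intros conv_continuous_on[OF \<rho>(1) \<Omega>(1) u])
    then show "continuous_on \<Omega> (\<lambda>y. \<bar>v n y\<bar>)" by (rule continuous_on_eq) (simp add: v_def)
    show "local_lipschitz_gradient \<Omega> (\<lambda>y. \<bar>v n y\<bar>) (grad (\<rho> n))"
      by (rule local_lipschitz_gradient_cong[OF conv_grad[OF \<rho>(1)]]) (auto simp: v_def)
    show "grad (\<rho> n) \<in> borel_measurable M" by (rule grad_measurable[OF \<rho>(1)])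
    have "(\<integral>\<^sup>+y\<in>ball x0 ((1 + 2 * \<Lambda>) * R). ennreal \<bar>v n y\<bar> \<partial>M) \<le> (\<integral>\<^sup>+x\<in>\<Omega>. ennreal \<bar>conv (\<rho> n x) u x\<bar> \<partial>M)"
      by (intro nn_integral_mono) (auto simp: v_def indicator_def)
    then show "(\<integral>\<^sup>+y\<in>ball x0 ((1 + 2 * \<Lambda>) * R). ennreal \<bar>v n y\<bar> \<partial>M) \<le> ennreal A"
      using conv_integral[OF \<rho>(1)] unfolding A_def by (rule order.trans)
    have "(\<integral>\<^sup>+y\<in>ball x0 ((1 + 2 * \<Lambda>) * R). grad (\<rho> n) y \<partial>M) \<le> (\<integral>\<^sup>+x\<in>\<Omega>. grad (\<rho> n) x \<partial>M)"
      using B by (intro nn_integral_mono mult_left_mono) (auto simp: indicator_def subset_iff)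
    then show "(\<integral>\<^sup>+y\<in>ball x0 ((1 + 2 * \<Lambda>) * R). grad (\<rho> n) y \<partial>M) \<le> ennreal N"
      using grad_integral[OF \<rho>(1)] unfolding N_def by (rule order.trans)
  qed simp
  define w where "w n x = v n x - indicator \<Omega> x * u x" for n x
  have um: "(\<lambda>x. indicator \<Omega> x * u x) \<in> borel_measurable M" using u_measurable \<Omega>_sets by measurable
  have wm: "w n \<in> borel_measurable M" for n unfolding w_def[abs_def] using vm um by measurable
  have wn: "(\<integral>\<^sup>+x. ennreal (norm (w n x)) \<partial>M) \<le> ennreal (1 / real (Suc n) * err_const)" for n
  proof -
    have "(\<integral>\<^sup>+x. ennreal (norm (w n x)) \<partial>M) \<le> (\<integral>\<^sup>+x\<in>\<Omega>. kavg (\<rho> n x) (\<lambda>y. ennreal \<bar>u y - u x\<bar>) x \<partial>M)"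
    proof (rule nn_integral_mono)
      fix x
      show "ennreal (norm (w n x)) \<le> kavg (\<rho> n x) (\<lambda>y. ennreal \<bar>u y - u x\<bar>) x * indicator \<Omega> x"
        using abs_conv_minus_const_le[OF admissible_pos[OF \<rho>(1), of x] u, of n x "u x"]
          by (cases "x \<in> \<Omega>") (auto simp: w_def v_def)
    qed
    also have "\<dots> \<le> ennreal (1 / real (Suc n) * err_const)" by (intro kavg_error_integral \<rho>) auto
    finally show ?thesis .
  qed
  have wi: "integrable M (w n)" for n
  proof (rule integrableI_bounded[OF wm])
    show "(\<integral>\<^sup>+x. ennreal (norm (w n x)) \<partial>M) < \<infinity>" using wn[of n] by (rule order.strict_trans1) simp
  qed
  have w0: "(\<lambda>n. LINT x|M. norm (w n x)) \<longlonglongrightarrow> 0"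
  proof (rule tendsto_sandwich[of "\<lambda>_. 0" _ _ "\<lambda>n. err_const * inverse (real (Suc n))"])
    show "(\<lambda>n. err_const * inverse (real (Suc n))) \<longlonglongrightarrow> 0"
      using tendsto_mult_right_zero[OF LIMSEQ_inverse_real_of_nat, of err_const] by simp
    show "\<forall>\<^sub>F n in sequentially. (LINT x|M. norm (w n x)) \<le> err_const * inverse (real (Suc n))"
    proof (intro always_eventually allI)
      fix n
      have "ennreal (LINT x|M. norm (w n x)) = (\<integral>\<^sup>+x. ennreal (norm (w n x)) \<partial>M)"
        using wi[of n] by (intro nn_integral_eq_integral[symmetric]) auto
      then have "ennreal (LINT x|M. norm (w n x)) \<le> ennreal (1 / real (Suc n) * err_const)" using wn[of n]
        by simp
      then show "(LINT x|M. norm (w n x)) \<le> err_const * inverse (real (Suc n))"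
        using err_const_nonneg by (subst (asm) ennreal_le_iff) (auto simp: field_simps)
    qed
  qed auto
  \<comment> \<open>L^1 convergence gives pointwise convergence only along a subsequence, which is
    enough for Fatou's lemma.\<close>
  obtain \<sigma> where \<sigma>: "strict_mono \<sigma>" "AE x in M. (\<lambda>n. w (\<sigma> n) x) \<longlonglongrightarrow> 0"
    using tendsto_L1_AE_subseq[OF wi w0] by blast
  have "(\<integral>\<^sup>+y\<in>ball x0 R. ennreal (\<bar>u y\<bar> powr q) \<partial>M) \<le>
     (\<integral>\<^sup>+y. liminf (\<lambda>n. ennreal (\<bar>v (\<sigma> n) y\<bar> powr q) * indicator (ball x0 R) y) \<partial>M)"
  proof (rule nn_integral_mono_AE)
    show "AE y in M. ennreal (\<bar>u y\<bar> powr q) * indicator (ball x0 R) y \<le>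
       liminf (\<lambda>n. ennreal (\<bar>v (\<sigma> n) y\<bar> powr q) * indicator (ball x0 R) y)"
      using \<sigma>(2)
    proof eventually_elim
      fix y assume y: "(\<lambda>n. w (\<sigma> n) y) \<longlonglongrightarrow> 0"
      show "ennreal (\<bar>u y\<bar> powr q) * indicator (ball x0 R) y \<le>
         liminf (\<lambda>n. ennreal (\<bar>v (\<sigma> n) y\<bar> powr q) * indicator (ball x0 R) y)"
      proof (cases "y \<in> ball x0 R")
        case True
        have "ball x0 R \<subseteq> ball x0 ((1 + 2 * \<Lambda>) * R)" using R \<Lambda>_ge_1 by (intro subset_ball) simp
        then have "y \<in> \<Omega>" using True B by blast
        then have "(\<lambda>n. v (\<sigma> n) y - u y) \<longlonglongrightarrow> 0" using y by (simp add: w_def)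
        then have "(\<lambda>n. v (\<sigma> n) y) \<longlonglongrightarrow> u y" by (rule LIM_zero_cancel)
        then have "(\<lambda>n. ennreal (\<bar>v (\<sigma> n) y\<bar> powr q)) \<longlonglongrightarrow> ennreal (\<bar>u y\<bar> powr q)"
          using q_gt_1 by (intro tendsto_ennrealI tendsto_powr' tendsto_rabs tendsto_const) auto
        then have "liminf (\<lambda>n. ennreal (\<bar>v (\<sigma> n) y\<bar> powr q)) = ennreal (\<bar>u y\<bar> powr q)"
          by (intro lim_imp_Liminf) auto
        then show ?thesis using True by simp
      qed simp
    qed
  qed
  also have "\<dots> \<le> liminf (\<lambda>n. \<integral>\<^sup>+y\<in>ball x0 R. ennreal (\<bar>v (\<sigma> n) y\<bar> powr q) \<partial>M)"
  proof -
    note [measurable] = vm ball_in_sets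
    show ?thesis by (rule nn_integral_liminf) measurable
  qed
  also have "\<dots> \<le> liminf (\<lambda>n. ennreal K)" by (intro Liminf_mono always_eventually allI bound)
  also have "\<dots> < \<infinity>" by (simp add: Liminf_const)
  finally show ?thesis .
qed

lemma powr_integrable_compact:
  assumes K: "compact K" "K \<subseteq> \<Omega>"
  shows "(\<integral>\<^sup>+y\<in>K. ennreal (\<bar>u y\<bar> powr q) \<partial>M) < \<infinity>"
proof -
  have "\<exists>R>0. ball x ((1 + 2 * \<Lambda>) * R) \<subseteq> \<Omega>" if x: "x \<in> K" for x
  proof -
    obtain e where e: "e > 0" "ball x e \<subseteq> \<Omega>" using x K(2) \<Omega>(1) open_contains_ball by blast
    then show ?thesis using \<Lambda>_ge_1 by (intro exI[of _ "e / (1 + 2 * \<Lambda>)"]) auto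
  qed
  then obtain R where R: "\<And>x. x \<in> K \<Longrightarrow> 0 < R x \<and> ball x ((1 + 2 * \<Lambda>) * R x) \<subseteq> \<Omega>" by metis
  obtain I where I: "I \<subseteq> K" "finite I" "K \<subseteq> (\<Union>x\<in>I. ball x (R x))"
    by (rule compactE_image[OF K(1), of K "\<lambda>x. ball x (R x)"]) (use R in auto)
  have "(\<integral>\<^sup>+y\<in>K. ennreal (\<bar>u y\<bar> powr q) \<partial>M) \<le>
     (\<integral>\<^sup>+y. (\<Sum>x\<in>I. ennreal (\<bar>u y\<bar> powr q) * indicator (ball x (R x)) y) \<partial>M)"
  proof (rule nn_integral_mono)
    fix y
    show "ennreal (\<bar>u y\<bar> powr q) * indicator K y \<le>
       (\<Sum>x\<in>I. ennreal (\<bar>u y\<bar> powr q) * indicator (ball x (R x)) y)"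
    proof (cases "y \<in> K")
      case True
      then obtain x where x: "x \<in> I" "y \<in> ball x (R x)" using I(3) by blast
      have "ennreal (\<bar>u y\<bar> powr q) * indicator (ball x (R x)) y \<le>
         (\<Sum>x\<in>I. ennreal (\<bar>u y\<bar> powr q) * indicator (ball x (R x)) y)"
        using x(1) I(2) by (intro member_le_sum) auto
      then show ?thesis using True x(2) by simp
    qed simp
  qed
  also have "\<dots> = (\<Sum>x\<in>I. \<integral>\<^sup>+y\<in>ball x (R x). ennreal (\<bar>u y\<bar> powr q) \<partial>M)"
  proof -
    note [measurable] = u_measurable ball_in_sets
    show ?thesis by (rule nn_integral_sum) measurable
  qed
  also have "\<dots> < \<infinity>"
    using I R powr_integrable_ball by (auto simp: less_top[symmetric] subset_iff)
  finally show ?thesis .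
qed

end

subsection \<open>Approximation up to the boundary\<close>

definition truncate :: "real \<Rightarrow> real \<Rightarrow> real" where
  "truncate N t = max (- N) (min N t)"

lemma truncate_measurable [measurable]: "truncate N \<in> borel_measurable borel"
  unfolding truncate_def by measurable

lemma truncate_lipschitz: "\<bar>truncate N t - truncate N t'\<bar> \<le> \<bar>t - t'\<bar>"
  by (auto simp: truncate_def max_def min_def)

lemma truncate_bounds:
  assumes "0 \<le> N"
  shows "\<bar>truncate N t\<bar> \<le> N" "\<bar>truncate N t\<bar> \<le> \<bar>t\<bar>" "\<bar>t - truncate N t\<bar> \<le> \<bar>t\<bar>" "\<bar>t\<bar> \<le> N \<Longrightarrow> truncate N t = t"
  using assms by (auto simp: truncate_def max_def min_def)

context bv_space
begin

lemma kavg_error_measurable: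
  assumes "admissible \<Omega> \<rho>"
  shows "(\<lambda>x. kavg (\<rho> x) (\<lambda>y. ennreal \<bar>u y - u x\<bar>) x) \<in> borel_measurable M"
proof -
  have "(\<lambda>w. ennreal \<bar>u (snd w) - u (fst w)\<bar>) \<in> borel_measurable (M \<Otimes>\<^sub>M M)"
    by (intro measurable_compose[OF _ measurable_ennreal] borel_measurable_abs borel_measurable_diff
        measurable_compose[OF measurable_snd u_measurable] measurable_compose[OF measurable_fst u_measurable])
  then show ?thesis
    using admissible_measurable[OF assms] by (intro kavg_measurable_pair) (simp_all add: case_prod_beta')
qed

text \<open>
  Splitting off the truncation of \<open>u\<close> at height \<open>N\<close> reduces the \<open>L\<^sup>q\<close> error to the \<open>L\<^sup>1\<close> error of the
  bounded part and the \<open>L\<^sup>q\<close> norm of the unbounded part.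
\<close>

lemma conv_error_pointwise:
  assumes adm: "admissible \<Omega> \<rho>" and x: "x \<in> \<Omega>" and N: "0 \<le> N"
  shows "ennreal (\<bar>conv (\<rho> x) u x - u x\<bar> powr q) \<le> ennreal (3 powr q) *
     (kavg (\<rho> x) (\<lambda>y. ennreal (\<bar>u y - truncate N (u y)\<bar> powr q)) x
      + ennreal ((2 * N) powr (q - 1)) * kavg (\<rho> x) (\<lambda>y. ennreal \<bar>u y - u x\<bar>) x
      + ennreal (\<bar>u x - truncate N (u x)\<bar> powr q))"
proof -
  have p: "0 < \<rho> x" using adm x by (rule admissible_pos)
  note [measurable] = u_measurable
  define w where "w y = truncate N (u y)" for y
  have wm [measurable]: "w \<in> borel_measurable M" unfolding w_def by measurable
  have w: "integrable M w"
    using truncate_bounds(2)[OF N] by (intro Bochner_Integration.integrable_bound[OF u wm]) (auto simp: w_def)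
  have uw: "integrable M (\<lambda>y. u y - w y)" using u w by (rule Bochner_Integration.integrable_diff)
  define A where "A = \<bar>conv (\<rho> x) (\<lambda>y. u y - w y) x\<bar>"
  define B where "B = \<bar>conv (\<rho> x) w x - w x\<bar>"
  define D where "D = \<bar>u x - w x\<bar>"
  have "\<bar>conv (\<rho> x) u x - u x\<bar> \<le> A + B + D"
    unfolding A_def B_def D_def conv_diff[OF p u w] by linarith
  then have "\<bar>conv (\<rho> x) u x - u x\<bar> powr q \<le> (A + B + D) powr q"
    using q_gt_1 by (intro powr_mono2) auto
  also have "\<dots> \<le> 3 powr q * (A powr q + B powr q + D powr q)"
    using q_gt_1 by (intro powr_add3_le) (auto simp: A_def B_def D_def)
  finally have "ennreal (\<bar>conv (\<rho> x) u x - u x\<bar> powr q) \<le>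
     ennreal (3 powr q * (A powr q + B powr q + D powr q))"
    by (rule ennreal_leI)
  also have "\<dots> = ennreal (3 powr q) * (ennreal (A powr q) + ennreal (B powr q) + ennreal (D powr q))"
    by (simp add: ennreal_mult ennreal_plus)
  also have "\<dots> \<le> ennreal (3 powr q) *
     (kavg (\<rho> x) (\<lambda>y. ennreal (\<bar>u y - w y\<bar> powr q)) x
      + ennreal ((2 * N) powr (q - 1)) * kavg (\<rho> x) (\<lambda>y. ennreal \<bar>u y - u x\<bar>) x
      + ennreal (D powr q))"
  proof (intro mult_left_mono add_mono order.refl)
    show "ennreal (A powr q) \<le> kavg (\<rho> x) (\<lambda>y. ennreal (\<bar>u y - w y\<bar> powr q)) x"
      unfolding A_def by (rule conv_powr_le[OF p uw q_gt_1])
    have "ennreal B \<le> kavg (\<rho> x) (\<lambda>y. ennreal \<bar>w y - w x\<bar>) x"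
      unfolding B_def by (rule abs_conv_minus_const_le[OF p w])
    also have "\<dots> \<le> kavg (\<rho> x) (\<lambda>y. ennreal (2 * N)) x"
    proof (intro kavg_mono ennreal_leI)
      fix y show "\<bar>w y - w x\<bar> \<le> 2 * N"
        using truncate_bounds(1)[OF N, of "u y"] truncate_bounds(1)[OF N, of "u x"] by (auto simp: w_def)
    qed
    also have "\<dots> = ennreal (2 * N)" by (rule kavg_const[OF p])
    finally have BN: "B \<le> 2 * N" using N by (simp add: ennreal_le_iff)
    have B1: "ennreal B \<le> kavg (\<rho> x) (\<lambda>y. ennreal \<bar>u y - u x\<bar>) x"
      unfolding B_def
      by (rule order.trans[OF abs_conv_minus_const_le[OF p w] kavg_mono])
        (auto simp: w_def intro!: ennreal_leI truncate_lipschitz)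
    \<comment> \<open>Boundedness of the truncated part trades all but one power of its error for (2
      N)^(q-1), so the L^1 error estimate applies.\<close>
    have "B powr q = B powr (q - 1) * B" using powr_mult_base[of B "q - 1"] by (simp add: B_def mult.commute)
    also have "\<dots> \<le> (2 * N) powr (q - 1) * B"
      using BN q_gt_1 by (intro mult_right_mono powr_mono2) (auto simp: B_def)
    finally have "ennreal (B powr q) \<le> ennreal ((2 * N) powr (q - 1) * B)" by (rule ennreal_leI)
    also have "\<dots> = ennreal ((2 * N) powr (q - 1)) * ennreal B" by (intro ennreal_mult'') (simp add: B_def)
    also have "\<dots> \<le> ennreal ((2 * N) powr (q - 1)) * kavg (\<rho> x) (\<lambda>y. ennreal \<bar>u y - u x\<bar>) x"
      by (rule mult_left_mono[OF B1]) simp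
    finally show "ennreal (B powr q) \<le>
       ennreal ((2 * N) powr (q - 1)) * kavg (\<rho> x) (\<lambda>y. ennreal \<bar>u y - u x\<bar>) x" .
  qed auto
  finally show ?thesis unfolding w_def D_def .
qed

text \<open>The order of choices matters: the truncation height is taken so large that the unbounded
  part is small in L^q on a neighbourhood \<open>S'\<close> of \<open>K\<close>, and only then is
  the scale taken small compared with the factor (2 N)^(q-1) that this height produces. The same
  \<open>r\<close> serves for every admissible scale and every measurable subset of
  \<open>K\<close>.\<close>

lemma approximation:
  assumes K: "compact K" "K \<subseteq> \<Omega>" and a: "0 < a"
  shows "\<exists>r>0. \<forall>\<rho> S. admissible \<Omega> \<rho> \<longrightarrow> S \<in> sets M \<longrightarrow> S \<subseteq> K \<longrightarrow> (\<forall>x\<in>S. \<rho> x \<le> r) \<longrightarrow>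
    (\<integral>\<^sup>+x\<in>S. ennreal (\<bar>conv (\<rho> x) u x - u x\<bar> powr q) \<partial>M) \<le> ennreal a"
proof -
  note [measurable] = u_measurable
  obtain e where e: "0 < e" "(\<Union>x\<in>K. cball x e) \<subseteq> \<Omega>"
    using compact_subset_open_imp_cball_epsilon_subset[OF K(1) \<Omega>(1) K(2)] by blast
  define S' where "S' = (\<Union>x\<in>K. ball x (e/2))"
  have S'm [measurable]: "S' \<in> sets M" unfolding S'_def by (intro open_in_sets open_UN) auto
  have cl: "closure S' \<subseteq> \<Omega>"
  proof
    fix y assume "y \<in> closure S'"
    then obtain z where z: "z \<in> S'" "dist z y < e/2" using e(1) unfolding closure_approachable
      by (meson half_gt_zero)
    then obtain x where x: "x \<in> K" "dist x z < e/2" by (auto simp: S'_def)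
    have "y \<in> cball x e" using z x dist_triangle[of x y z] by auto
    then show "y \<in> \<Omega>" using e(2) x(1) by blast
  qed
  have "bounded S'"
  proof -
    obtain p b where "K \<subseteq> cball p b" using compact_imp_bounded[OF K(1)]
      by (meson bounded_def mem_cball subsetI)
    then have "S' \<subseteq> cball p (b + e)"
    proof (intro subsetI)
      fix y assume "K \<subseteq> cball p b" "y \<in> S'"
      then obtain x where x: "x \<in> K" "dist x y < e/2" by (auto simp: S'_def)
      then have "dist p x \<le> b" using \<open>K \<subseteq> cball p b\<close> by auto
      then show "y \<in> cball p (b + e)" using x dist_triangle[of p y x] e(1) by auto
    qed
    then show ?thesis by (rule bounded_subset[OF bounded_cball])
  qed
  then have "compact (closure S')" by (intro compact_closed_bounded) auto
  from powr_integrable_compact[OF this cl]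
  have fin: "(\<integral>\<^sup>+y\<in>S'. ennreal (\<bar>u y\<bar> powr q) \<partial>M) < \<infinity>"
  proof (rule order.strict_trans1[rotated])
    show "(\<integral>\<^sup>+y\<in>S'. ennreal (\<bar>u y\<bar> powr q) \<partial>M) \<le> (\<integral>\<^sup>+y\<in>closure S'. ennreal (\<bar>u y\<bar> powr q) \<partial>M)"
      using closure_subset[of S'] by (intro nn_integral_mono mult_left_mono) (auto simp: indicator_def)
  qed
  define E where "E n = (\<integral>\<^sup>+y\<in>S'. ennreal (\<bar>u y - truncate (real n) (u y)\<bar> powr q) \<partial>M)" for n
  have "E \<longlonglongrightarrow> (\<integral>\<^sup>+y. 0 \<partial>M)"
    unfolding E_def
  proof (rule nn_integral_dominated_convergence[where w = "\<lambda>y. ennreal (\<bar>u y\<bar> powr q) * indicator S' y"])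
    show "(\<integral>\<^sup>+y. ennreal (\<bar>u y\<bar> powr q) * indicator S' y \<partial>M) < \<infinity>" by (rule fin)
    show "AE y in M. ennreal (\<bar>u y - truncate (real n) (u y)\<bar> powr q) * indicator S' y \<le>
       ennreal (\<bar>u y\<bar> powr q) * indicator S' y" for n
      using q_gt_1 truncate_bounds(3)[of "real n"]
      by (intro AE_I2 mult_right_mono ennreal_leI powr_mono2) auto
    show "AE y in M. (\<lambda>n. ennreal (\<bar>u y - truncate (real n) (u y)\<bar> powr q) * indicator S' y) \<longlonglongrightarrow> 0"
    proof (rule AE_I2)
      fix y
      obtain n0 where n0: "\<bar>u y\<bar> \<le> real n0" using real_arch_simple by blast
      have "\<forall>\<^sub>F n in sequentially. ennreal (\<bar>u y - truncate (real n) (u y)\<bar> powr q) * indicator S' y = 0"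
        using eventually_ge_at_top[of n0]
      proof eventually_elim
        fix n assume "n0 \<le> n"
        then have "\<bar>u y\<bar> \<le> real n" using n0 by linarith
        then show "ennreal (\<bar>u y - truncate (real n) (u y)\<bar> powr q) * indicator S' y = 0"
          using truncate_bounds(4)[of "real n" "u y"] by simp
      qed
      then show "(\<lambda>n. ennreal (\<bar>u y - truncate (real n) (u y)\<bar> powr q) * indicator S' y) \<longlonglongrightarrow> 0"
        by (rule tendsto_eventually)
    qed
  qed measurable
  then have "(\<lambda>n. ennreal (3 powr q * (2 * \<kappa> ^ 3 + 1)) * E n) \<longlonglongrightarrow> ennreal (3 powr q * (2 * \<kappa> ^ 3 + 1)) * 0"
    by (intro ennreal_tendsto_cmult) auto
  then have "\<forall>\<^sub>F n in sequentially. ennreal (3 powr q * (2 * \<kappa> ^ 3 + 1)) * E n < ennreal (a / 2)"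
    using a by (intro order_tendstoD(2)[where y=0]) (auto simp: zero_less_iff_neq_zero)
  then obtain n where n: "ennreal (3 powr q * (2 * \<kappa> ^ 3 + 1)) * E n < ennreal (a / 2)"
    by (meson eventually_sequentially order.refl)
  define N where "N = real n"
  have N: "0 \<le> N" by (simp add: N_def)
  define Q where "Q = 3 powr q * (2 * N) powr (q - 1) * err_const"
  have Q: "0 \<le> Q" unfolding Q_def using err_const_nonneg by simp
  \<comment> \<open>The bound e/2 keeps the averaging balls inside \<open>S'\<close>, where the tail
    is small; the other bound makes the L^1 contribution at most a/2. The summand 1 guards against
    division by zero.\<close>
  define r where "r = min (e / 2) (a / (2 * (Q + 1)))"
  have r: "0 < r" using e a Q by (simp add: r_def add_nonneg_pos)
  have Qr: "Q * r \<le> a / 2"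
  proof -
    have "Q * r \<le> Q * (a / (2 * (Q + 1)))" using Q by (intro mult_left_mono) (auto simp: r_def)
    also have "\<dots> \<le> a / 2" using Q a by (simp add: field_simps add_nonneg_eq_0_iff)
    finally show ?thesis .
  qed
  show ?thesis
  proof (intro exI[of _ r] conjI r allI impI)
    fix \<rho> S assume adm: "admissible \<Omega> \<rho>" and Sm [measurable]: "S \<in> sets M" and SK: "S \<subseteq> K"
      and \<rho>r: "\<forall>x\<in>S. \<rho> x \<le> r"
    have S\<Omega>: "S \<subseteq> \<Omega>" using SK K(2) by blast
    have S': "ball x (\<rho> x) \<subseteq> S'" if "x \<in> S" for x
    proof -
      have "\<rho> x \<le> e / 2" using \<rho>r that by (auto simp: r_def)
      then have "ball x (\<rho> x) \<subseteq> ball x (e/2)" by (rule subset_ball)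
      then show ?thesis using that SK unfolding S'_def by blast
    qed
    define k1 where "k1 x = kavg (\<rho> x) (\<lambda>y. ennreal (\<bar>u y - truncate N (u y)\<bar> powr q)) x" for x
    define k2 where "k2 x = kavg (\<rho> x) (\<lambda>y. ennreal \<bar>u y - u x\<bar>) x" for x
    define g where "g x = ennreal (\<bar>u x - truncate N (u x)\<bar> powr q)" for x
    have gm [measurable]: "g \<in> borel_measurable M" unfolding g_def by measurable
    have k2m [measurable]: "k2 \<in> borel_measurable M" unfolding k2_def[abs_def]
      by (rule kavg_error_measurable[OF adm])
    have k1m [measurable]: "k1 \<in> borel_measurable M"
      unfolding k1_def[abs_def] g_def[symmetric]
      by (rule kavg_measurable_pair[OF admissible_measurable[OF adm]])
        (simp add: case_prod_beta' measurable_compose[OF measurable_snd gm])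
    have "(\<integral>\<^sup>+x\<in>S. ennreal (\<bar>conv (\<rho> x) u x - u x\<bar> powr q) \<partial>M) \<le>
      (\<integral>\<^sup>+x. ennreal (3 powr q) * ((k1 x * indicator S x + ennreal ((2 * N) powr (q - 1)) *
        (k2 x * indicator S x)) + g x * indicator S x) \<partial>M)"
    proof (rule nn_integral_mono)
      fix x
      show "ennreal (\<bar>conv (\<rho> x) u x - u x\<bar> powr q) * indicator S x \<le>
        ennreal (3 powr q) * ((k1 x * indicator S x + ennreal ((2 * N) powr (q - 1)) * (k2 x * indicator S x))
          + g x * indicator S x)"
        using conv_error_pointwise[OF adm _ N, of x] S\<Omega> by (cases "x \<in> S") (auto simp: k1_def k2_def g_def)
    qed
    also have "\<dots> = ennreal (3 powr q) * (((\<integral>\<^sup>+x\<in>S. k1 x \<partial>M) + ennreal ((2 * N) powr (q - 1)) *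
       (\<integral>\<^sup>+x\<in>S. k2 x \<partial>M)) + (\<integral>\<^sup>+x\<in>S. g x \<partial>M))"
      by (simp add: nn_integral_cmult nn_integral_add)
    also have "\<dots> \<le>
       ennreal (3 powr q) * ((ennreal (2 * \<kappa> ^ 3) * E n + ennreal ((2 * N) powr (q - 1)) * ennreal
      (r * err_const)) + E n)"
    proof (intro mult_left_mono add_mono)
      show "(\<integral>\<^sup>+x\<in>S. k1 x \<partial>M) \<le> ennreal (2 * \<kappa> ^ 3) * E n"
        unfolding k1_def E_def N_def[symmetric] g_def[symmetric]
          by (rule kavg_integral_le[OF adm \<Omega>(1) gm S\<Omega> S' S'm])
      show "(\<integral>\<^sup>+x\<in>S. k2 x \<partial>M) \<le> ennreal (r * err_const)"
        unfolding k2_def using \<rho>r r by (intro kavg_error_integral[OF adm S\<Omega>]) auto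
      have "S \<subseteq> S'" using S' admissible_pos[OF adm] S\<Omega> by (meson centre_in_ball subset_eq)
      then show "(\<integral>\<^sup>+x\<in>S. g x \<partial>M) \<le> E n"
        unfolding E_def N_def[symmetric] g_def[symmetric]
          by (intro nn_integral_mono mult_left_mono) (auto simp: indicator_def)
    qed auto
    also have "\<dots> = ennreal (3 powr q * (2 * \<kappa> ^ 3 + 1)) * E n + ennreal (Q * r)"
    proof -
      have 1: "ennreal (3 powr q * (2 * \<kappa> ^ 3 + 1)) = ennreal (3 powr q) * (ennreal (2 * \<kappa> ^ 3) + 1)"
        using \<kappa>_ge_1 by (subst ennreal_mult') (auto simp: ennreal_plus)
      have 2: "ennreal (Q * r) =
         ennreal (3 powr q) * (ennreal ((2 * N) powr (q - 1)) * ennreal (r * err_const))"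
      proof -
        have "ennreal ((2 * N) powr (q - 1)) * ennreal (r * err_const) =
           ennreal ((2 * N) powr (q - 1) * (r * err_const))"
          by (intro ennreal_mult'[symmetric]) simp
        moreover have "ennreal (3 powr q) * \<dots> = ennreal (3 powr q * ((2 * N) powr (q - 1) * (r * err_const)))"
          by (intro ennreal_mult'[symmetric]) simp
        ultimately show ?thesis by (simp add: Q_def ac_simps)
      qed
      show ?thesis unfolding 1 2 by (simp add: distrib_left distrib_right ac_simps)
    qed
    also have "\<dots> \<le> ennreal (a / 2) + ennreal (a / 2)" using n Qr by (intro add_mono ennreal_leI) auto
    also have "\<dots> = ennreal a" using a by (simp flip: ennreal_plus)
    finally show "(\<integral>\<^sup>+x\<in>S. ennreal (\<bar>conv (\<rho> x) u x - u x\<bar> powr q) \<partial>M) \<le> ennreal a" .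
  qed
qed

lemma open_measure_pos:
  assumes "open U" "x \<in> U" "bounded U"
  shows "0 < measure M U" "U \<in> fmeasurable M"
proof -
  show f: "U \<in> fmeasurable M"
    using emeasure_bounded_finite[OF assms(3)] open_in_sets[OF assms(1)] by (auto simp: fmeasurable_def)
  obtain e where e: "e > 0" "ball x e \<subseteq> U" using assms open_contains_ball by blast
  have "0 < vol x e" using e by (simp add: vol_pos)
  also have "\<dots> \<le> measure M U" unfolding vol_def using e(2) f by (intro measure_mono_fmeasurable) auto
  finally show "0 < measure M U" .
qed

text \<open>A boundary ball that meets \<open>K\<close> has radius above \<open>c\<close>, and for
  radii up to 1 its centre stays in a compact part \<open>F\<close> of the frontier. Cover
  \<open>F\<close> by finitely many balls of radius c/2: each meets \<Omega> in positive measure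
  because its centre is a limit of points of \<Omega>, and the boundary ball contains one of
  them.\<close>

lemma frontier_measure_bound:
  assumes K: "compact K" and c: "0 < c" "\<And>y z. y \<in> K \<Longrightarrow> z \<notin> \<Omega> \<Longrightarrow> c \<le> dist y z"
  shows "\<exists>m>0. \<forall>z\<in>frontier \<Omega>. \<forall>r\<le>1. ball z r \<inter> K \<noteq> {} \<longrightarrow> m \<le> measure M (ball z r \<inter> \<Omega>)"
proof -
  obtain p b where b: "K \<subseteq> cball p b" using compact_imp_bounded[OF K] by (meson bounded_def mem_cball subsetI)
  define F where "F = frontier \<Omega> \<inter> cball p (b + 1)"
  have "closed F" unfolding F_def by (intro closed_Int frontier_closed closed_cball)
  moreover have "bounded F" unfolding F_def by (rule bounded_subset[OF bounded_cball[of p "b + 1"]]) auto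
  ultimately have F: "compact F" by (rule compact_closed_bounded)
  have cov: "F \<subseteq> (\<Union>x\<in>F. ball x (c/2))" using c(1) by force
  obtain I where I: "I \<subseteq> F" "finite I" "F \<subseteq> (\<Union>x\<in>I. ball x (c/2))"
    by (rule compactE_image[OF F _ cov]) simp
  define m where "m = Min (insert 1 ((\<lambda>x. measure M (ball x (c/2) \<inter> \<Omega>)) ` I))"
  have "0 < measure M (ball x (c/2) \<inter> \<Omega>)" if "x \<in> I" for x
  proof -
    have "x \<in> frontier \<Omega>" using that I(1) by (auto simp: F_def)
    then have "x \<in> closure \<Omega>" by (simp add: frontier_def)
    then obtain y where "y \<in> \<Omega>" "dist y x < c/2" using c(1) unfolding closure_approachable
      by (meson half_gt_zero)
    then have "y \<in> ball x (c/2) \<inter> \<Omega>" by (simp add: dist_commute)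
    then show ?thesis using \<Omega>(1) by (intro open_measure_pos(1)[of _ y]) (auto intro: bounded_Int)
  qed
  then have m: "0 < m" unfolding m_def using I(2) by (subst Min_gr_iff) auto
  have "m \<le> measure M (ball z r \<inter> \<Omega>)" if z: "z \<in> frontier \<Omega>" and r: "r \<le> 1" and ne: "ball z r \<inter> K \<noteq> {}"
    for z r
  proof -
    obtain y where y: "y \<in> K" "dist z y < r" using ne by auto
    have "z \<notin> \<Omega>" using z \<Omega>(1) by (simp add: frontier_def interior_open)
    then have cr: "c < r" using c(2)[OF y(1), of z] y(2) by (simp add: dist_commute)
    have "dist p z \<le> dist p y + dist y z" by (rule dist_triangle)
    also have "\<dots> \<le> b + 1" using y b r by (auto simp: dist_commute)
    finally have "z \<in> F" using z by (simp add: F_def)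
    then obtain i where i: "i \<in> I" "dist i z < c/2" using I(3) by auto
    have sub: "ball i (c/2) \<subseteq> ball z r"
    proof
      fix w assume "w \<in> ball i (c/2)"
      then show "w \<in> ball z r" using i(2) cr dist_triangle[of z w i] by (auto simp: dist_commute)
    qed
    have "m \<le> measure M (ball i (c/2) \<inter> \<Omega>)" unfolding m_def using I(2) i(1) by (intro Min_le) auto
    also have "\<dots> \<le> measure M (ball z r \<inter> \<Omega>)"
    proof (rule measure_mono_fmeasurable)
      show "ball i (c/2) \<inter> \<Omega> \<subseteq> ball z r \<inter> \<Omega>" using sub by blast
      show "ball i (c/2) \<inter> \<Omega> \<in> sets M" using \<Omega>(1) by (intro open_in_sets) auto
      have "z \<in> closure \<Omega>" using z by (simp add: frontier_def)
      show "ball z r \<inter> \<Omega> \<in> fmeasurable M"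
        using emeasure_bounded_finite[of "ball z r \<inter> \<Omega>"] \<Omega>(1)
          by (auto simp: fmeasurable_def intro!: open_in_sets bounded_Int)
    qed
    finally show ?thesis .
  qed
  then show ?thesis using m by blast
qed

lemma conv_N11:
  assumes adm: "admissible \<Omega> \<rho>"
  shows "(\<lambda>x. ereal (conv (\<rho> x) u x)) \<in> N11 M \<Omega>"
proof -
  have "(\<lambda>x. conv (\<rho> x) u x) \<in> borel_measurable (restrict_space M \<Omega>)"
  proof -
    have "(\<lambda>x. indicator \<Omega> x * conv (\<rho> x) u x) \<in> borel_measurable (restrict_space M \<Omega>)"
      by (rule measurable_restrict_space1[OF conv_measurable[OF adm u]])
    moreover have "(\<lambda>x. indicator \<Omega> x * conv (\<rho> x) u x) \<in> borel_measurable (restrict_space M \<Omega>) \<longleftrightarrow>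
      (\<lambda>x. conv (\<rho> x) u x) \<in> borel_measurable (restrict_space M \<Omega>)"
      by (intro measurable_cong) (auto simp: space_restrict_space)
    ultimately show ?thesis by simp
  qed
  moreover have "L1_norm M \<Omega> (\<lambda>x. ereal (conv (\<rho> x) u x)) < \<infinity>"
  proof -
    have "L1_norm M \<Omega> (\<lambda>x. ereal (conv (\<rho> x) u x)) = (\<integral>\<^sup>+x\<in>\<Omega>. ennreal \<bar>conv (\<rho> x) u x\<bar> \<partial>M)"
      unfolding L1_norm_def by (simp add: e2ennreal_ereal)
    also have "\<dots> < \<infinity>" using conv_integral[OF adm] by (rule order.strict_trans1) simp
    finally show ?thesis .
  qed
  moreover have "(INF g \<in> {g. weak_upper_gradient M \<Omega> (\<lambda>x. ereal (conv (\<rho> x) u x)) g}. \<integral>\<^sup>+x\<in>\<Omega>. g x \<partial>M) < \<infinity>"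
  proof (rule order.strict_trans1)
    show "(INF g \<in> {g. weak_upper_gradient M \<Omega> (\<lambda>x. ereal (conv (\<rho> x) u x)) g}. \<integral>\<^sup>+x\<in>\<Omega>. g x \<partial>M) \<le>
       (\<integral>\<^sup>+x\<in>\<Omega>. grad \<rho> x \<partial>M)"
      by (intro INF_lower CollectI local_lipschitz_gradient_weak_upper_gradient[OF conv_grad[OF adm]]
          measurable_restrict_space1 grad_measurable[OF adm])
    show "(\<integral>\<^sup>+x\<in>\<Omega>. grad \<rho> x \<partial>M) < \<infinity>" using grad_integral[OF adm] by (rule order.strict_trans1) simp
  qed
  ultimately show ?thesis by (simp add: N11_def N11_norm_def)
qed

lemma conv_Lip_loc:
  assumes adm: "admissible \<Omega> \<rho>"
  shows "(\<lambda>x. conv (\<rho> x) u x) \<in> Lip_loc \<Omega>"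
  unfolding Lip_loc_def
proof safe
  fix \<Omega>' assume "compactly_inside \<Omega>' \<Omega>"
  then have c: "compact (closure \<Omega>')" "closure \<Omega>' \<subseteq> \<Omega>" by (auto simp: compactly_inside_def)
  have "grad \<rho> x < \<infinity>" for x unfolding grad_def osc_eq[OF u] by (simp add: ennreal_mult_less_top)
  then have "\<exists>L. L-lipschitz_on (closure \<Omega>') (\<lambda>x. conv (\<rho> x) u x)"
    using local_lipschitz_gradient_finite[OF conv_grad[OF adm]]
    by (intro lipschitz_on_compact[OF c] continuous_on_subset[OF conv_continuous_on[OF adm \<Omega>(1) u] c(2)])
      blast
  then show "\<exists>L. L-lipschitz_on \<Omega>' (\<lambda>x. conv (\<rho> x) u x)"
    using lipschitz_on_subset closure_subset by blast
qed

text \<open>A small ball about a boundary point reaches only shells of high index, and on each of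
  these the error is a small multiple of the measure of that very ball. The contributions form a
  geometric tail, which gives a bound independent of the boundary point.\<close>

lemma boundary_approximation:
  "\<exists>\<rho>. admissible \<Omega> \<rho> \<and> (\<forall>\<epsilon>>0. \<forall>\<^sub>F r in at_right (0::real). \<forall>z\<in>frontier \<Omega>.
     (\<integral>\<^sup>+y\<in>ball z r \<inter> \<Omega>. ennreal (\<bar>conv (\<rho> y) u y - u y\<bar> powr q) \<partial>M) < ennreal
       (\<epsilon> * measure M (ball z r \<inter> \<Omega>)))"
proof -
  fix p :: 'a
  define K where "K = exhaustion \<Omega> p"
  have K: "compact (K k)" "K k \<subseteq> \<Omega>" for k unfolding K_def by (rule compact_exhaustion, rule exhaustion_subset)
  have Kd: "1 / 2 ^ k \<le> dist y z" if "y \<in> K k" "z \<notin> \<Omega>" for k y z using that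
    by (simp add: K_def exhaustion_def)
  have "\<exists>m>0. \<forall>z\<in>frontier \<Omega>. \<forall>r\<le>1. ball z r \<inter> K k \<noteq> {} \<longrightarrow> m \<le> measure M (ball z r \<inter> \<Omega>)" for k
    by (rule frontier_measure_bound[OF K(1), of "1 / 2 ^ k"]) (auto intro: Kd)
  then obtain m where m: "\<And>k. 0 < m k"
    "\<And>k z r. z \<in> frontier \<Omega> \<Longrightarrow> r \<le> 1 \<Longrightarrow> ball z r \<inter> K k \<noteq> {} \<Longrightarrow> m k \<le> measure M (ball z r \<inter> \<Omega>)" by metis
  \<comment> \<open>The factor \<open>m k\<close> turns the error on the k-th shell into a multiple
    of the measure of any boundary ball that meets the k-th compact set; the factor 2^-k makes the
    errors summable.\<close>
  define a where "a k = (1/2) ^ k * m k" for k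
  have a: "0 < a k" for k using m(1) by (simp add: a_def)
  define good where "good k r \<longleftrightarrow> (\<forall>\<rho> S. admissible \<Omega> \<rho> \<longrightarrow> S \<in> sets M \<longrightarrow> S \<subseteq> K k \<longrightarrow> (\<forall>x\<in>S. \<rho> x \<le> r) \<longrightarrow>
    (\<integral>\<^sup>+x\<in>S. ennreal (\<bar>conv (\<rho> x) u x - u x\<bar> powr q) \<partial>M) \<le> ennreal (a k))" for k r
  have "\<exists>r>0. good k r" for k unfolding good_def by (rule approximation[OF K a])
  then have "\<forall>k. \<exists>r. 0 < r \<and> good k r" by blast
  from choice[OF this] obtain r where r: "\<And>k. 0 < r k" and good: "\<And>k. good k (r k)" by blast
  obtain \<rho> where adm: "admissible \<Omega> \<rho>" and \<rho>': "\<forall>k. \<forall>x\<in>K k. (\<forall>j<k. x \<notin> K j) \<longrightarrow> \<rho> x \<le> r k"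
    using ex_admissible[OF \<Omega>, of r p, OF r] unfolding K_def by (elim exE conjE)
  \<comment> \<open>On a shell the scale is controlled by the radius belonging to its own index,
    which is exactly the point set for which \<open>good\<close> is invoked.\<close>
  have \<rho>: "\<rho> x \<le> r k" if "x \<in> K k" "\<forall>j<k. x \<notin> K j" for k x
    using \<rho>' that by simp
  define S where "S k = K k - (\<Union>j<k. K j)" for k
  have KM: "K k \<in> sets M" for k using K(1) by (intro closed_in_sets compact_imp_closed)
  have SM [measurable]: "S k \<in> sets M" for k unfolding S_def using KM by (intro sets.Diff sets.finite_UN) auto
  have S\<Omega>: "S k \<subseteq> \<Omega>" for k using K(2) by (auto simp: S_def)
  have Scov: "\<exists>k. y \<in> S k" if y: "y \<in> \<Omega>" for y
  proof -
    obtain \<delta> n where "0 < \<delta>" "ball y \<delta> \<subseteq> K n" using exhaustion_ball[OF \<Omega>(1) y] unfolding K_def by blast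
    then have "y \<in> K n" by (metis centre_in_ball subsetD)
    then obtain k where "y \<in> K k" "\<forall>j<k. y \<notin> K j" using exists_least_iff[of "\<lambda>k. y \<in> K k"] by blast
    then show ?thesis by (auto simp: S_def)
  qed
  define F where "F y = ennreal (\<bar>conv (\<rho> y) u y - u y\<bar> powr q)" for y
  have Fm: "(\<lambda>y. F y * indicator \<Omega> y) \<in> borel_measurable M"
  proof -
    note [measurable] = u_measurable \<Omega>_sets
    define w where "w y = indicator \<Omega> y * conv (\<rho> y) u y" for y
    have [measurable]: "w \<in> borel_measurable M" unfolding w_def by (rule conv_measurable[OF adm u])
    have "(\<lambda>y. ennreal (\<bar>w y - u y\<bar> powr q) * indicator \<Omega> y) \<in> borel_measurable M" by measurable
    moreover have "(\<lambda>y. ennreal (\<bar>w y - u y\<bar> powr q) * indicator \<Omega> y) = (\<lambda>y. F y * indicator \<Omega> y)"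
      by (auto simp: w_def F_def indicator_def)
    ultimately show ?thesis by simp
  qed
  have FS: "(\<integral>\<^sup>+y\<in>S k. F y \<partial>M) \<le> ennreal (a k)" for k
  proof -
    have "S k \<subseteq> K k" "\<forall>x\<in>S k. \<rho> x \<le> r k" by (auto simp: S_def intro!: \<rho>)
    then show ?thesis using good[of k] adm SM unfolding good_def F_def by blast
  qed
  have "\<forall>\<^sub>F t in at_right (0::real). \<forall>z\<in>frontier \<Omega>.
     (\<integral>\<^sup>+y\<in>ball z t \<inter> \<Omega>. F y \<partial>M) < ennreal (\<epsilon> * measure M (ball z t \<inter> \<Omega>))" if \<epsilon>: "\<epsilon> > 0" for \<epsilon> :: real
  proof -
    obtain n0 where n0: "(1/2) ^ n0 < \<epsilon>" using real_arch_pow_inv[OF \<epsilon>, of "1/2"] by auto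
    have "\<forall>\<^sub>F t in at_right (0::real). t < (1/2) ^ n0"
      by (rule eventually_at_rightI[of 0 "(1/2) ^ n0"]) auto
    moreover have "\<forall>\<^sub>F t in at_right (0::real). 0 < t" by (rule eventually_at_right_less)
    ultimately show ?thesis
    proof eventually_elim
      case (elim t)
      show ?case
      proof
        fix z assume z: "z \<in> frontier \<Omega>"
        define B where "B = ball z t \<inter> \<Omega>"
        define \<mu> where "\<mu> = measure M B"
        have z\<Omega>: "z \<notin> \<Omega>" using z \<Omega>(1) by (simp add: frontier_def interior_open)
        have "z \<in> closure \<Omega>" using z by (simp add: frontier_def)
        then obtain y where "y \<in> \<Omega>" "dist y z < t" using elim(2) unfolding closure_approachable by blast
        then have "y \<in> B" by (simp add: B_def dist_commute)
        then have \<mu>: "0 < \<mu>" unfolding \<mu>_def B_def using \<Omega>(1)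
          by (intro open_measure_pos(1)[of _ y]) (auto intro: bounded_Int)
        have t1: "t \<le> 1" using elim(1) power_le_one[of "1/2::real" n0] by linarith
        have BM: "B \<in> sets M" unfolding B_def using \<Omega>(1) by (intro open_in_sets) auto
        \<comment> \<open>Points of the k-th compact set have distance at least 2^-k from the
          boundary point, so a ball of radius below 2^-n0 meets this set only if k > n0.\<close>
        have term_le: "(\<integral>\<^sup>+y\<in>B \<inter> S k. F y \<partial>M) \<le> ennreal ((if k < Suc n0 then 0 else (1/2) ^ k) * \<mu>)" for k
        proof (cases "ball z t \<inter> K k = {}")
          case True
          then have "B \<inter> S k = {}" by (auto simp: B_def S_def)
          then show ?thesis by simp
        next
          case False
          then obtain y where y: "y \<in> K k" "dist z y < t" by auto
          have "1 / 2 ^ k < t" using Kd[OF y(1) z\<Omega>] y(2) by (simp add: dist_commute)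
          then have "(1/2) ^ k < ((1/2) ^ n0 :: real)" using elim(1) by (simp add: power_one_over)
          then have "n0 < k" by (simp add: power_strict_decreasing_iff)
          have "(\<integral>\<^sup>+y\<in>B \<inter> S k. F y \<partial>M) \<le> (\<integral>\<^sup>+y\<in>S k. F y \<partial>M)"
            by (intro nn_integral_mono) (auto simp: indicator_def)
          also have "\<dots> \<le> ennreal (a k)" by (rule FS)
          also have "a k \<le> (1/2) ^ k * \<mu>" unfolding a_def \<mu>_def B_def using m(2)[OF z t1 False]
            by (intro mult_left_mono) auto
          finally show ?thesis using \<open>n0 < k\<close> by (simp add: ennreal_leI)
        qed
        have "(\<integral>\<^sup>+y\<in>B. F y \<partial>M) \<le> (\<integral>\<^sup>+y. (\<Sum>k. F y * indicator (B \<inter> S k) y) \<partial>M)"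
        proof (rule nn_integral_mono)
          fix y
          show "F y * indicator B y \<le> (\<Sum>k. F y * indicator (B \<inter> S k) y)"
          proof (cases "y \<in> B")
            case True
            then obtain k where k: "y \<in> S k" using Scov by (auto simp: B_def)
            define f where "f k = F y * indicator (B \<inter> S k) y" for k
            have "f k \<le> (\<Sum>k. f k)" using sum_le_suminf[of f "{k}"] by simp
            then show ?thesis using True k by (simp add: f_def)
          qed simp
        qed
        also have "\<dots> = (\<Sum>k. \<integral>\<^sup>+y\<in>B \<inter> S k. F y \<partial>M)"
        proof (rule nn_integral_suminf)
          fix k
          have "(\<lambda>y. (F y * indicator \<Omega> y) * indicator (B \<inter> S k) y) \<in> borel_measurable M"
            using BM SM by (intro borel_measurable_times_ennreal[OF Fm] borel_measurable_indicator sets.Int)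
          moreover have "(\<lambda>y. (F y * indicator \<Omega> y) * indicator (B \<inter> S k) y) =
             (\<lambda>y. F y * indicator (B \<inter> S k) y)"
            by (auto simp: B_def indicator_def)
          ultimately show "(\<lambda>y. F y * indicator (B \<inter> S k) y) \<in> borel_measurable M" by simp
        qed
        also have "\<dots> \<le> ennreal ((1/2) ^ n0 * \<mu>)"
        proof (rule suminf_le_const[OF summableI])
          fix n
          have "(\<Sum>k<n. \<integral>\<^sup>+y\<in>B \<inter> S k. F y \<partial>M) \<le> (\<Sum>k<n. ennreal ((if k < Suc n0 then 0 else (1/2) ^ k) * \<mu>))"
            by (rule sum_mono[OF term_le])
          also have "\<dots> = ennreal (\<Sum>k<n. (if k < Suc n0 then 0 else (1/2) ^ k) * \<mu>)"
            using \<mu> by (intro sum_ennreal) auto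
          also have "\<dots> \<le> ennreal ((1/2) ^ n0 * \<mu>)"
          proof (rule ennreal_leI)
            \<comment> \<open>The sum starts at index n0 + 1, so the factor 2 of the geometric tail
              is absorbed and 2^-n0 remains.\<close>
            have "(\<Sum>k<n. (if k < Suc n0 then 0 else (1/2) ^ k) * \<mu>) \<le> 2 * (1/2) ^ Suc n0 * \<mu>"
              unfolding sum_distrib_right[symmetric] using \<mu> by (intro mult_right_mono sum_tail_half_le) auto
            then show "(\<Sum>k<n. (if k < Suc n0 then 0 else (1/2) ^ k) * \<mu>) \<le> (1/2) ^ n0 * \<mu>" by simp
          qed
          finally show "(\<Sum>k<n. \<integral>\<^sup>+y\<in>B \<inter> S k. F y \<partial>M) \<le> ennreal ((1/2) ^ n0 * \<mu>)" .
        qed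
        also have "\<dots> < ennreal (\<epsilon> * \<mu>)"
          using n0 \<mu> \<epsilon> by (intro ennreal_lessI mult_strict_right_mono) auto
        finally show "(\<integral>\<^sup>+y\<in>ball z t \<inter> \<Omega>. F y \<partial>M) < ennreal (\<epsilon> * measure M (ball z t \<inter> \<Omega>))"
          by (simp add: B_def \<mu>_def)
      qed
    qed
  qed
  then show ?thesis using adm unfolding F_def by blast
qed

end

section \<open>From the outer measure to the abstract setting\<close>

lemma doubling_measure_cmeasure:
  fixes \<mu> :: "'a::complete_space set \<Rightarrow> ennreal"
  assumes reg: "borel_regular_outer_measure \<mu>" and dbl: "doubling \<mu> C"
  shows "doubling_measure (cmeasure \<mu>) C"
proof -
  have om: "outer_measure_space UNIV \<mu>" using reg by (simp add: borel_regular_outer_measure_def)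
  note bs = sets_borel_subset_cmeasure[OF reg]
  have em: "emeasure (cmeasure \<mu>) A = \<mu> A" if "A \<in> sets (cmeasure \<mu>)" for A
    using that emeasure_cmeasure[OF om] sets_cmeasure[OF om] by simp
  have ball: "emeasure (cmeasure \<mu>) (ball x r) = \<mu> (ball x r)" for x r
    using bs by (intro em) auto
  have C: "1 \<le> C" using dbl by (simp add: doubling_def)
  have D: "0 < \<mu> (ball x (2 * r))" "\<mu> (ball x (2 * r)) \<le> ennreal C * \<mu> (ball x r)" "ennreal C * \<mu> (ball x r) <
     \<infinity>" if "0 < r" for x r
    using dbl that by (auto simp: doubling_def)
  show ?thesis
  proof
    show "space (cmeasure \<mu>) = UNIV" by (rule space_cmeasure[OF om])
    show "sets borel \<subseteq> sets (cmeasure \<mu>)" by (rule bs)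
    show "1 \<le> C" by (rule C)
    show "0 < emeasure (cmeasure \<mu>) (ball x r)" if "0 < r" for r x
      using D(1)[of "r/2" x] that by (simp add: ball)
    show "emeasure (cmeasure \<mu>) (ball x r) < \<infinity>" for x r
    proof (cases "0 < r")
      case True
      have "1 * \<mu> (ball x r) \<le> ennreal C * \<mu> (ball x r)" using C by (intro mult_right_mono) auto
      then show ?thesis using D(3)[OF True, of x] unfolding ball by (simp add: order.strict_trans1)
    next
      case False
      then have "ball x r = {}" by (simp add: not_less)
      then show ?thesis by (simp only: emeasure_empty) simp
    qed
    show "emeasure (cmeasure \<mu>) (ball x (2 * r)) \<le> ennreal C * emeasure (cmeasure \<mu>) (ball x r)" if "0 < r"
      for r x
      unfolding ball by (rule D(2)[OF that])
    show "\<exists>B\<in>sets borel. A \<subseteq> B \<and> emeasure (cmeasure \<mu>) B = emeasure (cmeasure \<mu>) A"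
      if A: "A \<in> sets (cmeasure \<mu>)" for A
    proof -
      obtain B where B: "B \<in> sets borel" "A \<subseteq> B" "\<mu> B = \<mu> A"
        using reg unfolding borel_regular_outer_measure_def by blast
      then show ?thesis using em[OF A] em[of B] bs by (intro bexI[of _ B]) auto
    qed
  qed
qed

theorem theorem1p2:
  fixes \<mu> :: "'a::complete_space set \<Rightarrow> ennreal"
    and C\<^sub>d C\<^sub>P \<Lambda> s :: real
    and \<Omega> :: "'a set"
    and u :: "'a \<Rightarrow> ereal"
  assumes "borel_regular_outer_measure \<mu>"
    and "doubling \<mu> C\<^sub>d"
    and "1 < s" and "log 2 C\<^sub>d \<le> s"
    and "poincare_inequality (cmeasure \<mu>) C\<^sub>P \<Lambda>"
    and "open \<Omega>" and "\<Omega> \<noteq> {}"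
    and "u \<in> BV (cmeasure \<mu>) \<Omega>"
  shows "\<exists>v :: 'a \<Rightarrow> real.
    (\<lambda>x. ereal (v x)) \<in> N11 (cmeasure \<mu>) \<Omega> \<and> v \<in> Lip_loc \<Omega> \<and>
    (\<forall>\<epsilon>>0. \<forall>\<^sub>F r in at_right (0::real). \<forall>z\<in>frontier \<Omega>.
       (\<integral>\<^sup>+y\<in>ball z r \<inter> \<Omega>. ennreal_powr (e2ennreal \<bar>ereal (v y) - u y\<bar>) (s / (s - 1)) \<partial>cmeasure \<mu>)
         / \<mu> (ball z r \<inter> \<Omega>) < ennreal \<epsilon>)"
proof -
  define M where "M = cmeasure \<mu>"
  have om: "outer_measure_space UNIV \<mu>" using assms(1) by (simp add: borel_regular_outer_measure_def)
  interpret doubling_measure M C\<^sub>d unfolding M_def by (rule doubling_measure_cmeasure[OF assms(1,2)])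
  interpret sobolev_space M C\<^sub>d C\<^sub>P \<Lambda> s
  proof
    show "poincare_inequality M C\<^sub>P \<Lambda>" using assms(5) by (simp add: M_def)
    show "1 < s" by fact
    show "C\<^sub>d \<le> 2 powr s" using assms(4) C_ge_1 by (simp add: log_le_iff)
  qed
  note \<Omega>M = open_in_sets[OF assms(6)]
  \<comment> \<open>Real-valued zero extension of \<open>u\<close>; infinite values of
    \<open>u\<close> become 0.\<close>
  define f where "f y = real_of_ereal (u y) * indicator \<Omega> y" for y
  have u: "u \<in> borel_measurable (restrict_space M \<Omega>)" "L1_norm M \<Omega> u < \<infinity>" "total_variation M \<Omega> u < \<infinity>"
    using assms(8) by (auto simp: BV_def L1_def M_def)
  have "(\<lambda>y. real_of_ereal (u y)) \<in> borel_measurable (restrict_space M \<Omega>)"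
    using u(1) by (rule borel_measurable_real_of_ereal)
  then have fm: "f \<in> borel_measurable M"
    unfolding f_def using \<Omega>M by (subst (asm) borel_measurable_restrict_space_iff) (auto simp: mult.commute)
  have absu: "(\<lambda>y. e2ennreal \<bar>u y\<bar> * indicator \<Omega> y) \<in> borel_measurable M"
  proof -
    have "(\<lambda>y. e2ennreal \<bar>u y\<bar>) \<in> borel_measurable (restrict_space M \<Omega>)" using u(1) by measurable
    then show ?thesis using \<Omega>M by (subst (asm) borel_measurable_restrict_space_iff_ennreal) auto
  qed
  have fi: "integrable M f"
  proof (rule integrableI_bounded[OF fm])
    have "(\<integral>\<^sup>+y. ennreal (norm (f y)) \<partial>M) \<le> L1_norm M \<Omega> u"
      unfolding L1_norm_def
    proof (rule nn_integral_mono)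
      fix y show "ennreal (norm (f y)) \<le> e2ennreal \<bar>u y\<bar> * indicator \<Omega> y"
        by (cases "u y") (auto simp: f_def indicator_def e2ennreal_ereal)
    qed
    then show "(\<integral>\<^sup>+y. ennreal (norm (f y)) \<partial>M) < \<infinity>" using u(2) by (rule order.strict_trans1)
  qed
  \<comment> \<open>Integrability confines the infinite values of \<open>u\<close> to a null set, so
    \<open>f\<close> may replace \<open>u\<close> in the final integrals.\<close>
  have ufin: "AE y in M. y \<in> \<Omega> \<longrightarrow> u y = ereal (f y)"
  proof -
    have "AE y in M. e2ennreal \<bar>u y\<bar> * indicator \<Omega> y \<noteq> \<infinity>"
      using u(2) unfolding L1_norm_def by (intro nn_integral_PInf_AE absu) auto
    then show ?thesis
    proof eventually_elim
      fix y assume y: "e2ennreal \<bar>u y\<bar> * indicator \<Omega> y \<noteq> \<infinity>"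
      show "y \<in> \<Omega> \<longrightarrow> u y = ereal (f y)" using y by (cases "u y") (auto simp: f_def)
    qed
  qed
  \<comment> \<open>A finite infimum yields one approximating sequence with finite lower limit; this
    single sequence serves for all admissible scales, and only a finite bound matters.\<close>
  obtain w g where w: "\<And>i. w i \<in> N11_loc M \<Omega>" "\<And>i. minimal_weak_upper_gradient M \<Omega> (w i) (g i)"
    "converges_L1_loc M \<Omega> w u" "liminf (\<lambda>i. \<integral>\<^sup>+x\<in>\<Omega>. g i x \<partial>M) < \<infinity>"
    using u(3) unfolding total_variation_def Inf_less_iff by blast
  obtain L where L: "liminf (\<lambda>i. \<integral>\<^sup>+x\<in>\<Omega>. g i x \<partial>M) = ennreal L" "0 \<le> L"
    using w(4) by (cases "liminf (\<lambda>i. \<integral>\<^sup>+x\<in>\<Omega>. g i x \<partial>M)") auto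
  interpret bv_space M C\<^sub>d C\<^sub>P \<Lambda> s \<Omega> f "4 * C\<^sub>P * (\<kappa> * \<kappa>) * L"
  proof
    show "open \<Omega>" "\<Omega> \<noteq> {}" by fact+
    show "integrable M f" by (rule fi)
    show "0 \<le> 4 * C\<^sub>P * (\<kappa> * \<kappa>) * L" using CP_pos \<kappa>_ge_1 L(2) by simp
    fix \<rho> assume adm: "admissible \<Omega> \<rho>"
    have "(\<integral>\<^sup>+x\<in>\<Omega>. ennreal (1 / \<rho> x) * osc f x (4 * \<rho> x) \<partial>M)
      \<le> ennreal (4 * C\<^sub>P * (\<kappa> * \<kappa>)) * liminf (\<lambda>i. \<integral>\<^sup>+x\<in>\<Omega>. g i x \<partial>M)"
      using w by (intro osc_integral_le_variation[OF adm assms(6) fi, of u w])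
        (auto simp: f_def minimal_weak_upper_gradient_def)
    also have "\<dots> = ennreal (4 * C\<^sub>P * (\<kappa> * \<kappa>) * L)" unfolding L(1) using L(2)
      by (intro ennreal_mult''[symmetric])
    finally show "(\<integral>\<^sup>+x\<in>\<Omega>. ennreal (1 / \<rho> x) * osc f x (4 * \<rho> x) \<partial>M) \<le> ennreal (4 * C\<^sub>P * (\<kappa> * \<kappa>) * L)" .
  qed
  obtain \<rho> where adm: "admissible \<Omega> \<rho>" and lim: "\<And>\<epsilon>. \<epsilon> > 0 \<Longrightarrow> \<forall>\<^sub>F r in at_right (0::real). \<forall>z\<in>frontier \<Omega>.
     (\<integral>\<^sup>+y\<in>ball z r \<inter> \<Omega>. ennreal (\<bar>conv (\<rho> y) f y - f y\<bar> powr q) \<partial>M) < ennreal (\<epsilon> * measure M (ball z r \<inter> \<Omega>))"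
    using boundary_approximation by blast
  define v where "v x = conv (\<rho> x) f x" for x
  have "\<forall>\<^sub>F r in at_right (0::real). \<forall>z\<in>frontier \<Omega>.
       (\<integral>\<^sup>+y\<in>ball z r \<inter> \<Omega>. ennreal_powr (e2ennreal \<bar>ereal (v y) - u y\<bar>) (s / (s - 1)) \<partial>M)
         / \<mu> (ball z r \<inter> \<Omega>) < ennreal \<epsilon>" if \<epsilon>: "0 < \<epsilon>" for \<epsilon>
    using lim[OF \<epsilon>]
  proof eventually_elim
    fix r assume *: "\<forall>z\<in>frontier \<Omega>. (\<integral>\<^sup>+y\<in>ball z r \<inter> \<Omega>. ennreal (\<bar>conv (\<rho> y) f y - f y\<bar> powr q) \<partial>M) <
       ennreal (\<epsilon> * measure M (ball z r \<inter> \<Omega>))"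
    show "\<forall>z\<in>frontier \<Omega>. (\<integral>\<^sup>+y\<in>ball z r \<inter> \<Omega>. ennreal_powr (e2ennreal \<bar>ereal (v y) - u y\<bar>) (s / (s - 1)) \<partial>M)
         / \<mu> (ball z r \<inter> \<Omega>) < ennreal \<epsilon>"
    proof
      fix z assume z: "z \<in> frontier \<Omega>"
      define B where "B = ball z r \<inter> \<Omega>"
      have BM: "B \<in> sets M" unfolding B_def using assms(6) by (intro open_in_sets) auto
      have "(\<integral>\<^sup>+y\<in>B. ennreal_powr (e2ennreal \<bar>ereal (v y) - u y\<bar>) (s / (s - 1)) \<partial>M) =
         (\<integral>\<^sup>+y\<in>B. ennreal (\<bar>v y - f y\<bar> powr q) \<partial>M)"
      proof (rule nn_integral_cong_AE)
        show "AE y in M. ennreal_powr (e2ennreal \<bar>ereal (v y) - u y\<bar>) (s / (s - 1)) * indicator B y =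
           ennreal (\<bar>v y - f y\<bar> powr q) * indicator B y"
          using ufin by eventually_elim (auto simp: B_def indicator_def e2ennreal_ereal ennreal_powr_def
            q_def)
      qed
      also have "\<dots> < ennreal (\<epsilon> * measure M B)" using bspec[OF * z] by (simp add: B_def v_def)
      finally have lt: "(\<integral>\<^sup>+y\<in>B. ennreal_powr (e2ennreal \<bar>ereal (v y) - u y\<bar>) (s / (s - 1)) \<partial>M) <
         ennreal (\<epsilon> * measure M B)" .
      have "emeasure M B < \<infinity>" by (rule emeasure_bounded_finite) (simp add: B_def bounded_Int)
      then have em: "emeasure M B = ennreal (measure M B)" by (intro emeasure_eq_ennreal_measure) auto
      have \<mu>B: "\<mu> B = ennreal (measure M B)"
        using emeasure_cmeasure[OF om, of B] BM em sets_cmeasure[OF om] by (simp add: M_def)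
      \<comment> \<open>The strict inequality \<open>lt\<close> already rules out measure zero, so
        the division is by a positive finite number.\<close>
      have "measure M B \<noteq> 0" using lt by (intro notI) simp
      then have "0 < measure M B" by (simp add: less_le)
      then show "(\<integral>\<^sup>+y\<in>ball z r \<inter> \<Omega>. ennreal_powr (e2ennreal \<bar>ereal (v y) - u y\<bar>) (s / (s - 1)) \<partial>M) / \<mu>
         (ball z r \<inter> \<Omega>) < ennreal \<epsilon>"
        unfolding B_def[symmetric] \<mu>B using lt \<epsilon>
        by (subst divide_less_ennreal) (auto simp: ennreal_mult)
    qed
  qed
  moreover have "(\<lambda>x. ereal (v x)) \<in> N11 M \<Omega>" "v \<in> Lip_loc \<Omega>"
    unfolding v_def by (rule conv_N11[OF adm], rule conv_Lip_loc[OF adm])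
  ultimately show ?thesis unfolding M_def by (intro exI[of _ v] conjI allI impI)
qed

end
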